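(* Let $p$ be an odd prime, let $F/\mathbb{Q}$ be a cyclic extension of degree $p$, let $K=\mathbb{Q}(\zeta_p)$ and $L=FK$, with $\Phi$, $I_i(x)$ and $\chi$ as defined in the context. Let $x\in L^{*}$ with $\mathrm{N}_{L/\mathbb{Q}}(x)=\pm q_1^{l_1}\cdots q_n^{l_n}$, where $n\ge 0$, $l_i\in\mathbb{Z}\setminus\{0\}$ and the $q_i$ are distinct rational primes, and assume that every prime ideal of $\mathcal{O}_L$ occurring with nonzero exponent in the factorization of $\mathcal{O}_L x$ lies above one of $q_1,\dots,q_n$. Then the principal fractional ideal $\mathcal{O}_L\,\Phi(\mathrm{N}_{L/K}(x))$ is not the $p$-th power of a fractional ideal of $L$ if and only if $n>0$ and there exists an $i\in\{1,\dots,n\}$ such that (a) $q_i$ splits completely in $L$, and (b) $p$ does not divide $\chi(I_i(x))$.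
   Context: $\zeta_p$ is a fixed primitive $p$-th root of unity and all fields lie in a fixed algebraic closure of $\mathbb{Q}$. $\mathcal{O}_N$ denotes the ring of integers of a number field $N$. Let $\bar\tau$ be a fixed generator of $\mathrm{Gal}(L/F)$; its restriction $\tau=\bar\tau|_K$ generates $\mathrm{Gal}(K/\mathbb{Q})$ (cyclic of order $p-1$). Let $e$ be a primitive root modulo $p$. The homomorphism $\Phi:L^*\to L^*$ is $$\Phi(y)=\prod_{j=0}^{p-2}\bar\tau^{j}(y)^{e^{p-2-j}}=y^{e^{p-2}}\,\bar\tau(y)^{e^{p-3}}\cdots\bar\tau^{p-2}(y).$$ For $x$ as in the claim, write $\mathcal{O}_Lx=J_1(x)\cdots J_n(x)$, where $J_i(x)$ is the fractional ideal of $L$ all of whose prime factors lie above $q_i$; then $\mathrm{N}_{L/\mathbb{Q}}(J_i(x))=\mathbb{Z}q_i^{l_i}$. Put $I_i(x)=\mathrm{N}_{L/K}(J_i(x))$ (ideal norm), a fractional ideal of $K$ with $\mathrm{N}_{K/\mathbb{Q}}(I_i(x))=\mathbb{Z}q_i^{l_i}$. If $q_i$ splits completely in $K$, let $P_1,\dots,P_{p-1}$ be the distinct prime ideals of $\mathcal{O}_K$ above $q_i$, numbered so that $\tau(P_j)=P_{j+1}$ for $1\le j\le p-2$ and $\tau(P_{p-1})=P_1$. Writing $I_i(x)=P_1^{\beta_1}\cdots P_{p-1}^{\beta_{p-1}}$ with $\beta_j\in\mathbb{Z}$, define $$\chi(I_i(x))=e^{p-2}\beta_1+e^{p-3}\beta_{p-1}+e^{p-4}\beta_{p-2}+\cdots+e\beta_3+\beta_2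 .$$ Whether $p$ divides $\chi(I_i(x))$ does not depend on the choice of $P_1$. *)

theory Defs
  imports "HOL-Algebra.Algebra" "HOL-Algebra.Algebraic_Closure_Type"
    "HOL-Number_Theory.Residue_Primitive_Roots"
begin

text \<open>
  All fields are subfields of the complex numbers; finite extensions of the rationals then
  automatically lie in one fixed algebraic closure. Subfields and rings of integers are treated as
  subsets of the following ring, by changing its carrier.
\<close>

abbreviation CC :: "complex ring" where
  "CC \<equiv> ring_of_type_algebra"

definition primitive_root_of_unity :: "nat \<Rightarrow> complex \<Rightarrow> bool" where
  "primitive_root_of_unity m z \<longleftrightarrow> z ^ m = 1 \<and> (\<forall>k. 0 < k \<and> k < m \<longrightarrow> z ^ k \<noteq> 1)"

text \<open>Automorphisms of \<open>L\<close> are extensional: they take the value \<open>undefined\<close> outside \<open>L\<close>.\<close>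

definition galois_group :: "complex set \<Rightarrow> complex set \<Rightarrow> (complex \<Rightarrow> complex) monoid" where
  "galois_group K L = BijGroup L
     \<lparr>carrier := {\<sigma> \<in> Bij L. \<sigma> \<in> ring_hom (CC\<lparr>carrier := L\<rparr>) (CC\<lparr>carrier := L\<rparr>) \<and> (\<forall>a\<in>K. \<sigma> a = a)}\<rparr>"

definition cyclic_extension :: "nat \<Rightarrow> complex set \<Rightarrow> complex set \<Rightarrow> bool" where
  "cyclic_extension m K L \<longleftrightarrow>
     subfield K CC \<and> subfield L CC \<and> K \<subseteq> L \<and> ring.dimension CC m K L \<and>
     {a \<in> L. \<forall>\<sigma>\<in>carrier (galois_group K L). \<sigma> a = a} = K \<and>
     cyclic_group (galois_group K L)"

definition embeddings :: "complex set \<Rightarrow> complex set \<Rightarrow> (complex \<Rightarrow> complex) set" where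
  "embeddings K L =
     {\<sigma> \<in> ring_hom (CC\<lparr>carrier := L\<rparr>) CC. \<sigma> \<in> extensional L \<and> (\<forall>a\<in>K. \<sigma> a = a)}"

definition field_norm :: "complex set \<Rightarrow> complex set \<Rightarrow> complex \<Rightarrow> complex" where
  "field_norm K L x = (\<Prod>\<sigma>\<in>embeddings K L. \<sigma> x)"

definition integers_of :: "complex set \<Rightarrow> complex set" where
  "integers_of L = {a \<in> L. algebraic_int a}"

definition prime_ideals :: "complex set \<Rightarrow> complex set set" where
  "prime_ideals L = {P. primeideal P (CC\<lparr>carrier := integers_of L\<rparr>) \<and> P \<noteq> {0}}"

definition lies_above :: "complex set \<Rightarrow> nat \<Rightarrow> bool" where
  "lies_above P q \<longleftrightarrow> P \<inter> \<int> = range (\<lambda>k. of_int (int q * k))"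

definition fractional_ideal :: "complex set \<Rightarrow> complex set \<Rightarrow> bool" where
  "fractional_ideal L I \<longleftrightarrow>
     I \<subseteq> L \<and> 0 \<in> I \<and> I \<noteq> {0} \<and>
     (\<forall>a\<in>I. \<forall>b\<in>I. a + b \<in> I) \<and> (\<forall>r\<in>integers_of L. \<forall>a\<in>I. r * a \<in> I) \<and>
     (\<exists>d\<in>integers_of L. d \<noteq> 0 \<and> (\<forall>a\<in>I. d * a \<in> integers_of L))"

text \<open>
  \<open>ideal_prod\<close> consists of the finite sums of products; it uses only the operations
  of its ring argument, so it also multiplies fractional ideals.
\<close>

definition ideal_group :: "complex set \<Rightarrow> complex set monoid" where
  "ideal_group L =
     \<lparr>carrier = {I. fractional_ideal L I}, monoid.mult = ideal_prod CC, one = integers_of L\<rparr>"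

definition principal_ideal :: "complex set \<Rightarrow> complex \<Rightarrow> complex set" where
  "principal_ideal L x = {a * x | a. a \<in> integers_of L}"

text \<open>The description is well defined for \<open>L\<close> a number field, by unique factorization into primes.\<close>

definition ideal_exponents :: "complex set \<Rightarrow> complex set \<Rightarrow> complex set \<Rightarrow> int" where
  "ideal_exponents L I = (THE v.
     finite {P. v P \<noteq> 0} \<and> {P. v P \<noteq> 0} \<subseteq> prime_ideals L \<and>
     I = finprod (ideal_group L) (\<lambda>P. P [^]\<^bsub>ideal_group L\<^esub> v P) {P. v P \<noteq> 0})"

text \<open>For \<open>I\<close> the principal ideal of \<open>x\<close> and \<open>q = q\<^sub>i\<close> this is \<open>J\<^sub>i(x)\<close>.\<close>

definition ideal_part :: "complex set \<Rightarrow> nat \<Rightarrow> complex set \<Rightarrow> complex set" where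
  "ideal_part L q I =
     finprod (ideal_group L) (\<lambda>P. P [^]\<^bsub>ideal_group L\<^esub> ideal_exponents L I P)
       {P \<in> prime_ideals L. lies_above P q}"

text \<open>
  The ideal norm of \<open>J\<close> is the \<open>integers_of K\<close>-module generated by the norms of the elements of \<open>J\<close>
  (here \<open>ideal_prod\<close> forms the finite sums of products \<open>r * field_norm K L a\<close>).
\<close>

definition ideal_norm :: "complex set \<Rightarrow> complex set \<Rightarrow> complex set \<Rightarrow> complex set" where
  "ideal_norm K L J = ideal_prod CC (integers_of K) (field_norm K L ` J)"

text \<open>The number of primes above \<open>q\<close> is the degree of \<open>L\<close> over the rationals.\<close>

definition splits_completely :: "complex set \<Rightarrow> nat \<Rightarrow> bool" where
  "splits_completely L q \<longleftrightarrow>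
     ring.dimension CC (card {P \<in> prime_ideals L. lies_above P q}) \<rat> L"

definition Phi :: "nat \<Rightarrow> nat \<Rightarrow> (complex \<Rightarrow> complex) \<Rightarrow> complex \<Rightarrow> complex" where
  "Phi p e \<tau> y = (\<Prod>j=0..p - 2. ((\<tau> ^^ j) y) ^ (e ^ (p - 2 - j)))"

definition cyclic_numbering ::
  "nat \<Rightarrow> complex set \<Rightarrow> (complex \<Rightarrow> complex) \<Rightarrow> nat \<Rightarrow> (nat \<Rightarrow> complex set) \<Rightarrow> bool" where
  "cyclic_numbering p K \<tau> q P \<longleftrightarrow>
     bij_betw P {1..p - 1} {Q \<in> prime_ideals K. lies_above Q q} \<and>
     (\<forall>j\<in>{1..p - 2}. \<tau> ` P j = P (j + 1)) \<and> \<tau> ` P (p - 1) = P 1"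

text \<open>
  \<open>e\<^sup>p\<^sup>-\<^sup>2 \<beta>\<^sub>1 + e\<^sup>p\<^sup>-\<^sup>3 \<beta>\<^sub>p\<^sub>-\<^sub>1 + \<dots> + e \<beta>\<^sub>3 + \<beta>\<^sub>2\<close>, where \<open>\<beta>\<^sub>j\<close> is the exponent of \<open>P j\<close> in \<open>I\<close>.
\<close>

definition chi :: "nat \<Rightarrow> nat \<Rightarrow> complex set \<Rightarrow> (nat \<Rightarrow> complex set) \<Rightarrow> complex set \<Rightarrow> int" where
  "chi p e K P I =
     int e ^ (p - 2) * ideal_exponents K I (P 1) +
     (\<Sum>j=2..p - 1. int e ^ (j - 2) * ideal_exponents K I (P j))"

end

theory Submission
  imports Defs "Jordan_Normal_Form.Char_Poly"
begin

text \<open>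
  Put \<open>y = N\<^sub>L\<^sub>/\<^sub>K(x)\<close> and let \<open>V(P)\<close> be the exponent of a prime \<open>P\<close> of \<open>L\<close> in \<open>\<Phi>(y)\<close>; the ideal of \<open>\<Phi>(y)\<close> is
  a \<open>p\<close>-th power iff \<open>p\<close> divides every \<open>V(P)\<close>. The group \<open>Gal(L/K)\<close> has order \<open>p\<close> and leaves \<open>V\<close>
  invariant, while \<open>V(P) = e V(\<tau> P)\<close> modulo \<open>p\<close> by the shape of \<open>\<Phi>\<close>. If \<open>p\<close> does not divide \<open>V(P)\<close>, then
  no nontrivial \<open>\<sigma> \<in> Gal(L/K)\<close> fixes \<open>P\<close> (otherwise all do, and \<open>V(P)\<close> is \<open>p\<close> times the exponent in
  \<open>\<Phi>(x)\<close>), and \<open>\<tau>\<^sup>d P\<close> is not conjugate to \<open>P\<close> over \<open>K\<close> for \<open>0 < d < p - 1\<close> (as \<open>e\<^sup>d \<noteq> 1\<close> modulo \<open>p\<close>). So \<open>P\<close> has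
  \<open>p (p - 1)\<close> conjugates and the prime number below splits completely in \<open>L\<close>. For such a prime number
  there is no ramification, the ideal norm can be read off from norms of elements, and
  \<open>\<chi>(I\<^sub>i(x)) = V(P)\<close> for \<open>P\<close> above \<open>P\<^sub>1\<close>.

  The ideal theory rests on one observation: elements of \<open>L\<close> in excess of the degree are linearly
  dependent over \<open>\<rat>\<close>, hence have a relation with integer coefficients not all divisible by a given prime
  number \<open>q\<close>. So \<open>\<O>/q\<O>\<close> is finite, and chains of ideals above \<open>q\<close> are no longer than the degree.
\<close>

section \<open>Algebraic integers and number fields\<close>

text \<open>Complete splitting is expressed by a count, and two bounds meet there. The minimal
  polynomial of \<open>\<zeta>\<close> divides \<open>1 + X + ... + X ^ (p - 1)\<close>, so the
  degree of \<open>L\<close> is at most \<open>p (p - 1)\<close>, and no prime number has more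
  primes of \<open>L\<close> above it than this degree. An orbit with \<open>p (p - 1)\<close>
  members therefore consists of all primes above \<open>q\<close> and forces the degree to be
  attained. The ideal norm in the statement is generated by norms of single elements, so it is
  computed by choosing elements: an approximation argument supplies one with the prescribed exponent
  at every prime above \<open>q\<close>, and its norm has the least possible valuation. To compare
  valuations in \<open>K\<close> and in \<open>L\<close>, the number \<open>q\<close> serves as
  uniformizer on both sides; this is why splitting has to be carried down from \<open>L\<close> to
  \<open>K\<close>. The coefficients of \<open>\<chi>\<close> run backwards through the numbering
  because the exponent of \<open>\<tau>\<^sup>j y\<close> at \<open>Q\<close> is the exponent of
  \<open>y\<close> at \<open>\<tau>\<^sup>-\<^sup>j Q\<close>.\<close>

lemma CC_simps [simp]:
  "carrier CC = UNIV" "x \<otimes>\<^bsub>CC\<^esub> y = x * y" "x \<oplus>\<^bsub>CC\<^esub> y = x + y" "\<zero>\<^bsub>CC\<^esub> = 0" "\<one>\<^bsub>CC\<^esub> = 1"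
  by (simp_all add: ring_of_type_algebra_def)

lemma field_CC: "field CC"
  by (rule field_from_type_algebra)

interpretation CC: domain CC
  using field_CC by (rule field.axioms)

lemma a_inv_CC [simp]: "\<ominus>\<^bsub>CC\<^esub> x = - x"
  by (rule CC.minus_equality) simp_all

lemma m_inv_CC: "x \<noteq> 0 \<Longrightarrow> inv\<^bsub>CC\<^esub> x = inverse x"
  by (rule CC.comm_inv_char) simp_all

lemma subfield_CC_iff:
  "subfield K CC \<longleftrightarrow> 1 \<in> K \<and> (\<forall>a\<in>K. \<forall>b\<in>K. a - b \<in> K) \<and> (\<forall>a\<in>K. \<forall>b\<in>K. a * b \<in> K) \<and>
     (\<forall>a\<in>K. inverse a \<in> K)"
  (is "_ \<longleftrightarrow> ?r")
proof
  assume K: "subfield K CC"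
  note p = subringE[OF subfieldE(1)[OF K]]
  have "a - b \<in> K" if "a \<in> K" "b \<in> K" for a b
    using p(7)[OF that(1) p(5)[OF that(2)]] by simp
  moreover have "inverse a \<in> K" if "a \<in> K" for a
    using CC.subfield_m_inv(1)[OF K, of a] that m_inv_CC[of a] p(2) by (cases "a = 0") auto
  ultimately show ?r
    using p(3) p(6) by simp
next
  assume r: ?r
  have z: "0 \<in> K" using r by (metis diff_self)
  have n: "- a \<in> K" if "a \<in> K" for a using r z that by (metis diff_0)
  have a: "a + b \<in> K" if "a \<in> K" "b \<in> K" for a b
    using r n[OF that(2)] that by (metis diff_minus_eq_add)
  show "subfield K CC"
    by (rule field.subfieldI'[OF field_CC], rule CC.subringI) (use r n a in \<open>auto simp: m_inv_CC\<close>)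
qed

text \<open>The relations make \<open>v\<close> an eigenvector of the integer matrix
  \<open>c\<close> with eigenvalue \<open>x\<close>, so \<open>x\<close> is a root of its
  characteristic polynomial, which is monic over \<open>\<int>\<close>. The entry at
  \<open>b0\<close> certifies that the vector is not zero; the entries may well be linearly
  dependent.\<close>

lemma algebraic_int_of_int_eigenvector:
  fixes x :: complex and v :: "'a \<Rightarrow> complex" and c :: "'a \<Rightarrow> 'a \<Rightarrow> int"
  assumes "finite B" "b0 \<in> B" "v b0 \<noteq> 0"
    and "\<And>b. b \<in> B \<Longrightarrow> x * v b = (\<Sum>b'\<in>B. of_int (c b b') * v b')"
  shows "algebraic_int x"
proof -
  define n where "n = card B"
  obtain f where f: "bij_betw f {0..<n} B"
    using ex_bij_betw_nat_finite[OF assms(1)] n_def by blast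
  define A where "A = mat n n (\<lambda>(i, j). c (f i) (f j))"
  define w where "w = vec n (\<lambda>i. v (f i))"
  have fB: "f i \<in> B" if "i < n" for i using f that by (auto simp: bij_betw_def)
  obtain i0 where i0: "i0 < n" "f i0 = b0" using f assms(2) by (auto simp: bij_betw_def)
  have A: "A \<in> carrier_mat n n" by (simp add: A_def)
  have A': "map_mat complex_of_int A \<in> carrier_mat n n" using A by simp
  have "eigenvector (map_mat complex_of_int A) w x"
    unfolding eigenvector_def
  proof (intro conjI)
    show "w \<in> carrier_vec (dim_row (map_mat complex_of_int A))" using A by (simp add: w_def)
    show "w \<noteq> 0\<^sub>v (dim_row (map_mat complex_of_int A))"
    proof
      assume "w = 0\<^sub>v (dim_row (map_mat complex_of_int A))"
      then have "w $ i0 = 0" using A i0 by simp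
      then show False using i0 assms(3) by (simp add: w_def)
    qed
    show "map_mat complex_of_int A *\<^sub>v w = x \<cdot>\<^sub>v w"
    proof (rule eq_vecI)
      show "dim_vec (map_mat complex_of_int A *\<^sub>v w) = dim_vec (x \<cdot>\<^sub>v w)" using A by (simp add: w_def)
      fix i assume "i < dim_vec (x \<cdot>\<^sub>v w)"
      then have i: "i < n" by (simp add: w_def)
      have "(map_mat complex_of_int A *\<^sub>v w) $ i = (\<Sum>j = 0..<n. of_int (c (f i) (f j)) * v (f j))"
        using i by (auto simp: scalar_prod_def A_def w_def intro!: sum.cong)
      also have "\<dots> = (\<Sum>b'\<in>B. of_int (c (f i) b') * v b')"
        using sum.reindex_bij_betw[OF f, of "\<lambda>b'. of_int (c (f i) b') * v b'"] by simp
      also have "\<dots> = x * v (f i)" using assms(4)[OF fB[OF i]] by simp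
      finally show "(map_mat complex_of_int A *\<^sub>v w) $ i = (x \<cdot>\<^sub>v w) $ i" using i by (simp add: w_def)
    qed
  qed
  then have "poly (char_poly (map_mat complex_of_int A)) x = 0"
    using eigenvalue_root_char_poly[OF A'] unfolding eigenvalue_def by blast
  then have "poly (map_poly of_int (char_poly A)) x = 0"
    using of_int_hom.char_poly_hom[OF A] by metis
  moreover have "lead_coeff (char_poly A) = 1"
    using degree_monic_char_poly[OF A] by simp
  ultimately show ?thesis by (auto simp: algebraic_int_altdef_ipoly)
qed

lemma algebraic_int_power_relation:
  fixes x :: complex
  assumes "algebraic_int x"
  obtains n :: nat and c :: "nat \<Rightarrow> int" where "n > 0" "x ^ n = (\<Sum>i<n. of_int (c i) * x ^ i)"
proof -
  from assms obtain p where p: "poly (map_poly of_int p) x = 0" "lead_coeff p = (1::int)"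
    by (auto simp: algebraic_int_altdef_ipoly)
  define n where "n = degree p"
  have d: "degree (map_poly of_int p :: complex poly) = n"
    by (simp add: n_def degree_map_poly)
  have "0 = (\<Sum>i\<le>n. of_int (coeff p i) * x ^ i)"
    using p(1) unfolding poly_altdef d by (simp add: coeff_map_poly)
  also have "\<dots> = (\<Sum>i<n. of_int (coeff p i) * x ^ i) + x ^ n"
    using p(2) by (simp add: lessThan_Suc_atMost[symmetric] n_def)
  finally have e: "x ^ n = (\<Sum>i<n. of_int (- coeff p i) * x ^ i)"
    by (simp add: sum_negf eq_neg_iff_add_eq_0 add.commute)
  have "n \<noteq> 0"
  proof
    assume "n = 0"
    then show False using e by simp
  qed
  then show thesis using that[OF _ e] by simp
qed

lemma sum_of_int_delta:
  fixes f :: "nat \<Rightarrow> complex"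
  assumes "j < n"
  shows "(\<Sum>l<n. of_int (if l = j then 1 else 0) * f l) = f j"
proof -
  have "(\<Sum>l<n. of_int (if l = j then 1 else 0) * f l) = (\<Sum>l<n. if l = j then f l else 0)"
    by (rule sum.cong) auto
  then show ?thesis using assms by simp
qed

lemma power_int_combination:
  fixes x :: complex
  assumes "n > 0" "x ^ n = (\<Sum>i<n. of_int (c i) * x ^ i)" "i < n"
  obtains d :: "nat \<Rightarrow> int" where "x * x ^ i = (\<Sum>k<n. of_int (d k) * x ^ k)"
proof (cases "Suc i < n")
  case True
  have "x * x ^ i = (\<Sum>k<n. of_int (if k = Suc i then 1 else 0) * x ^ k)"
    by (simp only: sum_of_int_delta[OF True, of "\<lambda>k. x ^ k"] power_Suc)
  then show ?thesis by (rule that)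
next
  case False
  then have "Suc i = n" using assms(3) by simp
  then have "x * x ^ i = x ^ n" by auto
  also note assms(2)
  finally show ?thesis by (rule that)
qed

text \<open>Powers \<open>x ^ i\<close> with \<open>i < n\<close> span a \<open>\<int>\<close>-module stable under \<open>x\<close>, so products of such
  powers of two algebraic integers span a module stable under both.\<close>

lemma algebraic_int_add_mult:
  fixes x y :: complex
  assumes "algebraic_int x" "algebraic_int y"
  shows "algebraic_int (x + y)" "algebraic_int (x * y)"
proof -
  obtain m c where m: "m > 0" "x ^ m = (\<Sum>i<m. of_int (c i) * x ^ i)"
    using algebraic_int_power_relation[OF assms(1)] by metis
  obtain n d where n: "n > 0" "y ^ n = (\<Sum>i<n. of_int (d i) * y ^ i)"
    using algebraic_int_power_relation[OF assms(2)] by metis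
  have "\<forall>i. \<exists>C. i < m \<longrightarrow> x * x ^ i = (\<Sum>k<m. of_int (C k) * x ^ k)"
    using power_int_combination[OF m] by metis
  then obtain C :: "nat \<Rightarrow> nat \<Rightarrow> int"
    where C: "\<And>i. i < m \<Longrightarrow> x * x ^ i = (\<Sum>k<m. of_int (C i k) * x ^ k)" by metis
  have "\<forall>i. \<exists>D. i < n \<longrightarrow> y * y ^ i = (\<Sum>k<n. of_int (D k) * y ^ k)"
    using power_int_combination[OF n] by metis
  then obtain D :: "nat \<Rightarrow> nat \<Rightarrow> int"
    where D: "\<And>i. i < n \<Longrightarrow> y * y ^ i = (\<Sum>k<n. of_int (D i k) * y ^ k)" by metis
  define B where "B = {..<m} \<times> {..<n}"
  define v where "v = (\<lambda>(i, j). x ^ i * y ^ j)"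
  have B: "finite B" "(0, 0) \<in> B" "v (0, 0) \<noteq> 0" using m n by (auto simp: B_def v_def)
  have comb: "(\<Sum>k<m. of_int (a k) * x ^ k) * (\<Sum>l<n. of_int (b l) * y ^ l) =
    (\<Sum>b'\<in>B. of_int ((\<lambda>(k, l). a k * b l) b') * v b')" for a b :: "nat \<Rightarrow> int"
    by (simp add: sum_product B_def v_def sum.cartesian_product case_prod_unfold mult_ac)
  \<comment> \<open>\<open>x\<close> affects only the first exponent. Writing
    \<open>y ^ snd b\<close> as a combination with Kronecker deltas turns the result into a product
    of two combinations, to which \<open>comb\<close> applies.\<close>
  have xB: "x * v b = (\<Sum>b'\<in>B. of_int ((\<lambda>(k, l). C (fst b) k * (if l = snd b then 1 else 0)) b') * v b')"
    if "b \<in> B" for b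
  proof -
    have b: "fst b < m" "snd b < n" using that by (auto simp: B_def)
    have "x * v b = (x * x ^ fst b) * y ^ snd b" by (simp add: v_def case_prod_unfold)
    also have "\<dots> = (\<Sum>k<m. of_int (C (fst b) k) * x ^ k) * (\<Sum>l<n. of_int (if l = snd b then 1 else 0) * y ^ l)"
      by (simp only: C[OF b(1)] sum_of_int_delta[OF b(2), of "\<lambda>l. y ^ l"])
    finally show ?thesis unfolding comb .
  qed
  have yB: "y * v b = (\<Sum>b'\<in>B. of_int ((\<lambda>(k, l). (if k = fst b then 1 else 0) * D (snd b) l) b') * v b')"
    if "b \<in> B" for b
  proof -
    have b: "fst b < m" "snd b < n" using that by (auto simp: B_def)
    have "y * v b = x ^ fst b * (y * y ^ snd b)" by (simp add: v_def case_prod_unfold)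
    also have "\<dots> = (\<Sum>l<m. of_int (if l = fst b then 1 else 0) * x ^ l) * (\<Sum>k<n. of_int (D (snd b) k) * y ^ k)"
      by (simp only: D[OF b(2)] sum_of_int_delta[OF b(1), of "\<lambda>k. x ^ k"])
    finally show ?thesis unfolding comb .
  qed
  define cx where "cx b kl = (case kl of (k, l) \<Rightarrow> C (fst b) k * (if l = snd b then 1 else 0))" for b kl :: "nat \<times> nat"
  define cy where "cy b kl = (case kl of (k, l) \<Rightarrow> (if k = fst b then 1 else 0) * D (snd b) l)" for b kl :: "nat \<times> nat"
  have cx: "x * v b = (\<Sum>b'\<in>B. of_int (cx b b') * v b')" if "b \<in> B" for b
    using xB[OF that] unfolding cx_def .
  have cy: "y * v b = (\<Sum>b'\<in>B. of_int (cy b b') * v b')" if "b \<in> B" for b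
    using yB[OF that] unfolding cy_def .
  show "algebraic_int (x + y)"
  proof (rule algebraic_int_of_int_eigenvector[where B = B and v = v, OF B])
    fix b assume b: "b \<in> B"
    show "(x + y) * v b = (\<Sum>b'\<in>B. of_int (cx b b' + cy b b') * v b')"
      by (simp add: distrib_right sum.distrib cx[OF b] cy[OF b])
  qed
  show "algebraic_int (x * y)"
  proof (rule algebraic_int_of_int_eigenvector[where B = B and v = v, OF B])
    fix b assume b: "b \<in> B"
    \<comment> \<open>The coefficient matrix of multiplication by \<open>x * y\<close> is the
      product of the matrices for \<open>y\<close> and for \<open>x\<close>.\<close>
    have "x * y * v b = (\<Sum>b'\<in>B. of_int (cy b b') * (x * v b'))"
      by (simp only: mult.assoc cy[OF b] sum_distrib_left mult.left_commute[of x])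
    also have "\<dots> = (\<Sum>b'\<in>B. \<Sum>b''\<in>B. of_int (cy b b' * cx b' b'') * v b'')"
      by (rule sum.cong) (simp_all add: cx sum_distrib_left mult.assoc)
    also have "\<dots> = (\<Sum>b''\<in>B. of_int (\<Sum>b'\<in>B. cy b b' * cx b' b'') * v b'')"
      by (subst sum.swap) (simp add: sum_distrib_right)
    finally show "x * y * v b = (\<Sum>b''\<in>B. of_int (\<Sum>b'\<in>B. cy b b' * cx b' b'') * v b'')" .
  qed
qed

section \<open>Linear relations over \<open>\<rat>\<close> and products of modules\<close>

lemma combine_CC_eq_sum:
  "length Ks = length Us \<Longrightarrow> CC.combine Ks Us = (\<Sum>i<length Us. Ks ! i * Us ! i)"
  by (induction Ks Us rule: list_induct2) (simp_all add: sum.lessThan_Suc_shift del: sum.lessThan_Suc)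

lemma subfield_Rats: "subfield \<rat> CC"
  by (simp add: subfield_CC_iff)

lemma common_denominator:
  fixes f :: "'a \<Rightarrow> complex"
  assumes "finite A" "\<And>a. a \<in> A \<Longrightarrow> f a \<in> \<rat>"
  obtains D :: int where "D > 0" "\<And>a. a \<in> A \<Longrightarrow> of_int D * f a \<in> \<int>"
  using assms
proof (induction A arbitrary: thesis rule: finite_induct)
  case empty
  show ?case by (rule empty(1)[of 1]) auto
next
  case (insert b A)
  from insert.IH insert.prems(2) obtain D :: int
    where D: "D > 0" "\<And>a. a \<in> A \<Longrightarrow> of_int D * f a \<in> \<int>" by blast
  from insert.prems(2)[of b] obtain r s :: int where rs: "s > 0" "f b = of_int r / of_int s"
    by (auto elim: Rats_cases')
  have "of_int (D * s) * f a \<in> \<int>" if "a \<in> insert b A" for a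
  proof (cases "a = b")
    case True
    then have "of_int (D * s) * f a = of_int (D * r)" using rs by simp
    then show ?thesis by (metis Ints_of_int)
  next
    case False
    then have "of_int s * (of_int D * f a) \<in> \<int>" using that Ints_mult[OF Ints_of_int D(2)[of a]] by auto
    then show ?thesis by (simp add: mult_ac)
  qed
  moreover have "D * s > 0" using D rs by simp
  ultimately show ?case using insert.prems(1) by blast
qed

text \<open>\<open>ideal_prod\<close> is generated inductively by products and sums, so it is the
  least additively closed set containing the products. Inclusions of products are checked through
  this rule, for fractional ideals as well as for sets of norms.\<close>

lemma ideal_prod_subset:
  assumes "\<And>i j. i \<in> I \<Longrightarrow> j \<in> J \<Longrightarrow> i * j \<in> Z" "\<And>a b. a \<in> Z \<Longrightarrow> b \<in> Z \<Longrightarrow> a + b \<in> Z"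
  shows "ideal_prod CC I J \<subseteq> Z"
proof
  fix s assume "s \<in> ideal_prod CC I J"
  then show "s \<in> Z" by (induction rule: ideal_prod.induct) (use assms in auto)
qed

lemma ideal_prod_mult: "i \<in> I \<Longrightarrow> j \<in> J \<Longrightarrow> i * j \<in> ideal_prod CC I J"
  using ideal_prod.prod[of i I j J CC] by simp

lemma ideal_prod_add:
  "s \<in> ideal_prod CC I J \<Longrightarrow> t \<in> ideal_prod CC I J \<Longrightarrow> s + t \<in> ideal_prod CC I J"
  using ideal_prod.sum[of s CC I J t] by simp

lemma ideal_prod_comm: "ideal_prod CC I J = ideal_prod CC J I"
proof -
  have "ideal_prod CC I J \<subseteq> ideal_prod CC J I" for I J
    by (rule ideal_prod_subset) (metis ideal_prod_mult mult.commute, rule ideal_prod_add)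
  then show ?thesis by blast
qed

lemma ideal_prod_assoc:
  "ideal_prod CC (ideal_prod CC I J) K = ideal_prod CC I (ideal_prod CC J K)"
proof -
  have le: "ideal_prod CC (ideal_prod CC I J) K \<subseteq> ideal_prod CC I (ideal_prod CC J K)" for I J K
  proof (rule ideal_prod_subset)
    fix s k assume "s \<in> ideal_prod CC I J" "k \<in> K"
    then show "s * k \<in> ideal_prod CC I (ideal_prod CC J K)"
      by (induction rule: ideal_prod.induct)
        (auto simp: mult.assoc distrib_right intro: ideal_prod_mult ideal_prod_add)
  qed (rule ideal_prod_add)
  \<comment> \<open>The reverse inclusion is the same inclusion read from right to left, by
    commutativity.\<close>
  show ?thesis
    using le[of I J K] le[of K J I] by (simp add: ideal_prod_comm)
qed

lemma ideal_prod_mono: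
  assumes "I \<subseteq> I'" "J \<subseteq> J'"
  shows "ideal_prod CC I J \<subseteq> ideal_prod CC I' J'"
  by (rule ideal_prod_subset) (use assms ideal_prod_mult ideal_prod_add in blast)+

section \<open>Subfields of the complex numbers and number fields\<close>

locale complex_subfield =
  fixes L :: "complex set"
  assumes subfield: "subfield L CC"
begin

lemma L_closed [simp, intro]:
  shows "1 \<in> L" and "0 \<in> L"
    and "a \<in> L \<Longrightarrow> b \<in> L \<Longrightarrow> a - b \<in> L" and "a \<in> L \<Longrightarrow> b \<in> L \<Longrightarrow> a * b \<in> L"
    and "a \<in> L \<Longrightarrow> b \<in> L \<Longrightarrow> a + b \<in> L" and "a \<in> L \<Longrightarrow> - a \<in> L"
    and "a \<in> L \<Longrightarrow> inverse a \<in> L" and "a \<in> L \<Longrightarrow> b \<in> L \<Longrightarrow> a / b \<in> L"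
    and "a \<in> L \<Longrightarrow> a ^ k \<in> L"
proof -
  note s = subfield[unfolded subfield_CC_iff]
  show one: "1 \<in> L" using s by blast
  show d: "a - b \<in> L" if "a \<in> L" "b \<in> L" for a b using s that by blast
  show z: "0 \<in> L" using d[OF one one] by simp
  show m: "- a \<in> L" if "a \<in> L" for a using d[OF z that] by simp
  show t: "a * b \<in> L" if "a \<in> L" "b \<in> L" for a b using s that by blast
  show "a + b \<in> L" if "a \<in> L" "b \<in> L" for a b using d[OF that(1) m[OF that(2)]] by simp
  show i: "inverse a \<in> L" if "a \<in> L" for a using s that by blast
  show "a / b \<in> L" if "a \<in> L" "b \<in> L" for a b
    using t[OF that(1) i[OF that(2)]] by (simp add: divide_inverse)
  show "a ^ k \<in> L" if "a \<in> L" for a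
    by (induction k) (use one t that in auto)
qed

lemma of_nat_in_L [simp]: "of_nat k \<in> L"
  by (induction k) auto

lemma of_int_in_L [simp]: "of_int k \<in> L"
  by (cases k) auto

lemma Rats_subset_L: "\<rat> \<subseteq> L"
  by (auto elim!: Rats_cases')

end

text \<open>The degree \<open>n\<close> is a parameter because it is the number against which primes
  above \<open>q\<close> are counted.\<close>

locale number_field = complex_subfield L for L :: "complex set" +
  fixes n :: nat
  assumes dimension: "CC.dimension n \<rat> L"
begin

abbreviation integers ("\<O>") where "\<O> \<equiv> integers_of L"

lemma O_subset_L: "a \<in> \<O> \<Longrightarrow> a \<in> L"
  by (simp add: integers_of_def)

lemma O_closed [simp, intro]:
  shows "1 \<in> \<O>" and "0 \<in> \<O>"
    and "a \<in> \<O> \<Longrightarrow> b \<in> \<O> \<Longrightarrow> a - b \<in> \<O>" and "a \<in> \<O> \<Longrightarrow> b \<in> \<O> \<Longrightarrow> a * b \<in> \<O>"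
    and "a \<in> \<O> \<Longrightarrow> b \<in> \<O> \<Longrightarrow> a + b \<in> \<O>" and "a \<in> \<O> \<Longrightarrow> - a \<in> \<O>"
    and "of_int k \<in> \<O>" and "of_nat m \<in> \<O>" and "a \<in> \<O> \<Longrightarrow> a ^ m \<in> \<O>"
proof -
  show one: "1 \<in> \<O>" and "0 \<in> \<O>" and "of_int k \<in> \<O>" and "of_nat m \<in> \<O>"
    by (auto simp: integers_of_def intro: int_imp_algebraic_int)
  show t: "a * b \<in> \<O>" if "a \<in> \<O>" "b \<in> \<O>" for a b
    using that by (auto simp: integers_of_def intro: algebraic_int_add_mult)
  show "a + b \<in> \<O>" if "a \<in> \<O>" "b \<in> \<O>" for a b
    using that by (auto simp: integers_of_def intro: algebraic_int_add_mult)
  show "a - b \<in> \<O>" if "a \<in> \<O>" "b \<in> \<O>" for a b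
    using that algebraic_int_add_mult(1)[of a "- b"] by (auto simp: integers_of_def)
  show "- a \<in> \<O>" if "a \<in> \<O>" for a
    using that by (auto simp: integers_of_def)
  show "a ^ m \<in> \<O>" if "a \<in> \<O>"
    by (induction m) (use one t that in auto)
qed

lemma O_sum [intro]: "(\<And>i. i \<in> A \<Longrightarrow> f i \<in> \<O>) \<Longrightarrow> sum f A \<in> \<O>"
  by (induction A rule: infinite_finite_induct) auto

lemma rational_dependence:
  assumes "set as \<subseteq> L" "length as > n"
  obtains c :: "nat \<Rightarrow> int" and i where
    "(\<Sum>i<length as. of_int (c i) * as ! i) = 0" "i < length as" "c i \<noteq> 0"
proof -
  have "CC.dependent \<rat> as"
  proof
    assume "CC.independent \<rat> as"
    from CC.independent_length_le_dimension[OF subfield_Rats dimension this assms(1)]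
    show False using assms(2) by simp
  qed
  then obtain Ks where Ks: "length Ks = length as" "CC.combine Ks as = 0" "set Ks \<subseteq> \<rat>" "set Ks \<noteq> {0}"
    using CC.dependent_imp_non_trivial_combine[OF subfield_Rats, of as] by auto
  have rat: "Ks ! i \<in> \<rat>" if "i < length as" for i
    using Ks that by (metis nth_mem subsetD)
  obtain D :: int where D: "D > 0" "\<And>i. i \<in> {..<length as} \<Longrightarrow> of_int D * Ks ! i \<in> \<int>"
    using common_denominator[of "{..<length as}" "\<lambda>i. Ks ! i"] rat by blast
  define c where "c i = (SOME m. of_int D * Ks ! i = of_int m)" for i
  have c: "of_int (c i) = of_int D * Ks ! i" if "i < length as" for i
    using someI_ex[of "\<lambda>m. of_int D * Ks ! i = of_int m"] D(2)[of i] that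
    unfolding c_def by (auto elim!: Ints_cases)
  have "set Ks \<noteq> {}" using Ks(1) assms(2) by auto
  then have "\<not> set Ks \<subseteq> {0}" using Ks(4) by (auto simp: subset_singleton_iff)
  then obtain k where "k \<in> set Ks" "k \<noteq> 0" by blast
  then obtain i where i: "i < length as" "Ks ! i \<noteq> 0" by (metis Ks(1) in_set_conv_nth)
  have "(\<Sum>i<length as. of_int (c i) * as ! i) = of_int D * (\<Sum>i<length as. Ks ! i * as ! i)"
    by (simp add: c sum_distrib_left mult_ac)
  also have "\<dots> = 0" using Ks(2) combine_CC_eq_sum[OF Ks(1)] by simp
  finally have "(\<Sum>i<length as. of_int (c i) * as ! i) = 0" .
  moreover have "c i \<noteq> 0" using c[OF i(1)] i(2) D(1) by auto
  ultimately show thesis using that i by blast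
qed

text \<open>Dividing an integral relation by the gcd of its coefficients leaves one that does not
  vanish modulo \<open>q\<close>. In this form the degree over \<open>\<rat>\<close> bounds
  dimensions over the field with \<open>q\<close> elements.\<close>

lemma primitive_dependence:
  assumes "set as \<subseteq> L" "length as > n" "Factorial_Ring.prime q"
  obtains c :: "nat \<Rightarrow> int" and i where
    "(\<Sum>i<length as. of_int (c i) * as ! i) = 0" "i < length as" "\<not> int q dvd c i"
proof -
  obtain c :: "nat \<Rightarrow> int" and i where c: "(\<Sum>i<length as. of_int (c i) * as ! i) = 0"
    "i < length as" "c i \<noteq> 0"
    using rational_dependence[OF assms(1,2)] by metis
  define g where "g = Gcd (c ` {..<length as})"
  have g0: "g \<noteq> 0" unfolding g_def using c(2,3) by (auto simp: Gcd_0_iff)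
  have gd: "g dvd c j" if "j < length as" for j unfolding g_def using that by (intro Gcd_dvd) auto
  define d where "d j = c j div g" for j
  have d: "c j = g * d j" if "j < length as" for j using gd[OF that] by (simp add: d_def)
  have "of_int g * (\<Sum>i<length as. of_int (d i) * as ! i) = (\<Sum>i<length as. of_int (c i) * as ! i)"
    by (simp add: sum_distrib_left d mult_ac)
  then have s: "(\<Sum>i<length as. of_int (d i) * as ! i) = 0" using c(1) g0 by simp
  have "\<exists>j<length as. \<not> int q dvd d j"
  proof (rule ccontr)
    assume "\<not> ?thesis"
    then have "\<And>j. j < length as \<Longrightarrow> g * int q dvd c j" by (simp add: d)
    then have "g * int q dvd g" unfolding g_def by (intro Gcd_greatest) auto
    then have "int q dvd 1" using g0 by (metis dvd_mult_cancel_left mult.right_neutral)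
    then show False using assms(3) by auto
  qed
  then show thesis using s that by blast
qed

text \<open>An integral relation among \<open>1, x, ..., x ^ n\<close> has a last nonzero
  coefficient \<open>c N\<close>. Then \<open>c N * x\<close> maps the module spanned by the powers
  of \<open>x\<close> below \<open>N\<close> into itself, hence is integral; the absolute value
  makes the factor positive.\<close>

lemma integral_multiple:
  assumes "x \<in> L"
  obtains m :: nat where "m > 0" "of_nat m * x \<in> \<O>"
proof -
  define as where "as = map (\<lambda>i. x ^ i) [0..<Suc n]"
  have "set as \<subseteq> L" "length as > n" using assms by (auto simp: as_def simp del: upt_Suc)
  then obtain c :: "nat \<Rightarrow> int" and i where c: "(\<Sum>i<length as. of_int (c i) * as ! i) = 0"
    "i < length as" "c i \<noteq> 0"
    using rational_dependence by metis
  have len: "length as = Suc n" by (simp add: as_def)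
  have c1: "(\<Sum>i<Suc n. of_int (c i) * x ^ i) = 0"
    using c(1) unfolding len by (simp add: as_def nth_append del: upt_Suc)
  define N where "N = Max {i. i < Suc n \<and> c i \<noteq> 0}"
  have "N \<in> {i. i < Suc n \<and> c i \<noteq> 0}" unfolding N_def
    by (rule Max_in) (use c len in auto)
  then have N: "N < Suc n" "c N \<noteq> 0" by auto
  have Nm: "c j = 0" if "j < Suc n" "N < j" for j
  proof (rule ccontr)
    assume "c j \<noteq> 0"
    then have "j \<le> N" unfolding N_def by (intro Max_ge) (use that in auto)
    then show False using that by simp
  qed
  have "(\<Sum>i<Suc n. of_int (c i) * x ^ i) = (\<Sum>i<Suc N. of_int (c i) * x ^ i)"
    by (rule sum.mono_neutral_right) (use N Nm in \<open>auto simp: not_less\<close>)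
  then have rel: "of_int (c N) * x ^ N = (\<Sum>i<N. of_int (- c i) * x ^ i)"
    using c1 by (simp add: sum_negf eq_neg_iff_add_eq_0 add.commute)
  have N0: "N > 0" using rel N by (cases N) auto
  have "algebraic_int (of_int (c N) * x)"
  proof (rule algebraic_int_of_int_eigenvector[of "{..<N}" 0 "\<lambda>i. x ^ i"])
    fix i assume i: "i \<in> {..<N}"
    show "of_int (c N) * x * x ^ i =
      (\<Sum>k<N. of_int (if Suc i < N then c N * (if k = Suc i then 1 else 0) else - c k) * x ^ k)"
    proof (cases "Suc i < N")
      case True
      then show ?thesis
        using sum_of_int_delta[OF True, of "\<lambda>k. of_int (c N) * x ^ k"] by (simp add: mult_ac)
    next
      case False
      then have "Suc i = N" using i by auto
      then show ?thesis using rel by (auto simp: mult.assoc)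
    qed
  qed (use N0 in auto)
  then have "of_int (c N) * x \<in> \<O>" using assms by (simp add: integers_of_def)
  moreover from this have "- (of_int (c N) * x) \<in> \<O>" by blast
  ultimately have "of_int \<bar>c N\<bar> * x \<in> \<O>" by (simp add: abs_if)
  then have "of_nat (nat \<bar>c N\<bar>) * x \<in> \<O>" by simp
  then show thesis using that N(2) by (metis zero_less_abs_iff zero_less_nat_eq)
qed

text \<open>Linear independence of the residues in \<open>\<O>/q\<O>\<close> over the field with
  \<open>q\<close> elements, phrased with integer coefficients so that no quotient ring has to be
  formed.\<close>

definition residually_independent :: "nat \<Rightarrow> complex list \<Rightarrow> bool" where
  "residually_independent q as \<longleftrightarrow> set as \<subseteq> \<O> \<and>
     (\<forall>c. (\<exists>b\<in>\<O>. (\<Sum>i<length as. of_int (c i) * as ! i) = of_nat q * b) \<longrightarrow>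
        (\<forall>i<length as. int q dvd c i))"

lemma residually_independent_length:
  assumes "residually_independent q as" "Factorial_Ring.prime q"
  shows "length as \<le> n"
proof (rule ccontr)
  assume "\<not> length as \<le> n"
  moreover have "set as \<subseteq> L" using assms by (auto simp: residually_independent_def O_subset_L)
  ultimately obtain c :: "nat \<Rightarrow> int" and i where c: "(\<Sum>i<length as. of_int (c i) * as ! i) = 0"
    "i < length as" "\<not> int q dvd c i"
    using primitive_dependence[of as q] assms(2) by (metis not_le)
  then have "\<exists>b\<in>\<O>. (\<Sum>i<length as. of_int (c i) * as ! i) = of_nat q * b" by (intro bexI[of _ 0]) auto
  then show False using assms(1) c(2,3) unfolding residually_independent_def by blast
qed

text \<open>A residually independent list of maximal length spans \<open>\<O>\<close> modulo
  \<open>q\<close>: appending \<open>a\<close> to it creates a relation in which the coefficient of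
  \<open>a\<close> is prime to \<open>q\<close>, and inverting it expresses \<open>a\<close> by the
  list. The representatives are the combinations with coefficients in
  \<open>{0..<q}\<close>.\<close>

lemma finite_residues_prime:
  assumes q: "Factorial_Ring.prime (q::nat)"
  shows "\<exists>R. finite R \<and> R \<subseteq> \<O> \<and> (\<forall>a\<in>\<O>. \<exists>r\<in>R. \<exists>b\<in>\<O>. a = r + of_nat q * b)"
proof -
  have "\<exists>as. residually_independent q as" by (rule exI[of _ "[]"]) (simp add: residually_independent_def)
  moreover have "\<forall>as. residually_independent q as \<longrightarrow> length as < Suc n"
    using residually_independent_length q by (auto simp: less_Suc_eq_le)
  ultimately obtain as where as: "residually_independent q as"
    "\<And>bs. residually_independent q bs \<Longrightarrow> length bs \<le> length as"
    using ex_has_greatest_nat[of "residually_independent q" _ length "Suc n"] by blast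
  define m where "m = length as"
  define R where "R = (\<lambda>c. \<Sum>i<m. of_int (c i) * as ! i) ` ({..<m} \<rightarrow>\<^sub>E {0..<int q})"
  have asO: "as ! i \<in> \<O>" if "i < m" for i using as(1) that by (auto simp: residually_independent_def m_def)
  have "finite R" unfolding R_def by (intro finite_imageI finite_PiE) auto
  moreover have "R \<subseteq> \<O>" unfolding R_def using asO by auto
  moreover have "\<exists>r\<in>R. \<exists>b\<in>\<O>. a = r + of_nat q * b" if a: "a \<in> \<O>" for a
  proof -
    have "\<not> residually_independent q (as @ [a])" using as(2)[of "as @ [a]"] by auto
    moreover have "set (as @ [a]) \<subseteq> \<O>" using as(1) a by (auto simp: residually_independent_def)
    ultimately obtain c b i where c: "b \<in> \<O>"
      "(\<Sum>i<length (as @ [a]). of_int (c i) * (as @ [a]) ! i) = of_nat q * b"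
      "i < length (as @ [a])" "\<not> int q dvd c i"
      unfolding residually_independent_def by blast
    have eq: "(\<Sum>i<m. of_int (c i) * as ! i) + of_int (c m) * a = of_nat q * b"
      using c(2) by (simp add: m_def nth_append)
    \<comment> \<open>Otherwise the term with \<open>a\<close> is absorbed into \<open>q\<close>
      times an integer of \<open>L\<close>, and the relation is one among the independent elements
      alone.\<close>
    have "\<not> int q dvd c m"
    proof
      assume "int q dvd c m"
      then obtain k where k: "c m = int q * k" by blast
      have "(\<Sum>i<m. of_int (c i) * as ! i) = of_nat q * (b - of_int k * a)"
        using eq by (simp add: k algebra_simps)
      moreover have "b - of_int k * a \<in> \<O>" using c(1) a by auto
      ultimately have "\<forall>i<m. int q dvd c i"
        using as(1) unfolding residually_independent_def m_def by blast
      then show False using \<open>int q dvd c m\<close> c(3,4) by (auto simp: m_def less_Suc_eq)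
    qed
    then have "Rings.coprime (c m) (int q)"
      using q by (metis coprime_commute prime_imp_coprime prime_nat_int_transfer)
    then obtain u where "[c m * u = 1] (mod int q)" using cong_solve_coprime_int by blast
    then obtain k where k: "c m * u = 1 + int q * k"
      by (metis cong_iff_lin cong_sym)
    define d where "d i = (- u * c i) mod int q" for i
    define t where "t i = (- u * c i) div int q" for i
    have dt: "- u * c i = int q * t i + d i" for i by (simp add: d_def t_def)
    have r: "(\<Sum>i<m. of_int (d i) * as ! i) \<in> R"
      unfolding R_def
    proof (rule image_eqI)
      show "restrict d {..<m} \<in> {..<m} \<rightarrow>\<^sub>E {0..<int q}"
        using prime_gt_0_nat[OF q] by (auto simp: d_def)
    qed simp
    have "of_int (c m * u) * a = of_int u * of_nat q * b - (\<Sum>i<m. of_int (u * c i) * as ! i)"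
      using arg_cong[OF eq, of "\<lambda>z. of_int u * z"] by (simp add: algebra_simps sum_distrib_left)
    also have "\<dots> = of_int u * of_nat q * b + (\<Sum>i<m. of_int (- u * c i) * as ! i)"
      by (simp add: sum_negf)
    also have "(\<Sum>i<m. of_int (- u * c i) * as ! i) =
      of_nat q * (\<Sum>i<m. of_int (t i) * as ! i) + (\<Sum>i<m. of_int (d i) * as ! i)"
      unfolding dt by (simp add: algebra_simps sum.distrib sum_distrib_left)
    finally have "a = (\<Sum>i<m. of_int (d i) * as ! i) +
      of_nat q * (of_int u * b + (\<Sum>i<m. of_int (t i) * as ! i) - of_int k * a)"
      unfolding k by (simp add: algebra_simps)
    moreover have "of_int u * b + (\<Sum>i<m. of_int (t i) * as ! i) - of_int k * a \<in> \<O>"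
      by (intro O_closed(3,4,5,7) O_sum) (use c(1) a asO in auto)
    ultimately show ?thesis using r by blast
  qed
  ultimately show ?thesis by blast
qed

text \<open>A representative modulo \<open>q\<close> plus \<open>q\<close> times one modulo
  \<open>m'\<close> represents the classes modulo \<open>q * m'\<close>, so the prime case
  suffices.\<close>

lemma finite_residues:
  assumes "m > 0"
  obtains R where "finite R" "R \<subseteq> \<O>" "\<And>a. a \<in> \<O> \<Longrightarrow> \<exists>r\<in>R. \<exists>b\<in>\<O>. a = r + of_nat m * b"
proof -
  have "\<exists>R. finite R \<and> R \<subseteq> \<O> \<and> (\<forall>a\<in>\<O>. \<exists>r\<in>R. \<exists>b\<in>\<O>. a = r + of_nat m * b)"
    using assms
  proof (induction m rule: less_induct)
    case (less m)
    show ?case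
    proof (cases "m = 1")
      case True
      then show ?thesis by (intro exI[of _ "{0}"]) auto
    next
      case False
      then obtain q where q: "Factorial_Ring.prime q" "q dvd m" using prime_factor_nat by blast
      then obtain m' where m: "m = q * m'" by blast
      have "m' > 0" "m' < m" using less.prems m prime_gt_1_nat[OF q(1)] by auto
      from less.IH[OF this(2,1)] obtain S where
        S0: "finite S \<and> S \<subseteq> \<O> \<and> (\<forall>a\<in>\<O>. \<exists>r\<in>S. \<exists>b\<in>\<O>. a = r + of_nat m' * b)" ..
      then have S: "finite S" "S \<subseteq> \<O>" "\<And>a. a \<in> \<O> \<Longrightarrow> \<exists>r\<in>S. \<exists>b\<in>\<O>. a = r + of_nat m' * b"
        by auto
      from finite_residues_prime[OF q(1)] obtain R where
        R0: "finite R \<and> R \<subseteq> \<O> \<and> (\<forall>a\<in>\<O>. \<exists>r\<in>R. \<exists>b\<in>\<O>. a = r + of_nat q * b)" ..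
      then have R: "finite R" "R \<subseteq> \<O>" "\<And>a. a \<in> \<O> \<Longrightarrow> \<exists>r\<in>R. \<exists>b\<in>\<O>. a = r + of_nat q * b"
        by auto
      define T where "T = (\<lambda>(r, s). r + of_nat q * s) ` (R \<times> S)"
      have "finite T" using R S by (simp add: T_def)
      moreover have "T \<subseteq> \<O>" using R(2) S(2) by (auto simp: T_def subset_iff)
      moreover have "\<exists>r\<in>T. \<exists>b\<in>\<O>. a = r + of_nat m * b" if a: "a \<in> \<O>" for a
      proof -
        obtain r b where rb: "r \<in> R" "b \<in> \<O>" "a = r + of_nat q * b" using R(3)[OF a] by blast
        obtain s d where sd: "s \<in> S" "d \<in> \<O>" "b = s + of_nat m' * d" using S(3)[OF rb(2)] by blast
        have "r + of_nat q * s \<in> T" using rb sd by (auto simp: T_def)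
        moreover have "a = (r + of_nat q * s) + of_nat m * d" using rb sd m by (simp add: algebra_simps)
        ultimately show ?thesis using sd by blast
      qed
      ultimately show ?thesis by blast
    qed
  qed
  then show thesis using that by blast
qed

end

section \<open>The group of fractional ideals\<close>

context number_field
begin

abbreviation fractional :: "complex set \<Rightarrow> bool" where "fractional \<equiv> fractional_ideal L"

abbreviation integral :: "complex set \<Rightarrow> bool" where "integral I \<equiv> fractional I \<and> I \<subseteq> \<O>"

abbreviation primes :: "complex set set" where "primes \<equiv> prime_ideals L"

abbreviation times_ideal (infixl "\<star>" 70) where "I \<star> J \<equiv> ideal_prod CC I J"

lemma fractionalD:
  assumes "fractional I"
  shows "I \<subseteq> L" "0 \<in> I" "a \<in> I \<Longrightarrow> b \<in> I \<Longrightarrow> a + b \<in> I"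
    "r \<in> \<O> \<Longrightarrow> a \<in> I \<Longrightarrow> r * a \<in> I" "a \<in> I \<Longrightarrow> - a \<in> I" "a \<in> I \<Longrightarrow> b \<in> I \<Longrightarrow> a - b \<in> I"
    "\<exists>a\<in>I. a \<noteq> 0" "\<exists>d\<in>\<O>. d \<noteq> 0 \<and> (\<forall>a\<in>I. d * a \<in> \<O>)"
proof -
  show a: "a + b \<in> I" if "a \<in> I" "b \<in> I" for a b using assms that by (auto simp: fractional_ideal_def)
  show r: "r * a \<in> I" if "r \<in> \<O>" "a \<in> I" for r a using assms that by (auto simp: fractional_ideal_def)
  show m: "- a \<in> I" if "a \<in> I" for a using r[of "- 1" a] that by (auto simp: O_closed)
  show "a - b \<in> I" if "a \<in> I" "b \<in> I" for a b using a[OF that(1) m[OF that(2)]] by simp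
qed (use assms in \<open>auto simp: fractional_ideal_def\<close>)

lemma fractional_sum:
  assumes "fractional I" "\<And>i. i \<in> A \<Longrightarrow> f i \<in> I"
  shows "sum f A \<in> I"
  using assms(2) by (induction A rule: infinite_finite_induct)
    (use fractionalD(2,3)[OF assms(1)] in auto)

lemma integral_if:
  assumes "I \<subseteq> \<O>" "a \<in> I" "a \<noteq> 0" "\<And>a b. a \<in> I \<Longrightarrow> b \<in> I \<Longrightarrow> a + b \<in> I"
    "\<And>r a. r \<in> \<O> \<Longrightarrow> a \<in> I \<Longrightarrow> r * a \<in> I"
  shows "integral I"
proof -
  have "0 \<in> I" using assms(5)[of 0 a] assms(2) by simp
  moreover have "\<exists>d\<in>\<O>. d \<noteq> 0 \<and> (\<forall>a\<in>I. d * a \<in> \<O>)" using assms(1) by (intro bexI[of _ 1]) auto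
  moreover have "I \<subseteq> L" using assms(1) O_subset_L by blast
  moreover have "I \<noteq> {0}" using assms(2,3) by blast
  ultimately show ?thesis using assms(1,4,5) by (simp add: fractional_ideal_def)
qed

lemma integral_O: "integral \<O>"
  by (rule integral_if[of _ 1]) auto

text \<open>Trades \<open>primeideal\<close> for conditions on sets of complex numbers, which is the
  form used from here on. An ideal inside \<open>\<O>\<close> is fractional with denominator 1 as
  soon as it is nonzero.\<close>

lemma in_primes_iff:
  "P \<in> primes \<longleftrightarrow> integral P \<and> 1 \<notin> P \<and> (\<forall>a\<in>\<O>. \<forall>b\<in>\<O>. a * b \<in> P \<longrightarrow> a \<in> P \<or> b \<in> P)"
proof
  assume "P \<in> primes"
  then have pr: "primeideal P (CC\<lparr>carrier := \<O>\<rparr>)" and nz: "P \<noteq> {0}"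
    by (auto simp: prime_ideals_def)
  interpret P: primeideal P "CC\<lparr>carrier := \<O>\<rparr>" by (rule pr)
  have sub: "P \<subseteq> \<O>" using P.Icarr by auto
  have add: "a + b \<in> P" if "a \<in> P" "b \<in> P" for a b using additive_subgroup.a_closed[OF P.is_additive_subgroup that] by simp
  have mult: "r * a \<in> P" if "r \<in> \<O>" "a \<in> P" for r a using P.I_l_closed[OF that(2), of r] that by simp
  have "0 \<in> P" using additive_subgroup.zero_closed[OF P.is_additive_subgroup] by simp
  then obtain a where "a \<in> P" "a \<noteq> 0" using nz by blast
  then have "integral P" using integral_if[OF sub] add mult by blast
  moreover have "1 \<notin> P" using P.I_notcarr sub mult[of _ 1] by auto
  ultimately show "integral P \<and> 1 \<notin> P \<and> (\<forall>a\<in>\<O>. \<forall>b\<in>\<O>. a * b \<in> P \<longrightarrow> a \<in> P \<or> b \<in> P)"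
    using P.I_prime by auto
next
  assume r: "integral P \<and> 1 \<notin> P \<and> (\<forall>a\<in>\<O>. \<forall>b\<in>\<O>. a * b \<in> P \<longrightarrow> a \<in> P \<or> b \<in> P)"
  then have f: "fractional P" and sub: "P \<subseteq> \<O>" by auto
  have sr: "subcring \<O> CC"
    by (rule CC.subcringI', rule CC.subringI) auto
  have cr: "cring (CC\<lparr>carrier := \<O>\<rparr>)" by (rule CC.subcring_iff[THEN iffD1, OF _ sr]) auto
  interpret R: cring "CC\<lparr>carrier := \<O>\<rparr>" by (rule cr)
  have sg: "subgroup P (add_monoid (CC\<lparr>carrier := \<O>\<rparr>))"
  proof
    fix a assume a: "a \<in> P"
    then have "a \<in> \<O>" using sub by blast
    then have "inv\<^bsub>add_monoid (CC\<lparr>carrier := \<O>\<rparr>)\<^esub> a = - a"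
      using R.minus_equality[of "- a" a] unfolding a_inv_def by auto
    then show "inv\<^bsub>add_monoid (CC\<lparr>carrier := \<O>\<rparr>)\<^esub> a \<in> P" using fractionalD(5)[OF f a] by simp
  qed (use fractionalD(2,3)[OF f] sub in auto)
  have "ideal P (CC\<lparr>carrier := \<O>\<rparr>)"
  proof (rule idealI[OF R.ring_axioms sg])
    fix a x assume "a \<in> P" "x \<in> carrier (CC\<lparr>carrier := \<O>\<rparr>)"
    then have "x * a \<in> P" using fractionalD(4)[OF f] by simp
    then show "x \<otimes>\<^bsub>CC\<lparr>carrier := \<O>\<rparr>\<^esub> a \<in> P" "a \<otimes>\<^bsub>CC\<lparr>carrier := \<O>\<rparr>\<^esub> x \<in> P"
      by (simp_all add: mult.commute)
  qed
  then have "primeideal P (CC\<lparr>carrier := \<O>\<rparr>)"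
    by (rule primeidealI[OF _ cr]) (use r in auto)
  then show "P \<in> primes" using fractionalD(7)[OF f] unfolding prime_ideals_def by auto
qed

lemma primesD:
  assumes "P \<in> primes"
  shows "fractional P" "P \<subseteq> \<O>" "1 \<notin> P"
    "a \<in> \<O> \<Longrightarrow> b \<in> \<O> \<Longrightarrow> a * b \<in> P \<Longrightarrow> a \<in> P \<or> b \<in> P"
  using assms in_primes_iff by blast+

lemma O_times: "fractional I \<Longrightarrow> \<O> \<star> I = I"
proof
  assume I: "fractional I"
  show "\<O> \<star> I \<subseteq> I" by (rule ideal_prod_subset) (use fractionalD[OF I] in auto)
  show "I \<subseteq> \<O> \<star> I" using ideal_prod_mult[of 1 \<O> _ I] by auto
qed

lemma fractional_times:
  assumes I: "fractional I" and J: "fractional J"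
  shows "fractional (I \<star> J)"
proof -
  have sub: "I \<star> J \<subseteq> L"
    by (rule ideal_prod_subset) (use fractionalD(1)[OF I] fractionalD(1)[OF J] in auto)
  obtain i j where ij: "i \<in> I" "j \<in> J" "i \<noteq> 0" "j \<noteq> 0" using fractionalD(7) I J by blast
  have "i * j \<in> I \<star> J" "i * j \<noteq> 0" using ij ideal_prod_mult by auto
  moreover have "0 \<in> I \<star> J"
    using ideal_prod_mult[OF fractionalD(2)[OF I] fractionalD(2)[OF J]] by simp
  moreover have "r * s \<in> I \<star> J" if "r \<in> \<O>" "s \<in> I \<star> J" for r s
    using that(2)
  proof (induction rule: ideal_prod.induct)
    case (prod i j)
    then show ?case
      using ideal_prod_mult[OF fractionalD(4)[OF I that(1), of i], of j J] by (simp add: mult.assoc)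
  qed (simp add: distrib_left ideal_prod_add)
  moreover obtain d where d: "d \<in> \<O>" "d \<noteq> 0" "\<And>a. a \<in> I \<Longrightarrow> d * a \<in> \<O>"
    using fractionalD(8)[OF I] by blast
  moreover obtain e where e: "e \<in> \<O>" "e \<noteq> 0" "\<And>a. a \<in> J \<Longrightarrow> e * a \<in> \<O>"
    using fractionalD(8)[OF J] by blast
  moreover have "(d * e) * s \<in> \<O>" if "s \<in> I \<star> J" for s
    using that
  proof (induction rule: ideal_prod.induct)
    case (prod i j)
    then show ?case using O_closed(4)[OF d(3) e(3), of i j] by (simp add: mult_ac)
  qed (simp add: distrib_left)
  ultimately show ?thesis
    using sub ideal_prod_add[of _ I J] unfolding fractional_ideal_def
    by (intro conjI bexI[of _ "d * e"]) auto
qed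

lemma integral_times:
  assumes "integral I" "integral J"
  shows "integral (I \<star> J)" "I \<star> J \<subseteq> I" "I \<star> J \<subseteq> J"
proof -
  show 1: "I \<star> J \<subseteq> J" by (rule ideal_prod_subset) (use fractionalD[of J] assms in blast)+
  show 2: "I \<star> J \<subseteq> I"
    by (rule ideal_prod_subset) (use fractionalD[of I] assms in \<open>metis mult.commute subsetD\<close>, use fractionalD[of I] assms in blast)
  show "integral (I \<star> J)" using fractional_times assms 1 by blast
qed

lemma fractional_principal:
  assumes "x \<in> L" "x \<noteq> 0"
  shows "fractional (principal_ideal L x)"
proof -
  obtain m where m: "m > 0" "of_nat m * x \<in> \<O>" using integral_multiple[OF assms(1)] by blast
  have "\<forall>a\<in>principal_ideal L x. of_nat m * a \<in> \<O>"
  proof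
    fix a assume "a \<in> principal_ideal L x"
    then obtain r where r: "r \<in> \<O>" "a = r * x" by (auto simp: principal_ideal_def)
    have "of_nat m * a = r * (of_nat m * x)" unfolding r(2) by (simp add: mult_ac)
    also have "\<dots> \<in> \<O>" by (rule O_closed(4)[OF r(1) m(2)])
    finally show "of_nat m * a \<in> \<O>" .
  qed
  then have "\<exists>d\<in>\<O>. d \<noteq> 0 \<and> (\<forall>a\<in>principal_ideal L x. d * a \<in> \<O>)"
    using m(1) by (intro bexI[of _ "of_nat m"]) auto
  moreover have "x \<in> principal_ideal L x" by (auto simp: principal_ideal_def intro: exI[of _ 1])
  moreover have "0 \<in> principal_ideal L x" by (auto simp: principal_ideal_def)
  moreover have "\<forall>a\<in>principal_ideal L x. \<forall>b\<in>principal_ideal L x. a + b \<in> principal_ideal L x"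
    by (force simp: principal_ideal_def distrib_right[symmetric])
  moreover have "\<forall>r\<in>\<O>. \<forall>a\<in>principal_ideal L x. r * a \<in> principal_ideal L x"
    by (force simp: principal_ideal_def mult.assoc[symmetric])
  moreover have "principal_ideal L x \<subseteq> L" using assms O_subset_L by (auto simp: principal_ideal_def)
  ultimately show ?thesis using assms(2) unfolding fractional_ideal_def by blast
qed

lemma principal_times: "fractional I \<Longrightarrow> principal_ideal L x \<star> I = (\<lambda>a. x * a) ` I"
proof
  assume I: "fractional I"
  show "principal_ideal L x \<star> I \<subseteq> (\<lambda>a. x * a) ` I"
  proof (rule ideal_prod_subset)
    fix i j assume "i \<in> principal_ideal L x" "j \<in> I"
    then obtain a where "a \<in> \<O>" "i = a * x" by (auto simp: principal_ideal_def)
    then show "i * j \<in> (\<lambda>a. x * a) ` I"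
      using fractionalD(4)[OF I, of a j] \<open>j \<in> I\<close> by (intro image_eqI[of _ _ "a * j"]) auto
  next
    fix a b assume "a \<in> (\<lambda>a. x * a) ` I" "b \<in> (\<lambda>a. x * a) ` I"
    then show "a + b \<in> (\<lambda>a. x * a) ` I"
      using fractionalD(3)[OF I] by (auto simp: distrib_left[symmetric])
  qed
  have "x \<in> principal_ideal L x" by (auto simp: principal_ideal_def intro: exI[of _ 1])
  then show "(\<lambda>a. x * a) ` I \<subseteq> principal_ideal L x \<star> I" using ideal_prod_mult by blast
qed

lemma principal_eq_image: "principal_ideal L x = (\<lambda>a. x * a) ` \<O>"
  by (auto simp: principal_ideal_def image_def mult.commute)

lemma principal_mult:
  assumes "y \<in> L" "y \<noteq> 0"
  shows "principal_ideal L (x * y) = principal_ideal L x \<star> principal_ideal L y"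
  unfolding principal_times[OF fractional_principal[OF assms]]
  by (simp add: principal_eq_image image_image mult.assoc)

lemma principal_one: "principal_ideal L 1 = \<O>"
  by (simp add: principal_eq_image)

section \<open>Integers in ideals: finiteness and maximality\<close>

lemma ex_nat_in_integral:
  assumes "integral I"
  obtains m :: nat where "m > 0" "of_nat m \<in> I"
proof -
  obtain a where a: "a \<in> I" "a \<noteq> 0" using assms fractionalD(7) by blast
  then have "inverse a \<in> L" using assms O_subset_L by blast
  then obtain m where m: "m > 0" "of_nat m * inverse a \<in> \<O>" using integral_multiple by blast
  have "(of_nat m * inverse a) * a \<in> I" using fractionalD(4)[of I] assms m a by blast
  then show thesis using that m a by (simp add: mult.assoc)
qed

text \<open>An ideal containing the integer \<open>m\<close> is a union of residue classes modulo
  \<open>m\<close>, so it is determined by the representatives it contains. This finiteness plays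
  the part of the Noetherian condition.\<close>

lemma finite_integral_above:
  assumes "integral I"
  shows "finite {J. integral J \<and> I \<subseteq> J}"
proof -
  obtain m where m: "m > 0" "of_nat m \<in> I" using ex_nat_in_integral[OF assms] by blast
  obtain R where R: "finite R" "R \<subseteq> \<O>" "\<And>a. a \<in> \<O> \<Longrightarrow> \<exists>r\<in>R. \<exists>b\<in>\<O>. a = r + of_nat m * b"
    using finite_residues[OF m(1)] by blast
  have "J \<subseteq> J'" if J: "integral J" "I \<subseteq> J" "integral J'" "I \<subseteq> J'" "J \<inter> R = J' \<inter> R" for J J'
  proof
    fix a assume a: "a \<in> J"
    then obtain r b where rb: "r \<in> R" "b \<in> \<O>" "a = r + of_nat m * b" using R(3) J(1) by blast
    have mb: "of_nat m * b \<in> J" "of_nat m * b \<in> J'"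
      using fractionalD(4)[of J b "of_nat m"] fractionalD(4)[of J' b "of_nat m"] J m rb
      by (auto simp: mult.commute)
    have "r = a - of_nat m * b" using rb by simp
    then have "r \<in> J" using fractionalD(6)[of J] J(1) a mb(1) by simp
    then have "r \<in> J'" using J(5) rb(1) by blast
    then show "a \<in> J'" using fractionalD(3)[of J'] J(3) mb(2) rb(3) by simp
  qed
  then have "inj_on (\<lambda>J. J \<inter> R) {J. integral J \<and> I \<subseteq> J}" by (intro inj_onI) blast
  moreover have "finite ((\<lambda>J. J \<inter> R) ` {J. integral J \<and> I \<subseteq> J})"
    by (rule finite_subset[of _ "Pow R"]) (use R in auto)
  ultimately show ?thesis by (rule finite_imageD[rotated])
qed

text \<open>The decreasing measure of the Noetherian inductions below.\<close>

lemma card_integral_above_less: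
  assumes "integral I" "integral J" "I \<subset> J"
  shows "card {J'. integral J' \<and> J \<subseteq> J'} < card {J'. integral J' \<and> I \<subseteq> J'}"
  by (rule psubset_card_mono[OF finite_integral_above[OF assms(1)]]) (use assms in auto)

text \<open>Pigeonhole for the finitely many residues modulo \<open>m\<close>. Applied to powers of
  one element it yields integrality as well as inverses modulo a prime.\<close>

lemma residue_collision:
  assumes m: "m > 0" and g: "\<And>k::nat. g k \<in> \<O>"
  obtains i j b where "i < j" "b \<in> \<O>" "g j - g i = of_nat m * b"
proof -
  obtain R where R: "finite R" "R \<subseteq> \<O>" "\<And>a. a \<in> \<O> \<Longrightarrow> \<exists>r\<in>R. \<exists>b\<in>\<O>. a = r + of_nat m * b"
    using finite_residues[OF m] by blast
  have "\<forall>k. \<exists>r. r \<in> R \<and> (\<exists>b\<in>\<O>. g k = r + of_nat m * b)" using R(3)[OF g] by blast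
  then obtain r where r: "\<forall>k. r k \<in> R \<and> (\<exists>b\<in>\<O>. g k = r k + of_nat m * b)" by metis
  have "\<not> inj r"
  proof
    assume "inj r"
    then have "infinite (range r)" using finite_imageD infinite_UNIV_nat by blast
    moreover have "range r \<subseteq> R" using r by auto
    ultimately show False using R(1) finite_subset by blast
  qed
  then obtain i j where ij: "i < j" "r i = r j" by (metis injI linorder_neqE_nat)
  obtain b where b: "b \<in> \<O>" "g i = r i + of_nat m * b" using r by blast
  obtain b' where b': "b' \<in> \<O>" "g j = r i + of_nat m * b'" using r ij by metis
  have "g j - g i = of_nat m * (b' - b)" using b b' by (simp add: algebra_simps)
  then show thesis using that[OF ij(1), of "b' - b"] b b' by simp
qed

text \<open>If \<open>a\<close> stays integral after multiplication by all powers of \<open>x\<close>, the residues of these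
  products modulo an integer repeat, so \<open>x\<close> satisfies an equation \<open>X ^ j - X ^ i = b\<close>.\<close>

lemma integral_multiplier:
  assumes I: "fractional I" and x: "x \<in> L" "\<And>a. a \<in> I \<Longrightarrow> x * a \<in> I"
  shows "x \<in> \<O>"
proof -
  obtain a where a: "a \<in> I" "a \<noteq> 0" using fractionalD(7)[OF I] by blast
  obtain d where d: "d \<in> \<O>" "d \<noteq> 0" "\<And>a. a \<in> I \<Longrightarrow> d * a \<in> \<O>" using fractionalD(8)[OF I] by blast
  have da: "d * a \<in> \<O>" "d * a \<noteq> 0" using d a by auto
  then have "inverse (d * a) \<in> L" using O_subset_L by blast
  then obtain m where m: "m > 0" "of_nat m * inverse (d * a) \<in> \<O>" using integral_multiple by blast
  have pow: "x ^ k * a \<in> I" for k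
    by (induction k) (use a x in \<open>auto simp: mult.assoc\<close>)
  \<comment> \<open>One \<open>m\<close> serves all powers: \<open>x ^ k\<close> is the algebraic
    integer \<open>d * (x ^ k * a)\<close> divided by the fixed number \<open>d * a\<close>.\<close>
  have mx: "of_nat m * x ^ k \<in> \<O>" for k
  proof -
    have "(of_nat m * inverse (d * a)) * (d * (x ^ k * a)) \<in> \<O>" using m(2) d(3)[OF pow] by blast
    then show ?thesis using da(2) by (simp add: field_simps)
  qed
  obtain i j b where ij: "i < j" and b: "b \<in> \<O>" "of_nat m * x ^ j - of_nat m * x ^ i = of_nat m * b"
    using residue_collision[OF m(1), of "\<lambda>k. of_nat m * x ^ k"] mx by blast
  have "of_nat m * (x ^ j - x ^ i) = of_nat m * b" using b(2) by (simp add: right_diff_distrib)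
  then have e: "x ^ j - x ^ i = b" using m(1) by simp
  define p where "p = Polynomial.monom 1 j - Polynomial.monom (1::complex) i"
  have deg: "degree p = j" unfolding p_def diff_conv_add_uminus
    using ij by (subst degree_add_eq_left) (auto simp: degree_monom_eq)
  have "algebraic_int x"
  proof (rule algebraic_int_root[of b p])
    show "algebraic_int b" using b(1) by (simp add: integers_of_def)
    show "poly p x = b" using e by (simp add: p_def poly_monom)
    show "\<forall>i. poly.coeff p i \<in> \<int>" by (auto simp: p_def)
    show "lead_coeff p = 1" unfolding deg using ij by (simp add: p_def)
    show "degree p > 0" using deg ij by simp
  qed
  then show ?thesis using x(1) by (simp add: integers_of_def)
qed

text \<open>Powers of \<open>a\<close> repeat modulo an integer in \<open>P\<close>, so
  \<open>a ^ i * (1 - a ^ (j - i))\<close> lies in \<open>P\<close> for some \<open>i < j\<close>.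
  No power of \<open>a\<close> lies in \<open>P\<close>, hence \<open>a ^ (j - i - 1)\<close>
  inverts \<open>a\<close> modulo \<open>P\<close>.\<close>

lemma prime_maximal:
  assumes P: "P \<in> primes" and a: "a \<in> \<O>" "a \<notin> P"
  obtains b where "b \<in> \<O>" "1 - a * b \<in> P"
proof -
  note p = primesD[OF P]
  obtain m where m: "m > 0" "of_nat m \<in> P" using ex_nat_in_integral p by blast
  obtain i j b where ij: "i < j" and b: "b \<in> \<O>" "a ^ j - a ^ i = of_nat m * b"
    using residue_collision[OF m(1), of "\<lambda>k. a ^ k"] a(1) by blast
  have "a ^ i - a ^ j = - b * of_nat m" using b(2) by (simp add: algebra_simps)
  also have "\<dots> \<in> P" using fractionalD(4)[OF p(1) _ m(2), of "- b"] b(1) by simp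
  finally have "a ^ i - a ^ j \<in> P" .
  moreover have "a ^ j = a ^ i * a ^ (j - i)" using ij by (simp flip: power_add)
  ultimately have "a ^ i * (1 - a ^ (j - i)) \<in> P" by (simp add: algebra_simps)
  moreover have "a ^ k \<notin> P" for k
    by (induction k) (use p a in \<open>auto dest!: p(4)[rotated 2]\<close>)
  ultimately have "1 - a ^ (j - i) \<in> P" using p(4)[of "a ^ i" "1 - a ^ (j - i)"] a by auto
  moreover have "a ^ (j - i) = a * a ^ (j - i - 1)" using ij by (metis power_minus_mult mult.commute zero_less_diff)
  ultimately show thesis using that[of "a ^ (j - i - 1)"] a by auto
qed

lemma prime_not_le:
  assumes "P \<in> primes" "Q \<in> primes" "P \<subseteq> Q"
  shows "P = Q"
proof (rule ccontr)
  assume "P \<noteq> Q"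
  then obtain a where a: "a \<in> Q" "a \<notin> P" using assms(3) by blast
  note q = primesD[OF assms(2)]
  obtain b where b: "b \<in> \<O>" "1 - a * b \<in> P" using prime_maximal[OF assms(1)] a q(2) by blast
  have "a * b \<in> Q" using fractionalD(4)[OF q(1) b(1) a(1)] by (simp add: mult.commute)
  then have "(1 - a * b) + a * b \<in> Q" using fractionalD(3)[OF q(1)] b assms(3) by blast
  then show False using q(3) by simp
qed

section \<open>Products of primes, inverses and factorization\<close>

lemma prime_contains_times:
  assumes "P \<in> primes" "I \<subseteq> \<O>" "J \<subseteq> \<O>" "I \<star> J \<subseteq> P"
  shows "I \<subseteq> P \<or> J \<subseteq> P"
proof (rule ccontr)
  assume "\<not> ?thesis"
  then obtain a b where "a \<in> I" "a \<notin> P" "b \<in> J" "b \<notin> P" by blast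
  then show False using ideal_prod_mult[of a I b J] primesD(4)[OF assms(1), of a b] assms by blast
qed

abbreviation list_prod :: "complex set list \<Rightarrow> complex set" where
  "list_prod Ps \<equiv> foldr (\<lambda>P I. P \<star> I) Ps \<O>"

lemma integral_list_prod: "set Ps \<subseteq> primes \<Longrightarrow> integral (list_prod Ps)"
proof (induction Ps)
  case (Cons P Ps)
  then show ?case using integral_times(1)[of P "list_prod Ps"] primesD(1,2)[of P] by auto
qed (use integral_O in simp)

lemma list_prod_append:
  "set Ps \<subseteq> primes \<Longrightarrow> set Qs \<subseteq> primes \<Longrightarrow> list_prod (Ps @ Qs) = list_prod Ps \<star> list_prod Qs"
proof (induction Ps)
  case Nil
  then show ?case using O_times integral_list_prod by simp
qed (simp add: ideal_prod_assoc)

lemma prime_contains_list_prod: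
  assumes "P \<in> primes" "set Ps \<subseteq> primes" "list_prod Ps \<subseteq> P"
  shows "P \<in> set Ps"
  using assms(2,3)
proof (induction Ps)
  case Nil
  then show ?case using primesD(3)[OF assms(1)] O_closed(1) by auto
next
  case (Cons Q Ps)
  then have "Q \<subseteq> P \<or> list_prod Ps \<subseteq> P"
    using prime_contains_times[OF assms(1), of Q "list_prod Ps"] primesD(2)[of Q] integral_list_prod[of Ps]
    by auto
  then show ?case using Cons prime_not_le[of Q P] assms(1) by auto
qed

lemma integral_extend:
  assumes I: "integral I" and a: "a \<in> \<O>"
  defines "J \<equiv> {i + r * a | i r. i \<in> I \<and> r \<in> \<O>}"
  shows "integral J" "I \<subseteq> J" "a \<in> J"
proof -
  have fI: "fractional I" using I by blast
  show IJ: "I \<subseteq> J"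
  proof
    fix i assume "i \<in> I"
    then show "i \<in> J" unfolding J_def by (intro CollectI exI[of _ i] exI[of _ 0]) auto
  qed
  show "a \<in> J" unfolding J_def
    by (intro CollectI exI[of _ 0] exI[of _ 1]) (use fractionalD(2)[OF fI] in auto)
  obtain c where c: "c \<in> I" "c \<noteq> 0" using fractionalD(7)[OF fI] by blast
  show "integral J"
  proof (rule integral_if[of _ c])
    show "J \<subseteq> \<O>" unfolding J_def using I a by auto
    show "c \<in> J" using c IJ by blast
    show "x + y \<in> J" if "x \<in> J" "y \<in> J" for x y
    proof -
      from that obtain i r j s where "x = i + r * a" "y = j + s * a" "i \<in> I" "j \<in> I" "r \<in> \<O>" "s \<in> \<O>"
        unfolding J_def by blast
      then have "x + y = (i + j) + (r + s) * a" "i + j \<in> I" "r + s \<in> \<O>"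
        using fractionalD(3)[OF fI] by (auto simp: algebra_simps)
      then show ?thesis unfolding J_def by blast
    qed
    show "t * x \<in> J" if "t \<in> \<O>" "x \<in> J" for t x
    proof -
      from that obtain i r where "x = i + r * a" "i \<in> I" "r \<in> \<O>" unfolding J_def by blast
      then have "t * x = t * i + (t * r) * a" "t * i \<in> I" "t * r \<in> \<O>"
        using fractionalD(4)[OF fI that(1), of i] that(1) by (simp_all add: algebra_simps)
      then show ?thesis unfolding J_def by blast
    qed
  qed (use c in auto)
qed

text \<open>If \<open>a * b\<close> lies in \<open>I\<close> but neither \<open>a\<close> nor
  \<open>b\<close> does, adjoining \<open>a\<close> and adjoining \<open>b\<close> give two strictly
  larger ideals whose product falls back into \<open>I\<close>.\<close>

lemma integral_not_prime_extend:
  assumes I: "integral I" "I \<notin> primes" "I \<noteq> \<O>"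
  obtains J J' where "integral J" "integral J'" "I \<subset> J" "I \<subset> J'" "J \<star> J' \<subseteq> I"
proof -
  have fI: "fractional I" using I by blast
  have "1 \<notin> I"
  proof
    assume "1 \<in> I"
    then have "\<O> \<subseteq> I" using fractionalD(4)[OF fI, of _ 1] by auto
    then show False using I by blast
  qed
  then obtain a b where ab: "a \<in> \<O>" "b \<in> \<O>" "a * b \<in> I" "a \<notin> I" "b \<notin> I"
    using in_primes_iff[of I] I by blast
  define J where "J = {i + r * a | i r. i \<in> I \<and> r \<in> \<O>}"
  define J' where "J' = {i + r * b | i r. i \<in> I \<and> r \<in> \<O>}"
  note j = integral_extend[OF I(1) ab(1), folded J_def] integral_extend[OF I(1) ab(2), folded J'_def]
  have "J \<star> J' \<subseteq> I"
  proof (rule ideal_prod_subset)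
    fix x y assume "x \<in> J" "y \<in> J'"
    then obtain i r k s where h: "x = i + r * a" "y = k + s * b" "i \<in> I" "k \<in> I" "r \<in> \<O>" "s \<in> \<O>"
      unfolding J_def J'_def by blast
    have "x * y = (k + s * b) * i + ((r * a) * k + (r * s) * (a * b))" using h by (simp add: algebra_simps)
    moreover have "k + s * b \<in> \<O>" "r * a \<in> \<O>" "r * s \<in> \<O>" using h ab I by auto
    ultimately show "x * y \<in> I" using fractionalD(3,4)[OF fI] h ab by metis
  qed (use fractionalD(3)[OF fI] in blast)
  then show thesis using that j ab by blast
qed

text \<open>A nonprime proper ideal contains the product of two larger ones, so the lists obtained
  for these can be concatenated. Only an inclusion can be had at this stage; equality needs inverses
  of primes.\<close>

lemma ex_list_prod_le:
  assumes "integral I"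
  shows "\<exists>Ps. set Ps \<subseteq> primes \<and> list_prod Ps \<subseteq> I"
  using assms
proof (induction "card {J'. integral J' \<and> I \<subseteq> J'}" arbitrary: I rule: less_induct)
  case less
  consider "I = \<O>" | "I \<in> primes" | "I \<notin> primes" "I \<noteq> \<O>" by blast
  then show ?case
  proof cases
    case 1
    then show ?thesis by (intro exI[of _ "[]"]) simp
  next
    case 2
    then show ?thesis using O_times primesD(1)[of I]
      by (intro exI[of _ "[I]"]) (simp add: ideal_prod_comm[of I])
  next
    case 3
    then obtain J J' where J: "integral J" "integral J'" "I \<subset> J" "I \<subset> J'" "J \<star> J' \<subseteq> I"
      using integral_not_prime_extend less.prems by blast
    obtain Ps where Ps: "set Ps \<subseteq> primes" "list_prod Ps \<subseteq> J"
      using less.hyps[OF card_integral_above_less[OF less.prems J(1,3)] J(1)] by blast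
    obtain Qs where Qs: "set Qs \<subseteq> primes" "list_prod Qs \<subseteq> J'"
      using less.hyps[OF card_integral_above_less[OF less.prems J(2,4)] J(2)] by blast
    have "list_prod (Ps @ Qs) \<subseteq> J \<star> J'"
      unfolding list_prod_append[OF Ps(1) Qs(1)] by (rule ideal_prod_mono[OF Ps(2) Qs(2)])
    then show ?thesis using J Ps Qs by (intro exI[of _ "Ps @ Qs"]) auto
  qed
qed

text \<open>If the first of the two larger ideals were all of \<open>\<O>\<close>, the second would
  lie in \<open>I\<close>. So the first is proper and the induction applies to it.\<close>

lemma ex_prime_above:
  assumes I: "integral I" "I \<noteq> \<O>"
  shows "\<exists>P\<in>primes. I \<subseteq> P"
  using assms
proof (induction "card {J'. integral J' \<and> I \<subseteq> J'}" arbitrary: I rule: less_induct)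
  case less
  show ?case
  proof (cases "I \<in> primes")
    case False
    then obtain J J' where J: "integral J" "integral J'" "I \<subset> J" "I \<subset> J'" "J \<star> J' \<subseteq> I"
      using integral_not_prime_extend less.prems by metis
    show ?thesis
    proof (cases "J = \<O>")
      case True
      then have "J' \<subseteq> I" using O_times[of J'] J by simp
      then show ?thesis using J by blast
    next
      case False
      then show ?thesis
        using less.hyps[OF card_integral_above_less[OF less.prems(1) J(1,3)] J(1)] J(3) by blast
    qed
  qed auto
qed

text \<open>For nonzero \<open>a\<close> in \<open>P\<close> take a shortest list of primes whose
  product lies in the principal ideal of \<open>a\<close>. Then \<open>P\<close> is one of them, and
  the product of the others contains some \<open>b\<close> outside that ideal;
  \<open>c = b / a\<close> is not integral but carries \<open>P\<close> into
  \<open>\<O>\<close>.\<close>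

lemma ex_nonintegral_multiplier:
  assumes P: "P \<in> primes"
  obtains c where "c \<in> L" "c \<notin> \<O>" "\<And>a. a \<in> P \<Longrightarrow> c * a \<in> \<O>"
proof -
  note p = primesD[OF P]
  obtain a where a: "a \<in> P" "a \<noteq> 0" using fractionalD(7)[OF p(1)] by blast
  then have aO: "a \<in> \<O>" "a \<in> L" using p(2) O_subset_L by auto
  have pa: "principal_ideal L a \<subseteq> P"
    using fractionalD(4)[OF p(1) _ a(1)] by (auto simp: principal_ideal_def)
  have ia: "integral (principal_ideal L a)" using fractional_principal[OF aO(2) a(2)] pa p(2) by blast
  define good where "good k \<longleftrightarrow> (\<exists>Ps. length Ps = k \<and> set Ps \<subseteq> primes \<and> list_prod Ps \<subseteq> principal_ideal L a)" for k
  have "\<exists>k. good k" using ex_list_prod_le[OF ia] by (auto simp: good_def)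
  then have g: "good (LEAST k. good k)" by (rule LeastI_ex)
  then obtain Ps where Ps: "length Ps = (LEAST k. good k)" "set Ps \<subseteq> primes" "list_prod Ps \<subseteq> principal_ideal L a"
    by (auto simp: good_def)
  have "P \<in> set Ps" using prime_contains_list_prod[OF P Ps(2)] Ps(3) pa by blast
  then obtain Qs Rs where QR: "Ps = Qs @ P # Rs" by (meson split_list)
  have sub: "set Qs \<subseteq> primes" "set Rs \<subseteq> primes" using Ps(2) QR by auto
  have "list_prod Ps = list_prod Qs \<star> (P \<star> list_prod Rs)"
    using list_prod_append[of Qs "P # Rs"] sub P QR by simp
  also have "\<dots> = P \<star> (list_prod Qs \<star> list_prod Rs)"
    by (metis ideal_prod_assoc ideal_prod_comm)
  finally have PsQR: "list_prod Ps = P \<star> list_prod (Qs @ Rs)"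
    using list_prod_append[OF sub] by (simp only:)
  have "length (Qs @ Rs) < (LEAST k. good k)" using Ps(1)[symmetric] QR by simp
  then have "\<not> good (length (Qs @ Rs))" by (rule not_less_Least)
  moreover have "good (length (Qs @ Rs))" if "list_prod (Qs @ Rs) \<subseteq> principal_ideal L a"
    unfolding good_def using sub that by (intro exI[of _ "Qs @ Rs"]) (simp only: set_append Un_subset_iff simp_thms)
  ultimately have "\<not> list_prod (Qs @ Rs) \<subseteq> principal_ideal L a" by blast
  then obtain b where b: "b \<in> list_prod (Qs @ Rs)" "b \<notin> principal_ideal L a" by blast
  have bL: "b \<in> L" using b(1) integral_list_prod[of "Qs @ Rs"] sub O_subset_L by auto
  have "b / a \<notin> \<O>"
  proof
    assume "b / a \<in> \<O>"
    then show False using b(2) a(2) unfolding principal_ideal_def by (auto intro: exI[of _ "b / a"])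
  qed
  moreover have "b / a * t \<in> \<O>" if "t \<in> P" for t
  proof -
    have "t * b \<in> list_prod Ps" unfolding PsQR using that b(1) by (rule ideal_prod_mult)
    then obtain s where "s \<in> \<O>" "t * b = s * a" using Ps(3) by (auto simp: principal_ideal_def)
    then show ?thesis using a(2) by (simp add: field_simps)
  qed
  ultimately show thesis using that[of "b / a"] bL aO by auto
qed

text \<open>\<open>Q\<close> consists of all \<open>c\<close> in \<open>L\<close> that carry
  \<open>P\<close> into \<open>\<O>\<close>. A nonintegral \<open>c\<close> in \<open>Q\<close>
  cannot map an ideal into itself, so \<open>I \<star> Q \<noteq> I\<close>; for
  \<open>I = P\<close> this makes \<open>P \<star> Q\<close> strictly larger than \<open>P\<close>,
  hence equal to \<open>\<O>\<close> by maximality. The inequality is exported because it makes the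
  induction for factorization advance.\<close>

lemma prime_invertible:
  assumes P: "P \<in> primes"
  obtains Q where "fractional Q" "P \<star> Q = \<O>" "\<O> \<subseteq> Q" "\<And>I. integral I \<Longrightarrow> I \<star> Q \<noteq> I"
proof -
  note p = primesD[OF P]
  define Q where "Q = {c \<in> L. \<forall>a\<in>P. c * a \<in> \<O>}"
  obtain m where m: "m > 0" "of_nat m \<in> P" using ex_nat_in_integral p by blast
  have OQ: "\<O> \<subseteq> Q" using p(2) O_subset_L by (auto simp: Q_def)
  have fQ: "fractional Q"
    unfolding fractional_ideal_def
  proof (intro conjI ballI)
    show "\<exists>d\<in>\<O>. d \<noteq> 0 \<and> (\<forall>a\<in>Q. d * a \<in> \<O>)"
      using m by (intro bexI[of _ "of_nat m"]) (auto simp: Q_def mult.commute)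
    show "Q \<noteq> {0}" using OQ O_closed(1) by (metis singletonD subsetD zero_neq_one)
    show "a + b \<in> Q" if "a \<in> Q" "b \<in> Q" for a b using that by (auto simp: Q_def distrib_right)
    show "r * a \<in> Q" if "r \<in> \<O>" "a \<in> Q" for r a using that O_subset_L by (auto simp: Q_def mult.assoc)
  qed (use OQ in \<open>auto simp: Q_def\<close>)
  have ne: "I \<star> Q \<noteq> I" if I: "integral I" for I
  proof
    assume e: "I \<star> Q = I"
    obtain c where c: "c \<in> L" "c \<notin> \<O>" "\<And>a. a \<in> P \<Longrightarrow> c * a \<in> \<O>"
      using ex_nonintegral_multiplier[OF P] by blast
    then have "c \<in> Q" by (auto simp: Q_def)
    then have "c * a \<in> I" if "a \<in> I" for a using ideal_prod_mult[OF that, of c Q] e by (simp add: mult.commute)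
    then show False using integral_multiplier[of I c] I c by blast
  qed
  have PQ: "P \<star> Q \<subseteq> \<O>" by (rule ideal_prod_subset) (auto simp: Q_def mult.commute)
  have "P \<subseteq> P \<star> Q" using ideal_prod_mono[of P P \<O> Q] O_times[OF p(1)] OQ by (simp add: ideal_prod_comm)
  then obtain a where a: "a \<in> P \<star> Q" "a \<notin> P" using ne[of P] p by blast
  then obtain b where b: "b \<in> \<O>" "1 - a * b \<in> P" using prime_maximal[OF P, of a] PQ by blast
  have fPQ: "fractional (P \<star> Q)" by (rule fractional_times[OF p(1) fQ])
  have "(1 - a * b) + b * a \<in> P \<star> Q"
    using fractionalD(3,4)[OF fPQ] a b \<open>P \<subseteq> P \<star> Q\<close> by blast
  then have "1 \<in> P \<star> Q" by (simp add: mult.commute)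
  then have "\<O> \<subseteq> P \<star> Q" using fractionalD(4)[OF fPQ, of _ 1] by auto
  then show thesis using that fQ PQ OQ ne by blast
qed

text \<open>Multiplying \<open>I\<close> by the inverse of a prime above it gives a strictly larger
  integral ideal; a factorization of that ideal with the prime prepended is one of
  \<open>I\<close>.\<close>

lemma integral_eq_list_prod:
  assumes "integral I"
  shows "\<exists>Ps. set Ps \<subseteq> primes \<and> list_prod Ps = I"
  using assms
proof (induction "card {J'. integral J' \<and> I \<subseteq> J'}" arbitrary: I rule: less_induct)
  case less
  show ?case
  proof (cases "I = \<O>")
    case True
    then show ?thesis by (intro exI[of _ "[]"]) simp
  next
    case False
    then obtain P where P: "P \<in> primes" "I \<subseteq> P" using ex_prime_above less.prems by blast
    obtain Q where Q: "fractional Q" "P \<star> Q = \<O>" "\<O> \<subseteq> Q" "\<And>I. integral I \<Longrightarrow> I \<star> Q \<noteq> I"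
      using prime_invertible[OF P(1)] by blast
    have "I \<subseteq> I \<star> Q" using ideal_prod_mono[of I I \<O> Q] O_times[of I] Q(3) less.prems
      by (simp add: ideal_prod_comm)
    then have s: "I \<subset> I \<star> Q" using Q(4) less.prems by blast
    have i: "integral (I \<star> Q)"
      using ideal_prod_mono[OF P(2), of Q Q] Q(1,2) fractional_times less.prems by auto
    obtain Ps where Ps: "set Ps \<subseteq> primes" "list_prod Ps = I \<star> Q"
      using less.hyps[OF card_integral_above_less[OF less.prems i s] i] by blast
    have "list_prod (P # Ps) = P \<star> (I \<star> Q)" using Ps(2) by simp
    also have "\<dots> = (P \<star> Q) \<star> I" by (metis ideal_prod_assoc ideal_prod_comm)
    also have "\<dots> = I" using Q(2) O_times[of I] less.prems by simp
    finally show ?thesis using Ps P by (intro exI[of _ "P # Ps"]) simp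
  qed
qed

lemma list_prod_invertible:
  "set Ps \<subseteq> primes \<Longrightarrow> \<exists>J. fractional J \<and> list_prod Ps \<star> J = \<O>"
proof (induction Ps)
  case Nil
  then show ?case using O_times integral_O by (intro exI[of _ \<O>]) simp
next
  case (Cons P Ps)
  then obtain J where J: "fractional J" "list_prod Ps \<star> J = \<O>" by auto
  have "P \<in> primes" using Cons.prems by simp
  then obtain Q where Q: "fractional Q" "P \<star> Q = \<O>" by (rule prime_invertible)
  have "list_prod (P # Ps) \<star> (J \<star> Q) = P \<star> ((list_prod Ps \<star> J) \<star> Q)"
    by (simp add: ideal_prod_assoc)
  also have "\<dots> = \<O>" using J Q O_times by simp
  finally show ?case using fractional_times J Q by blast
qed

lemma fractional_eq_quotient:
  assumes I: "fractional I"
  obtains d where "d \<in> \<O>" "d \<noteq> 0" "integral (principal_ideal L d \<star> I)"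
proof -
  obtain d where d: "d \<in> \<O>" "d \<noteq> 0" "\<And>a. a \<in> I \<Longrightarrow> d * a \<in> \<O>" using fractionalD(8)[OF I] by blast
  have "integral (principal_ideal L d \<star> I)"
    using fractional_times[OF fractional_principal I, of d] d O_subset_L
    by (auto simp: principal_times[OF I])
  then show thesis using that d by blast
qed

lemma fractional_invertible:
  assumes I: "fractional I"
  shows "\<exists>J. fractional J \<and> J \<star> I = \<O>"
proof -
  obtain d where d: "d \<in> \<O>" "d \<noteq> 0" "integral (principal_ideal L d \<star> I)"
    using fractional_eq_quotient[OF I] by blast
  obtain Ps where Ps: "set Ps \<subseteq> primes" "list_prod Ps = principal_ideal L d \<star> I"
    using integral_eq_list_prod[OF d(3)] by blast
  obtain J where J: "fractional J" "list_prod Ps \<star> J = \<O>" using list_prod_invertible[OF Ps(1)] by blast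
  have "(J \<star> principal_ideal L d) \<star> I = \<O>"
    using J(2) unfolding Ps(2) by (metis ideal_prod_assoc ideal_prod_comm)
  moreover have "fractional (J \<star> principal_ideal L d)"
    using fractional_times[OF J(1) fractional_principal] d O_subset_L by blast
  ultimately show ?thesis by blast
qed

lemma ideal_group_simps [simp]:
  "carrier (ideal_group L) = {I. fractional I}" "I \<otimes>\<^bsub>ideal_group L\<^esub> J = I \<star> J"
  "\<one>\<^bsub>ideal_group L\<^esub> = \<O>"
  by (simp_all add: ideal_group_def)

lemma comm_group_ideal_group: "comm_group (ideal_group L)"
  by (rule comm_groupI)
    (use fractional_times integral_O ideal_prod_assoc ideal_prod_comm O_times fractional_invertible
      in auto)

end

section \<open>Prime factorization and valuations\<close>

sublocale number_field \<subseteq> G: comm_group "ideal_group L"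
  by (rule comm_group_ideal_group)

context number_field
begin

text \<open>The divisors of \<open>L\<close>, cut out by the same two conditions as in
  \<open>ideal_exponents\<close>. They vanish on sets that are not prime ideals, so that an ideal
  can determine its \<open>v\<close> at every argument.\<close>

definition exponent_functions :: "(complex set \<Rightarrow> int) set" where
  "exponent_functions = {v. finite {P. v P \<noteq> 0} \<and> {P. v P \<noteq> 0} \<subseteq> primes}"

definition ideal_of :: "(complex set \<Rightarrow> int) \<Rightarrow> complex set" where
  "ideal_of v = finprod (ideal_group L) (\<lambda>P. P [^]\<^bsub>ideal_group L\<^esub> v P) {P. v P \<noteq> 0}"

lemma prime_in_carrier: "P \<in> primes \<Longrightarrow> P \<in> carrier (ideal_group L)"
  using primesD(1) by simp

text \<open>Factors with exponent zero are trivial, so products belonging to functions with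
  different supports can be compared over a common index set.\<close>

lemma ideal_of_eq:
  assumes "finite A" "A \<subseteq> primes" "{P. v P \<noteq> 0} \<subseteq> A"
  shows "ideal_of v = finprod (ideal_group L) (\<lambda>P. P [^]\<^bsub>ideal_group L\<^esub> v P) A"
  unfolding ideal_of_def
proof (rule G.finprod_mono_neutral_cong_left[OF assms(1,3)])
  fix P assume "P \<in> A - {P. v P \<noteq> 0}"
  then show "P [^]\<^bsub>ideal_group L\<^esub> v P = \<one>\<^bsub>ideal_group L\<^esub>" by (simp del: ideal_group_simps)
next
  show "(\<lambda>P. P [^]\<^bsub>ideal_group L\<^esub> v P) \<in> A \<rightarrow> carrier (ideal_group L)"
    using assms(2) prime_in_carrier by (blast intro: G.int_pow_closed)
qed simp

lemma fractional_ideal_of: "v \<in> exponent_functions \<Longrightarrow> fractional (ideal_of v)"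
proof -
  assume v: "v \<in> exponent_functions"
  have "ideal_of v \<in> carrier (ideal_group L)"
    unfolding ideal_of_def by (rule G.finprod_closed)
      (use v prime_in_carrier in \<open>auto simp: exponent_functions_def simp del: ideal_group_simps intro: G.int_pow_closed\<close>)
  then show ?thesis by simp
qed

lemma exponent_functions_add:
  assumes "v \<in> exponent_functions" "w \<in> exponent_functions"
  shows "(\<lambda>P. v P + w P) \<in> exponent_functions"
proof -
  have "{P. v P + w P \<noteq> 0} \<subseteq> {P. v P \<noteq> 0} \<union> {P. w P \<noteq> 0}" by auto
  moreover have "finite ({P. v P \<noteq> 0} \<union> {P. w P \<noteq> 0})" using assms by (auto simp: exponent_functions_def)
  ultimately have "finite {P. v P + w P \<noteq> 0}" by (rule finite_subset)
  moreover have "{P. v P + w P \<noteq> 0} \<subseteq> primes"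
    using \<open>{P. v P + w P \<noteq> 0} \<subseteq> _\<close> assms by (auto simp: exponent_functions_def)
  ultimately show ?thesis by (simp add: exponent_functions_def)
qed

lemma exponent_functions_uminus: "v \<in> exponent_functions \<Longrightarrow> (\<lambda>P. - v P) \<in> exponent_functions"
  by (simp add: exponent_functions_def)

lemma exponent_functions_zero: "(\<lambda>P. 0) \<in> exponent_functions"
  by (simp add: exponent_functions_def)

lemma exponent_functions_finite:
  "finite S \<Longrightarrow> S \<subseteq> primes \<Longrightarrow> (\<lambda>P. if P \<in> S then f P else 0) \<in> exponent_functions"
  by (auto simp: exponent_functions_def)

lemma ideal_of_add:
  assumes v: "v \<in> exponent_functions" and w: "w \<in> exponent_functions"
  shows "ideal_of (\<lambda>P. v P + w P) = ideal_of v \<star> ideal_of w"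
proof -
  let ?A = "{P. v P \<noteq> 0} \<union> {P. w P \<noteq> 0}"
  have A: "finite ?A" "?A \<subseteq> primes" using v w by (auto simp: exponent_functions_def)
  have c: "(\<lambda>P. P [^]\<^bsub>ideal_group L\<^esub> u P) \<in> ?A \<rightarrow> carrier (ideal_group L)" for u :: "complex set \<Rightarrow> int"
    using A(2) prime_in_carrier by (blast intro: G.int_pow_closed)
  have "ideal_of (\<lambda>P. v P + w P) =
    finprod (ideal_group L) (\<lambda>P. P [^]\<^bsub>ideal_group L\<^esub> v P \<otimes>\<^bsub>ideal_group L\<^esub> P [^]\<^bsub>ideal_group L\<^esub> w P) ?A"
    unfolding ideal_of_eq[of ?A "\<lambda>P. v P + w P", OF A, OF subsetI, simplified]
  proof (rule G.finprod_cong')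
    show "(\<lambda>P. P [^]\<^bsub>ideal_group L\<^esub> v P \<otimes>\<^bsub>ideal_group L\<^esub> P [^]\<^bsub>ideal_group L\<^esub> w P)
      \<in> ?A \<rightarrow> carrier (ideal_group L)"
      using c by (blast intro: G.m_closed)
    fix P assume "P \<in> ?A"
    then show "P [^]\<^bsub>ideal_group L\<^esub> (v P + w P) = P [^]\<^bsub>ideal_group L\<^esub> v P \<otimes>\<^bsub>ideal_group L\<^esub> P [^]\<^bsub>ideal_group L\<^esub> w P"
      using A(2) prime_in_carrier by (intro G.int_pow_mult) blast
  qed auto
  also have "\<dots> = ideal_of v \<otimes>\<^bsub>ideal_group L\<^esub> ideal_of w"
    unfolding G.finprod_multf[OF c c] by (subst (1 2) ideal_of_eq[OF A]) auto
  finally show ?thesis by simp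
qed

lemma ideal_of_zero: "ideal_of (\<lambda>P. 0) = \<O>"
  by (simp add: ideal_of_def)

lemma ideal_of_single:
  assumes "P \<in> primes"
  shows "ideal_of (\<lambda>Q. if Q = P then 1 else 0) = P"
proof -
  have "ideal_of (\<lambda>Q. if Q = P then 1 else 0) = P [^]\<^bsub>ideal_group L\<^esub> (1::int)"
    using assms prime_in_carrier by (subst ideal_of_eq[of "{P}"]) (auto simp del: ideal_group_simps intro: G.int_pow_closed)
  then show ?thesis using prime_in_carrier[OF assms] by (simp add: G.int_pow_1)
qed

lemma list_prod_eq_ideal_of:
  assumes "set Ps \<subseteq> primes"
  shows "(\<lambda>P. int (count_list Ps P)) \<in> exponent_functions"
    "list_prod Ps = ideal_of (\<lambda>P. int (count_list Ps P))"
proof -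
  have e: "(\<lambda>P. int (count_list Ps P)) \<in> exponent_functions" if "set Ps \<subseteq> primes" for Ps
  proof -
    have "{P. int (count_list Ps P) \<noteq> 0} = set Ps" by (auto simp: count_list_0_iff)
    then show ?thesis using that by (simp add: exponent_functions_def)
  qed
  then show "(\<lambda>P. int (count_list Ps P)) \<in> exponent_functions" using assms .
  show "list_prod Ps = ideal_of (\<lambda>P. int (count_list Ps P))"
    using assms
  proof (induction Ps)
    case Nil
    then show ?case by (simp add: ideal_of_zero)
  next
    case (Cons Q Ps)
    have s: "(\<lambda>P. if P = Q then 1 else 0) \<in> exponent_functions"
      using exponent_functions_finite[of "{Q}" "\<lambda>_. 1"] Cons.prems by simp
    have "list_prod (Q # Ps) = ideal_of (\<lambda>P. if P = Q then 1 else 0) \<star> ideal_of (\<lambda>P. int (count_list Ps P))"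
      using Cons ideal_of_single[of Q] by simp
    also have "\<dots> = ideal_of (\<lambda>P. (if P = Q then 1 else 0) + int (count_list Ps P))"
      using ideal_of_add[OF s e] Cons.prems by simp
    also have "(\<lambda>P. (if P = Q then 1 else 0) + int (count_list Ps P)) = (\<lambda>P. int (count_list (Q # Ps) P))"
      by auto
    finally show ?case .
  qed
qed

lemma ideal_of_nonneg:
  assumes v: "v \<in> exponent_functions" and pos: "\<And>P. v P \<ge> 0"
  obtains Ps where "set Ps = {P. v P \<noteq> 0}" "ideal_of v = list_prod Ps"
proof -
  have fin: "finite {P. 0 < nat (v P)}"
    by (rule finite_subset[of _ "{P. v P \<noteq> 0}"]) (use v in \<open>auto simp: exponent_functions_def\<close>)
  obtain Ps where Ps: "mset Ps = Abs_multiset (\<lambda>P. nat (v P))" using ex_mset by blast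
  have "count_list Ps P = nat (v P)" for P
    using fin by (simp flip: count_mset add: Ps)
  then have c: "v = (\<lambda>P. int (count_list Ps P))" using pos by simp
  have s: "set Ps = {P. v P \<noteq> 0}" unfolding c by (auto simp: count_list_0_iff)
  then have "set Ps \<subseteq> primes" using v by (simp add: exponent_functions_def)
  then show thesis using that[OF s] list_prod_eq_ideal_of(2)[of Ps] c by simp
qed

lemma list_prod_le_member:
  assumes "set Ps \<subseteq> primes" "P \<in> set Ps"
  shows "list_prod Ps \<subseteq> P"
  using assms
proof (induction Ps)
  case (Cons Q Ps)
  have i: "integral Q" "integral (list_prod Ps)"
    using Cons.prems integral_list_prod[of Ps] in_primes_iff[of Q] by auto
  then show ?case using integral_times(2,3)[OF i] Cons by auto
qed simp

text \<open>With \<open>u\<close> and \<open>w\<close> the positive and negative parts of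
  \<open>v\<close>, \<open>ideal_of u\<close> is the product of \<open>ideal_of v\<close> and
  \<open>ideal_of w\<close>, hence lies in \<open>ideal_of w\<close>. A prime with negative exponent
  contains \<open>ideal_of w\<close>, thus \<open>ideal_of u\<close>, although it is none of its
  factors. Uniqueness of factorization rests on this.\<close>

lemma exponents_nonneg_if_integral:
  assumes v: "v \<in> exponent_functions" and sub: "ideal_of v \<subseteq> \<O>"
  shows "v P \<ge> 0"
proof (rule ccontr)
  assume neg: "\<not> v P \<ge> 0"
  then have P: "P \<in> primes" using v by (auto simp: exponent_functions_def)
  define w where "w Q = max (- v Q) 0" for Q
  define u where "u Q = max (v Q) 0" for Q
  have w: "w \<in> exponent_functions"
  proof -
    have "{Q. w Q \<noteq> 0} \<subseteq> {Q. v Q \<noteq> 0}" by (auto simp: w_def)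
    then show ?thesis using v finite_subset by (fastforce simp: exponent_functions_def)
  qed
  have uvw: "u = (\<lambda>Q. v Q + w Q)" by (auto simp: u_def w_def)
  have u: "u \<in> exponent_functions" unfolding uvw by (rule exponent_functions_add[OF v w])
  obtain Ps where Ps: "set Ps = {Q. u Q \<noteq> 0}" "ideal_of u = list_prod Ps"
    using ideal_of_nonneg[OF u] by (auto simp: u_def)
  obtain Qs where Qs: "set Qs = {Q. w Q \<noteq> 0}" "ideal_of w = list_prod Qs"
    using ideal_of_nonneg[OF w] by (auto simp: w_def)
  have sp: "set Ps \<subseteq> primes" "set Qs \<subseteq> primes" using Ps Qs u w by (auto simp: exponent_functions_def)
  have "list_prod Ps = ideal_of v \<star> list_prod Qs"
    using ideal_of_add[OF v w] Ps Qs uvw by simp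
  also have "\<dots> \<subseteq> \<O> \<star> list_prod Qs" using sub by (rule ideal_prod_mono) simp
  also have "\<dots> = list_prod Qs" using O_times integral_list_prod[OF sp(2)] by simp
  also have "\<dots> \<subseteq> P" by (rule list_prod_le_member[OF sp(2)]) (use Qs neg in \<open>auto simp: w_def\<close>)
  finally have "P \<in> set Ps" by (rule prime_contains_list_prod[OF P sp(1)])
  then show False using Ps(1) neg by (auto simp: u_def)
qed

lemma ideal_of_uminus:
  assumes "v \<in> exponent_functions"
  shows "ideal_of v \<star> ideal_of (\<lambda>P. - v P) = \<O>"
  using ideal_of_add[OF assms exponent_functions_uminus[OF assms]] by (simp add: ideal_of_zero)

text \<open>To contain is to divide: after multiplication by the inverse of
  \<open>ideal_of w\<close> the claim is that an ideal is integral exactly if no exponent is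
  negative.\<close>

lemma ideal_of_le_iff:
  assumes v: "v \<in> exponent_functions" and w: "w \<in> exponent_functions"
  shows "ideal_of v \<subseteq> ideal_of w \<longleftrightarrow> (\<forall>P. w P \<le> v P)"
proof
  note wm = exponent_functions_uminus[OF w]
  have d: "(\<lambda>P. v P + - w P) \<in> exponent_functions" by (rule exponent_functions_add[OF v wm])
  {
    assume "ideal_of v \<subseteq> ideal_of w"
    then have "ideal_of (\<lambda>P. v P + - w P) \<subseteq> \<O>"
      unfolding ideal_of_add[OF v wm] using ideal_prod_mono[OF _ order.refl] ideal_of_uminus[OF w] by metis
    then show "\<forall>P. w P \<le> v P" using exponents_nonneg_if_integral[OF d] by auto
  next
    assume le: "\<forall>P. w P \<le> v P"
    obtain Ps where Ps: "set Ps = {P. v P + - w P \<noteq> 0}" "ideal_of (\<lambda>P. v P + - w P) = list_prod Ps"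
      using ideal_of_nonneg[OF d] le by auto
    then have "set Ps \<subseteq> primes" using d by (simp add: exponent_functions_def)
    then have "ideal_of (\<lambda>P. v P + - w P) \<subseteq> \<O>" using integral_list_prod Ps(2) by simp
    then have "ideal_of (\<lambda>P. v P + - w P) \<star> ideal_of w \<subseteq> \<O> \<star> ideal_of w" by (rule ideal_prod_mono) simp
    moreover have "ideal_of (\<lambda>P. v P + - w P) \<star> ideal_of w = ideal_of v"
      using ideal_of_add[OF d w] by simp
    ultimately show "ideal_of v \<subseteq> ideal_of w" using O_times[OF fractional_ideal_of[OF w]] by simp
  }
qed

text \<open>Justifies the definite description in \<open>ideal_exponents\<close>: equal ideals
  contain each other, so their exponents agree by antisymmetry.\<close>

lemma ideal_exponents_ideal_of:
  assumes v: "v \<in> exponent_functions"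
  shows "ideal_exponents L (ideal_of v) = v"
  unfolding ideal_exponents_def
proof (rule the_equality)
  show "finite {P. v P \<noteq> 0} \<and> {P. v P \<noteq> 0} \<subseteq> primes \<and>
    ideal_of v = finprod (ideal_group L) (\<lambda>P. P [^]\<^bsub>ideal_group L\<^esub> v P) {P. v P \<noteq> 0}"
    using v by (auto simp: exponent_functions_def ideal_of_def)
  fix w :: "complex set \<Rightarrow> int" assume w: "finite {P. w P \<noteq> 0} \<and> {P. w P \<noteq> 0} \<subseteq> primes \<and>
    ideal_of v = finprod (ideal_group L) (\<lambda>P. P [^]\<^bsub>ideal_group L\<^esub> w P) {P. w P \<noteq> 0}"
  then have w': "w \<in> exponent_functions" and eq: "ideal_of v = ideal_of w"
    by (auto simp: exponent_functions_def ideal_of_def)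
  have "w P = v P" for P
    using ideal_of_le_iff[OF v w'] ideal_of_le_iff[OF w' v] eq by (simp add: order_antisym)
  then show "w = v" by blast
qed

text \<open>With a denominator \<open>d\<close>, both the principal ideal of \<open>d\<close> and
  its product with \<open>I\<close> are integral; the exponents of \<open>I\<close> are the
  difference of theirs.\<close>

lemma fractional_eq_ideal_of:
  assumes I: "fractional I"
  obtains v where "v \<in> exponent_functions" "I = ideal_of v"
proof -
  obtain d where d: "d \<in> \<O>" "d \<noteq> 0" "integral (principal_ideal L d \<star> I)"
    using fractional_eq_quotient[OF I] by blast
  have fd: "fractional (principal_ideal L d)" using d fractional_principal O_subset_L by blast
  have "principal_ideal L d \<subseteq> \<O>" using d by (auto simp: principal_ideal_def)
  then obtain Ps where Ps: "set Ps \<subseteq> primes" "list_prod Ps = principal_ideal L d"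
    using integral_eq_list_prod[of "principal_ideal L d"] fd by blast
  obtain Qs where Qs: "set Qs \<subseteq> primes" "list_prod Qs = principal_ideal L d \<star> I"
    using integral_eq_list_prod[OF d(3)] by blast
  define v where "v P = int (count_list Ps P)" for P
  define w where "w P = int (count_list Qs P)" for P
  have v: "v \<in> exponent_functions" "ideal_of v = principal_ideal L d"
    using list_prod_eq_ideal_of[OF Ps(1)] Ps(2) by (simp_all add: v_def[abs_def])
  have w: "w \<in> exponent_functions" "ideal_of w = principal_ideal L d \<star> I"
    using list_prod_eq_ideal_of[OF Qs(1)] Qs(2) by (simp_all add: w_def[abs_def])
  note vm = exponent_functions_uminus[OF v(1)]
  have "ideal_of (\<lambda>P. w P + - v P) = (ideal_of v \<star> I) \<star> ideal_of (\<lambda>P. - v P)"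
    using ideal_of_add[OF w(1) vm] w v by simp
  also have "\<dots> = (ideal_of v \<star> ideal_of (\<lambda>P. - v P)) \<star> I"
    by (metis ideal_prod_assoc ideal_prod_comm)
  also have "\<dots> = I" using ideal_of_uminus[OF v(1)] O_times[OF I] by simp
  finally show thesis using that exponent_functions_add[OF w(1) vm] by metis
qed

lemma ideal_of_exponents:
  assumes "fractional I"
  shows "ideal_exponents L I \<in> exponent_functions" "ideal_of (ideal_exponents L I) = I"
proof -
  obtain v where "v \<in> exponent_functions" "I = ideal_of v" using fractional_eq_ideal_of[OF assms] .
  then show "ideal_exponents L I \<in> exponent_functions" "ideal_of (ideal_exponents L I) = I"
    using ideal_exponents_ideal_of by simp_all
qed

lemma fractional_le_iff:
  assumes "fractional I" "fractional J"
  shows "I \<subseteq> J \<longleftrightarrow> (\<forall>P. ideal_exponents L J P \<le> ideal_exponents L I P)"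
  using ideal_of_le_iff[OF ideal_of_exponents(1)[OF assms(1)] ideal_of_exponents(1)[OF assms(2)]]
    ideal_of_exponents(2) assms by simp

lemma ideal_exponents_times:
  assumes "fractional I" "fractional J"
  shows "ideal_exponents L (I \<star> J) P = ideal_exponents L I P + ideal_exponents L J P"
proof -
  note i = ideal_of_exponents[OF assms(1)] and j = ideal_of_exponents[OF assms(2)]
  have "I \<star> J = ideal_of (\<lambda>P. ideal_exponents L I P + ideal_exponents L J P)"
    using ideal_of_add[OF i(1) j(1)] i(2) j(2) by simp
  then show ?thesis using ideal_exponents_ideal_of[OF exponent_functions_add[OF i(1) j(1)]] by simp
qed

lemma ideal_exponents_O: "ideal_exponents L \<O> P = 0"
  using ideal_exponents_ideal_of[OF exponent_functions_zero] by (simp add: ideal_of_zero)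

lemma ideal_exponents_nat_pow:
  assumes "fractional I"
  shows "ideal_exponents L (I [^]\<^bsub>ideal_group L\<^esub> k) P = int k * ideal_exponents L I P"
proof (induction k)
  case 0
  then show ?case using ideal_exponents_O by simp
next
  case (Suc k)
  have "I [^]\<^bsub>ideal_group L\<^esub> k \<in> carrier (ideal_group L)" by (rule G.nat_pow_closed) (use assms in simp)
  then have "fractional (I [^]\<^bsub>ideal_group L\<^esub> k)" by simp
  then show ?case using ideal_exponents_times[OF _ assms] Suc by (simp add: algebra_simps)
qed

text \<open>In a free abelian group on the primes, a \<open>k\<close>-th root is obtained by
  dividing all exponents by \<open>k\<close>.\<close>

lemma is_power_iff:
  assumes J: "fractional J" and k: "k > 0"
  shows "(\<exists>I\<in>carrier (ideal_group L). J = I [^]\<^bsub>ideal_group L\<^esub> k) \<longleftrightarrow>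
    (\<forall>P\<in>primes. int k dvd ideal_exponents L J P)"
proof
  assume "\<exists>I\<in>carrier (ideal_group L). J = I [^]\<^bsub>ideal_group L\<^esub> k"
  then show "\<forall>P\<in>primes. int k dvd ideal_exponents L J P" using ideal_exponents_nat_pow by auto
next
  assume d: "\<forall>P\<in>primes. int k dvd ideal_exponents L J P"
  note j = ideal_of_exponents[OF J]
  have d': "int k dvd ideal_exponents L J P" for P
    using d j(1) by (cases "ideal_exponents L J P = 0") (auto simp: exponent_functions_def)
  define v where "v P = ideal_exponents L J P div int k" for P
  have "{P. v P \<noteq> 0} \<subseteq> {P. ideal_exponents L J P \<noteq> 0}" by (auto simp: v_def)
  then have v: "v \<in> exponent_functions"
    using j(1) finite_subset by (fastforce simp: exponent_functions_def)
  note fv = fractional_ideal_of[OF v]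
  have c: "ideal_of v [^]\<^bsub>ideal_group L\<^esub> k \<in> carrier (ideal_group L)"
    by (rule G.nat_pow_closed) (use fv in simp)
  then have f: "fractional (ideal_of v [^]\<^bsub>ideal_group L\<^esub> k)" by simp
  have "ideal_exponents L (ideal_of v [^]\<^bsub>ideal_group L\<^esub> k) P = ideal_exponents L J P" for P
    using ideal_exponents_nat_pow[OF fv] ideal_exponents_ideal_of[OF v] d'[of P] by (simp add: v_def)
  then have "J = ideal_of v [^]\<^bsub>ideal_group L\<^esub> k"
    using fractional_le_iff[OF J f] fractional_le_iff[OF f J] by auto
  then show "\<exists>I\<in>carrier (ideal_group L). J = I [^]\<^bsub>ideal_group L\<^esub> k" using fv by auto
qed

section \<open>Valuations of elements\<close>

definition val :: "complex set \<Rightarrow> complex \<Rightarrow> int" where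
  "val P a = ideal_exponents L (principal_ideal L a) P"

lemma mem_iff_val:
  assumes I: "fractional I" and a: "a \<in> L" "a \<noteq> 0"
  shows "a \<in> I \<longleftrightarrow> (\<forall>P. ideal_exponents L I P \<le> val P a)"
proof -
  have "a \<in> I \<longleftrightarrow> principal_ideal L a \<subseteq> I"
  proof
    assume "a \<in> I"
    then show "principal_ideal L a \<subseteq> I" using fractionalD(4)[OF I] by (auto simp: principal_ideal_def)
  next
    assume "principal_ideal L a \<subseteq> I"
    moreover have "a \<in> principal_ideal L a" unfolding principal_ideal_def
      by (intro CollectI exI[of _ 1]) simp
    ultimately show "a \<in> I" by blast
  qed
  then show ?thesis using fractional_le_iff[OF fractional_principal[OF a] I] by (simp add: val_def)
qed

lemma val_mult:
  assumes "a \<in> L" "a \<noteq> 0" "b \<in> L" "b \<noteq> 0"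
  shows "val P (a * b) = val P a + val P b"
  unfolding val_def principal_mult[OF assms(3,4)]
  by (rule ideal_exponents_times) (use assms fractional_principal in auto)

lemma val_one: "val P 1 = 0"
  by (simp add: val_def principal_one ideal_exponents_O)

lemma val_power:
  assumes "a \<in> L" "a \<noteq> 0"
  shows "val P (a ^ k) = int k * val P a"
  by (induction k) (use assms in \<open>simp_all add: val_one val_mult algebra_simps\<close>)

lemma val_prod:
  assumes "\<And>i. i \<in> A \<Longrightarrow> f i \<in> L \<and> f i \<noteq> 0"
  shows "prod f A \<in> L \<and> prod f A \<noteq> 0 \<and> val P (prod f A) = (\<Sum>i\<in>A. val P (f i))"
  using assms by (induction A rule: infinite_finite_induct) (simp_all add: val_one val_mult)

lemma val_nonneg: "a \<in> \<O> \<Longrightarrow> a \<noteq> 0 \<Longrightarrow> val P a \<ge> 0"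
  using mem_iff_val[of \<O> a] integral_O O_subset_L by (simp add: ideal_exponents_O)

lemma ideal_exponents_prime:
  assumes "P \<in> primes"
  shows "ideal_exponents L P Q = (if Q = P then 1 else 0)"
proof -
  have "(\<lambda>Q. if Q = P then 1 else 0) \<in> exponent_functions"
    using exponent_functions_finite[of "{P}" "\<lambda>_. 1"] assms by simp
  from ideal_exponents_ideal_of[OF this] show ?thesis using ideal_of_single[OF assms] by simp
qed

lemma mem_prime_iff:
  assumes "P \<in> primes" "a \<in> \<O>" "a \<noteq> 0"
  shows "a \<in> P \<longleftrightarrow> val P a \<ge> 1"
  using mem_iff_val[OF primesD(1)[OF assms(1)], of a] assms val_nonneg[OF assms(2,3)] O_subset_L
  by (auto simp: ideal_exponents_prime split: if_splits)

text \<open>The principal ideal of zero is not fractional, so \<open>val P 0\<close> is unspecified.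
  Here zero counts as having infinite valuation, which makes the condition stable under
  sums.\<close>

definition val_ge :: "complex set \<Rightarrow> int \<Rightarrow> complex \<Rightarrow> bool" where
  "val_ge P k a \<longleftrightarrow> a \<in> L \<and> (a = 0 \<or> k \<le> val P a)"

lemma val_uminus: "a \<in> L \<Longrightarrow> val P (- a) = val P a"
proof -
  have "principal_ideal L (- a) = principal_ideal L a"
    unfolding principal_ideal_def by (auto, (rule exI[of _ "- _"], force)+)
  then show ?thesis by (simp add: val_def)
qed

text \<open>The ultrametric inequality: \<open>a\<close> and \<open>b\<close> both lie in the
  fractional ideal with exponents \<open>min (val Q a) (val Q b)\<close>, hence so does
  \<open>a + b\<close>.\<close>

lemma val_ge_add:
  assumes "val_ge P k a" "val_ge P k b"
  shows "val_ge P k (a + b)"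
proof (cases "a = 0 \<or> b = 0 \<or> a + b = 0")
  case False
  then have n: "a \<noteq> 0" "b \<noteq> 0" "a + b \<noteq> 0" by auto
  have L: "a \<in> L" "b \<in> L" "k \<le> val P a" "k \<le> val P b" using assms n by (auto simp: val_ge_def)
  define v where "v Q = min (val Q a) (val Q b)" for Q
  have "{Q. v Q \<noteq> 0} \<subseteq> {Q. val Q a \<noteq> 0} \<union> {Q. val Q b \<noteq> 0}" by (auto simp: v_def min_def)
  moreover have "(\<lambda>Q. val Q a) \<in> exponent_functions" "(\<lambda>Q. val Q b) \<in> exponent_functions"
    unfolding val_def using ideal_of_exponents(1)[OF fractional_principal] L n by simp_all
  ultimately have v: "v \<in> exponent_functions"
    unfolding exponent_functions_def using finite_subset[of "{Q. v Q \<noteq> 0}"] by blast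
  note f = fractional_ideal_of[OF v]
  have "a \<in> ideal_of v" "b \<in> ideal_of v"
    using mem_iff_val[OF f] L n ideal_exponents_ideal_of[OF v] by (auto simp: v_def)
  then have "a + b \<in> ideal_of v" by (rule fractionalD(3)[OF f])
  then have "v P \<le> val P (a + b)"
    using mem_iff_val[OF f, of "a + b"] L n ideal_exponents_ideal_of[OF v] by auto
  then show ?thesis using L by (auto simp: val_ge_def v_def)
qed (use assms in \<open>auto simp: val_ge_def\<close>)

lemma val_ge_uminus: "val_ge P k a \<Longrightarrow> val_ge P k (- a)"
  by (auto simp: val_ge_def val_uminus)

lemma val_ge_sum: "(\<And>i. i \<in> A \<Longrightarrow> val_ge P k (f i)) \<Longrightarrow> val_ge P k (sum f A)"
  by (induction A rule: infinite_finite_induct) (auto simp: val_ge_add, auto simp: val_ge_def)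

lemma val_ge_mult: "r \<in> \<O> \<Longrightarrow> val_ge P k a \<Longrightarrow> val_ge P k (r * a)"
  using val_nonneg[of r P] val_mult[of r a P] O_subset_L[of r] by (cases "r = 0") (auto simp: val_ge_def)

lemma mem_imp_val_ge: "fractional I \<Longrightarrow> a \<in> I \<Longrightarrow> val_ge P (ideal_exponents L I P) a"
  using mem_iff_val[of I a] fractionalD(1)[of I] by (auto simp: val_ge_def)

text \<open>For each \<open>P\<close> in \<open>S\<close> there is \<open>f P\<close> in
  \<open>J\<close> with exactly the exponent of \<open>J\<close> at \<open>P\<close> and a larger
  valuation at the other primes of \<open>S\<close>. In the sum of all \<open>f P\<close>, only one
  summand is minimal at each prime of \<open>S\<close>, so nothing cancels there.\<close>

lemma approximation:
  assumes J: "fractional J" and S: "finite S" "S \<subseteq> primes" "S \<noteq> {}"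
  obtains a where "a \<in> J" "a \<noteq> 0" "\<And>P. P \<in> S \<Longrightarrow> val P a = ideal_exponents L J P"
proof -
  let ?j = "ideal_exponents L J"
  define w where "w T Q = ?j Q + (if Q \<in> T then 1 else 0)" for T Q
  have w: "w T \<in> exponent_functions" if "T \<subseteq> S" for T
    unfolding w_def[abs_def]
    by (rule exponent_functions_add[OF ideal_of_exponents(1)[OF J] exponent_functions_finite])
      (use that S finite_subset in auto)
  have "\<exists>a. a \<in> ideal_of (w (S - {P})) \<and> a \<notin> ideal_of (w S)" if P: "P \<in> S" for P
  proof -
    have "\<not> ideal_of (w (S - {P})) \<subseteq> ideal_of (w S)"
      using ideal_of_le_iff[OF w w, of "S - {P}" S] P by (auto simp: w_def intro!: exI[of _ P])
    then show ?thesis by blast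
  qed
  then obtain f where f: "\<And>P. P \<in> S \<Longrightarrow> f P \<in> ideal_of (w (S - {P}))" "\<And>P. P \<in> S \<Longrightarrow> f P \<notin> ideal_of (w S)"
    by metis
  have f0: "f P \<noteq> 0" if "P \<in> S" for P
    using f(2)[OF that] fractionalD(2)[OF fractional_ideal_of[OF w[of S]]] by auto
  have fL: "f P \<in> L" if "P \<in> S" for P
    using f(1)[OF that] fractionalD(1)[OF fractional_ideal_of[OF w[of "S - {P}"]]] by auto
  have ge: "w (S - {P}) Q \<le> val Q (f P)" if "P \<in> S" for P Q
    using mem_iff_val[OF fractional_ideal_of[OF w] fL[OF that] f0[OF that], of "S - {P}"] f(1)[OF that]
      ideal_exponents_ideal_of[OF w[of "S - {P}"]] by auto
  \<comment> \<open>\<open>w S\<close> and \<open>w (S - {P})\<close> differ only at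
    \<open>P\<close>, so the failure of membership in \<open>ideal_of (w S)\<close> must occur at
    \<open>P\<close>.\<close>
  have eq: "val P (f P) = ?j P" if P: "P \<in> S" for P
  proof -
    obtain Q where "\<not> w S Q \<le> val Q (f P)"
      using mem_iff_val[OF fractional_ideal_of[OF w] fL[OF P] f0[OF P], of S] f(2)[OF P]
        ideal_exponents_ideal_of[OF w[of S]] by auto
    then show ?thesis using ge[OF P, of Q] by (auto simp: w_def split: if_splits)
  qed
  define a where "a = sum f S"
  have fJ: "f P \<in> J" if "P \<in> S" for P
    using mem_iff_val[OF J fL[OF that] f0[OF that]] ge[OF that] by (smt (verit) w_def)
  have aJ: "a \<in> J" unfolding a_def by (rule fractional_sum[OF J fJ])
  have aL: "a \<in> L" using aJ fractionalD(1)[OF J] by blast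
  have n: "\<not> val_ge P (?j P + 1) a" if P: "P \<in> S" for P
  proof
    assume h: "val_ge P (?j P + 1) a"
    have r: "val_ge P (?j P + 1) (sum f (S - {P}))"
    proof (rule val_ge_sum)
      fix Q assume "Q \<in> S - {P}"
      then have "Q \<in> S" "Q \<noteq> P" by auto
      then show "val_ge P (?j P + 1) (f Q)" using ge[of Q P] fL[of Q] P by (simp add: val_ge_def w_def)
    qed
    have "f P = a + - sum f (S - {P})" unfolding a_def using S(1) P by (simp add: sum.remove)
    then have "val_ge P (?j P + 1) (f P)" using val_ge_add[OF h val_ge_uminus[OF r]] by simp
    then show False using eq[OF P] f0[OF P] by (simp add: val_ge_def)
  qed
  obtain P0 where "P0 \<in> S" using S(3) by blast
  then have a0: "a \<noteq> 0" using n[of P0] by (auto simp: val_ge_def)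
  have "val P a = ?j P" if "P \<in> S" for P
    using n[OF that] aL a0 mem_imp_val_ge[OF J aJ, of P] by (auto simp: val_ge_def)
  then show thesis using that aJ a0 by blast
qed

section \<open>Primes above a prime number: their number and ramification\<close>

lemma of_nat_prime_mem: "lies_above P q \<Longrightarrow> of_nat q \<in> P"
proof -
  assume "lies_above P q"
  moreover have "of_nat q \<in> range (\<lambda>k. of_int (int q * k) :: complex)" by (rule image_eqI[of _ _ 1]) auto
  ultimately show ?thesis unfolding lies_above_def by blast
qed

text \<open>A strictly decreasing chain of ideals between \<open>\<O>\<close> and \<open>q \<O>\<close> yields elements that are
  linearly independent modulo \<open>q\<close>, hence has length at most \<open>n\<close>.\<close>

lemma length_le_degree:
  assumes q: "Factorial_Ring.prime (q::nat)" and Ps: "set Ps \<subseteq> primes" "of_nat q \<in> list_prod Ps"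
  shows "length Ps \<le> n"
proof -
  \<comment> \<open>The induction keeps independence modulo the ideal \<open>list_prod Ps\<close>,
    which a further prime factor extends by one element. Since this ideal contains \<open>q\<close>,
    independence modulo \<open>q\<close> follows at the end.\<close>
  have "\<exists>as. length as = length Ps \<and> set as \<subseteq> \<O> \<and>
    (\<forall>c :: nat \<Rightarrow> int. (\<Sum>i<length as. of_int (c i) * as ! i) \<in> list_prod Ps \<longrightarrow> (\<forall>i<length as. int q dvd c i))"
    using Ps
  proof (induction Ps)
    case Nil
    then show ?case by simp
  next
    case (Cons P Ps)
    let ?I = "list_prod Ps" and ?J = "list_prod (P # Ps)"
    have i: "integral ?I" "integral P" using Cons.prems integral_list_prod[of Ps] in_primes_iff[of P] by auto
    have j: "integral ?J" using integral_list_prod[OF Cons.prems(1)] .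
    have JI: "?J \<subseteq> ?I" using integral_times(3)[OF i(2,1)] by simp
    \<comment> \<open>A new prime factor strictly shrinks the ideal, because exponents add up. An
      element lost in this step is the one to be appended.\<close>
    have "?J \<noteq> ?I"
    proof
      assume "?J = ?I"
      then have "ideal_exponents L P P = 0" using ideal_exponents_times[of P ?I P] i by simp
      then show False using ideal_exponents_prime[of P] Cons.prems by simp
    qed
    then obtain a where a: "a \<in> ?I" "a \<notin> ?J" using JI by blast
    have "set Ps \<subseteq> primes" "of_nat q \<in> ?I" using Cons.prems JI by auto
    from Cons.IH[OF this] obtain as where as0: "length as = length Ps \<and> set as \<subseteq> \<O> \<and>
      (\<forall>c :: nat \<Rightarrow> int. (\<Sum>i<length as. of_int (c i) * as ! i) \<in> ?I \<longrightarrow> (\<forall>i<length as. int q dvd c i))" ..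
    then have as: "length as = length Ps" "set as \<subseteq> \<O>"
      "\<And>c :: nat \<Rightarrow> int. (\<Sum>i<length as. of_int (c i) * as ! i) \<in> ?I \<Longrightarrow> \<forall>i<length as. int q dvd c i"
      by blast+
    have "\<forall>i<Suc (length as). int q dvd c i"
      if c: "(\<Sum>i<length as. of_int (c i) * as ! i) + of_int (c (length as)) * a \<in> ?J" for c :: "nat \<Rightarrow> int"
    proof -
      let ?s = "\<Sum>i<length as. of_int (c i) * as ! i" and ?m = "c (length as)"
      have ma: "of_int ?m * a \<in> ?I" using fractionalD(4)[of ?I "of_int ?m" a] i a by auto
      have "?s = (?s + of_int ?m * a) - of_int ?m * a" by simp
      then have "?s \<in> ?I" using fractionalD(6)[of ?I "?s + of_int ?m * a" "of_int ?m * a"] i ma c JI by auto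
      then have d: "\<forall>i<length as. int q dvd c i" by (rule as(3))
      have "?s = of_nat q * (\<Sum>i<length as. of_int (c i div int q) * as ! i)"
        unfolding sum_distrib_left
      proof (rule sum.cong)
        fix i assume "i \<in> {..<length as}"
        then have "c i = int q * (c i div int q)" using d by simp
        then have "complex_of_int (c i) = of_nat q * of_int (c i div int q)" by (metis of_int_mult of_int_of_nat_eq)
        then show "of_int (c i) * as ! i = of_nat q * (of_int (c i div int q) * as ! i)" by simp
      qed simp
      moreover have "(\<Sum>i<length as. of_int (c i div int q) * as ! i) \<in> \<O>"
        by (intro O_sum O_closed(4,7)) (use as(2) in auto)
      then have "(\<Sum>i<length as. of_int (c i div int q) * as ! i) * of_nat q \<in> ?J"
        using fractionalD(4) j Cons.prems(2) by blast
      ultimately have "?s \<in> ?J" by (simp only: mult.commute)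
      then have "(?s + of_int ?m * a) - ?s \<in> ?J" using fractionalD(6)[of ?J] j c by blast
      then have maJ: "of_int ?m * a \<in> ?J" by simp
      \<comment> \<open>Otherwise Bezout writes \<open>a\<close> as a combination of
        \<open>?m * a\<close> and \<open>q * a\<close>, both in \<open>?J\<close>, against the
        choice of \<open>a\<close>.\<close>
      have "int q dvd ?m"
      proof (rule ccontr)
        assume "\<not> int q dvd ?m"
        then have "Rings.coprime ?m (int q)"
          using q by (metis coprime_commute prime_imp_coprime prime_nat_int_transfer)
        then obtain u t where "u * ?m + t * int q = 1" by (metis bezout_int coprime_imp_gcd_eq_1)
        then have "of_int u * of_int ?m + of_int t * of_nat q = (1::complex)"
          by (metis of_int_1 of_int_add of_int_mult of_int_of_nat_eq)
        then have "a = (of_int u * of_int ?m + of_int t * of_nat q) * a" by simp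
        also have "\<dots> = of_int u * (of_int ?m * a) + (of_int t * a) * of_nat q" by (simp add: algebra_simps)
        also have "\<dots> \<in> ?J"
        proof (rule fractionalD(3))
          show "of_int u * (of_int ?m * a) \<in> ?J" by (rule fractionalD(4)) (use j maJ in auto)
          show "of_int t * a * of_nat q \<in> ?J"
            by (rule fractionalD(4)) (use j Cons.prems(2) a i in auto)
        qed (use j in blast)
        finally show False using a by blast
      qed
      then show ?thesis using d by (simp add: less_Suc_eq)
    qed
    then show ?case using as(1,2) a(1) i
      by (intro exI[of _ "as @ [a]"]) (auto simp: nth_append)
  qed
  then obtain as where as0: "length as = length Ps \<and> set as \<subseteq> \<O> \<and>
    (\<forall>c :: nat \<Rightarrow> int. (\<Sum>i<length as. of_int (c i) * as ! i) \<in> list_prod Ps \<longrightarrow> (\<forall>i<length as. int q dvd c i))" ..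
  then have as: "length as = length Ps" "set as \<subseteq> \<O>"
    "\<And>c :: nat \<Rightarrow> int. (\<Sum>i<length as. of_int (c i) * as ! i) \<in> list_prod Ps \<Longrightarrow> \<forall>i<length as. int q dvd c i"
    by blast+
  have "residually_independent q as"
    unfolding residually_independent_def
  proof (intro conjI allI impI)
    fix c i assume "\<exists>b\<in>\<O>. (\<Sum>i<length as. of_int (c i) * as ! i) = of_nat q * b" "i < length as"
    moreover have "of_nat q * b \<in> list_prod Ps" if "b \<in> \<O>" for b
      using fractionalD(4)[OF _ that Ps(2)] integral_list_prod[OF Ps(1)] by (simp add: mult.commute)
    ultimately show "int q dvd c i" using as(3)[of c] by auto
  qed (use as in auto)
  then show ?thesis using residually_independent_length q as(1) by metis
qed

lemma mem_list_prod_iff: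
  assumes "set Ps \<subseteq> primes" "a \<in> L" "a \<noteq> 0"
  shows "a \<in> list_prod Ps \<longleftrightarrow> (\<forall>P. int (count_list Ps P) \<le> val P a)"
  using list_prod_eq_ideal_of[OF assms(1)] mem_iff_val[OF fractional_ideal_of assms(2,3)]
    ideal_exponents_ideal_of by simp

abbreviation primes_above :: "nat \<Rightarrow> complex set set" where
  "primes_above q \<equiv> {P \<in> primes. lies_above P q}"

lemma val_prime_above:
  assumes "P \<in> primes_above q" "q > 0"
  shows "val P (of_nat q) \<ge> 1"
  using mem_prime_iff[of P "of_nat q"] of_nat_prime_mem assms by simp

text \<open>\<open>q\<close> has positive valuation at each prime above it, so it lies in the
  product of any distinct ones, and the degree bounds the number of factors.\<close>

lemma card_primes_above:
  assumes q: "Factorial_Ring.prime q"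
  shows "finite (primes_above q)" "card (primes_above q) \<le> n"
proof -
  have q0: "q > 0" using q prime_gt_0_nat by blast
  \<comment> \<open>Stated for finite subsets, since the finiteness of the whole set is deduced from
    this very bound.\<close>
  have c: "card S \<le> n" if S: "finite S" "S \<subseteq> primes_above q" for S
  proof -
    obtain Ps where Ps: "set Ps = S" "distinct Ps" using finite_distinct_list[OF S(1)] by blast
    have sp: "set Ps \<subseteq> primes" using Ps S by blast
    have "int (count_list Ps P) \<le> val P (of_nat q)" for P
    proof (cases "P \<in> set Ps")
      case True
      then have "count_list Ps P = 1" using Ps(2) by (simp add: distinct_count_atmost_1 flip: count_mset)
      then show ?thesis using val_prime_above[of P q] True Ps S q0 by auto
    next
      case False
      then show ?thesis using val_nonneg[of "of_nat q" P] q0 by simp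
    qed
    then have "of_nat q \<in> list_prod Ps" using mem_list_prod_iff[OF sp] q0 by simp
    then have "length Ps \<le> n" by (rule length_le_degree[OF q sp])
    then show ?thesis using Ps distinct_card[of Ps] by simp
  qed
  show f: "finite (primes_above q)"
  proof (rule ccontr)
    assume "infinite (primes_above q)"
    then obtain S where S: "finite S \<and> card S = Suc n \<and> S \<subseteq> primes_above q"
      using infinite_arbitrarily_large by blast
    then have "card S \<le> n" by (intro c) simp_all
    then show False using S by simp
  qed
  show "card (primes_above q) \<le> n" by (rule c[OF f subset_refl])
qed

text \<open>With valuation at least 2 at \<open>P\<close>, the product of all primes above
  \<open>q\<close> with \<open>P\<close> repeated would still contain \<open>q\<close>, and it has
  \<open>n + 1\<close> factors.\<close>

lemma val_unramified:
  assumes q: "Factorial_Ring.prime q" and n: "card (primes_above q) = n" and P: "P \<in> primes_above q"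
  shows "val P (of_nat q) = 1"
proof (rule ccontr)
  have q0: "q > 0" using q prime_gt_0_nat by blast
  assume "val P (of_nat q) \<noteq> 1"
  then have v2: "val P (of_nat q) \<ge> 2" using val_prime_above[OF P q0] by simp
  obtain Ps where Ps: "set Ps = primes_above q" "distinct Ps"
    using finite_distinct_list[OF card_primes_above(1)[OF q]] by blast
  have sp: "set (P # Ps) \<subseteq> primes" using Ps P by auto
  have "int (count_list (P # Ps) Q) \<le> val Q (of_nat q)" for Q
  proof (cases "Q \<in> set Ps")
    case True
    then have "count_list Ps Q = 1" using Ps(2) by (simp add: distinct_count_atmost_1 flip: count_mset)
    then show ?thesis using val_prime_above[of Q q] True Ps(1) q0 v2 by auto
  next
    case False
    then show ?thesis using val_nonneg[of "of_nat q" Q] q0 P Ps(1) by auto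
  qed
  then have "of_nat q \<in> list_prod (P # Ps)" using mem_list_prod_iff[OF sp, of "of_nat q"] q0 by simp
  then have "length (P # Ps) \<le> n" by (rule length_le_degree[OF q sp])
  then show False using Ps n distinct_card[of Ps] by simp
qed

end

section \<open>Normal extensions and their automorphisms\<close>

context complex_subfield
begin

lemma L_sum: "(\<And>i. i \<in> A \<Longrightarrow> f i \<in> L) \<Longrightarrow> sum f A \<in> L"
  by (induction A rule: infinite_finite_induct) simp_all

section \<open>Polynomials over a subfield and simple extensions\<close>

definition polys :: "complex poly set" where
  "polys = {f. \<forall>i. poly.coeff f i \<in> L}"

lemma polys_closed:
  shows "f \<in> polys \<Longrightarrow> g \<in> polys \<Longrightarrow> f + g \<in> polys" and "f \<in> polys \<Longrightarrow> g \<in> polys \<Longrightarrow> f - g \<in> polys"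
    and "f \<in> polys \<Longrightarrow> g \<in> polys \<Longrightarrow> f * g \<in> polys" and "0 \<in> polys"
    and "c \<in> L \<Longrightarrow> Polynomial.monom c k \<in> polys" and "c \<in> L \<Longrightarrow> f \<in> polys \<Longrightarrow> Polynomial.smult c f \<in> polys"
    and "c \<in> L \<Longrightarrow> [:c:] \<in> polys"
  by (auto simp: polys_def Polynomial.coeff_mult coeff_pCons split: nat.splits intro!: L_sum)

lemma polys_pCons_iff: "pCons a h \<in> polys \<longleftrightarrow> a \<in> L \<and> h \<in> polys"
  by (auto simp: polys_def coeff_pCons split: nat.splits)

lemma polys_sum: "(\<And>i. i \<in> A \<Longrightarrow> f i \<in> polys) \<Longrightarrow> sum f A \<in> polys"
  by (induction A rule: infinite_finite_induct) (simp_all add: polys_closed)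

lemma polys_division:
  assumes g: "g \<in> polys" "lead_coeff g = 1" and f: "f \<in> polys"
  shows "\<exists>h r. h \<in> polys \<and> r \<in> polys \<and> f = g * h + r \<and> (r = 0 \<or> degree r < degree g)"
  using f
\<comment> \<open>The measure places the zero polynomial strictly below the nonzero constants, whose
  degree is zero as well.\<close>
proof (induction "if f = 0 then 0 else Suc (degree f)" arbitrary: f rule: less_induct)
  case less
  show ?case
  proof (cases "f = 0 \<or> degree f < degree g")
    case True
    then show ?thesis using less.prems polys_closed(4) by (intro exI[of _ 0] exI[of _ f]) auto
  next
    case False
    then have f0: "f \<noteq> 0" and d: "degree g \<le> degree f" by auto
    define m where "m = Polynomial.monom (lead_coeff f) (degree f - degree g)"
    have m: "m \<in> polys" unfolding m_def using less.prems by (intro polys_closed) (simp add: polys_def)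
    have g0: "g \<noteq> 0" using g(2) by auto
    have m0: "m \<noteq> 0" using f0 by (simp add: m_def)
    have degm: "degree m = degree f - degree g" unfolding m_def
      by (rule Polynomial.degree_monom_eq) (use f0 in simp)
    then have dm: "degree (g * m) = degree f" using degree_mult_eq[OF g0 m0] d by simp
    have lm: "lead_coeff (g * m) = lead_coeff f" 
      unfolding lead_coeff_mult g(2) degm by (simp add: m_def)
    define f' where "f' = f - g * m"
    have f'L: "f' \<in> polys" unfolding f'_def using less.prems g(1) m by (intro polys_closed)
    have "f' = 0 \<or> degree f' < degree f"
    proof (cases "degree f = 0")
      case True
      then have "degree f' = 0" using dm degree_diff_le[of f 0 "g * m"] by (simp add: f'_def)
      moreover have "poly.coeff f' 0 = 0" using lm dm True by (simp add: f'_def)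
      ultimately show ?thesis by (metis leading_coeff_0_iff)
    next
      case False
      have "degree f' \<le> degree f" using dm degree_diff_le[of f "degree f" "g * m"] by (simp add: f'_def)
      moreover have "poly.coeff f' (degree f) = 0" using lm dm by (simp add: f'_def)
      ultimately show ?thesis by (metis le_neq_implies_less leading_coeff_0_iff)
    qed
    then have "(if f' = 0 then 0 else Suc (degree f')) < (if f = 0 then 0 else Suc (degree f))"
      using f0 by auto
    from less.hyps[OF this f'L] obtain h r
      where hr: "h \<in> polys" "r \<in> polys" "f' = g * h + r" "r = 0 \<or> degree r < degree g" by blast
    have "f = g * (h + m) + r" using hr(3) by (simp add: f'_def algebra_simps)
    then show ?thesis using hr m polys_closed(1) by blast
  qed
qed

text \<open>The bound by \<open>degree f\<close> is part of the conclusion because degrees of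
  extensions are later estimated by exhibiting a polynomial: the linear factors of conjugates for
  \<open>L\<close> over \<open>K\<close>, a geometric sum for \<open>K\<close> over
  \<open>\<rat>\<close>.\<close>

lemma minimal_polynomial:
  assumes f: "f \<in> polys" "f \<noteq> 0" "poly f \<theta> = 0"
  obtains g where "g \<in> polys" "lead_coeff g = 1" "poly g \<theta> = 0" "degree g > 0" "degree g \<le> degree f"
    "\<And>h. h \<in> polys \<Longrightarrow> poly h \<theta> = 0 \<Longrightarrow> g dvd h"
proof -
  define good where "good k \<longleftrightarrow> (\<exists>g\<in>polys. g \<noteq> 0 \<and> poly g \<theta> = 0 \<and> degree g = k)" for k
  have gf: "good (degree f)" unfolding good_def using f by blast
  define d where "d = (LEAST k. good k)"
  have gd: "good d" unfolding d_def using gf by (rule LeastI)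
  have le: "d \<le> k" if "good k" for k unfolding d_def using that by (rule Least_le)
  obtain g0 where g0: "g0 \<in> polys" "g0 \<noteq> 0" "poly g0 \<theta> = 0" "degree g0 = d" using gd unfolding good_def by blast
  define g where "g = Polynomial.smult (inverse (lead_coeff g0)) g0"
  have g: "g \<in> polys" "lead_coeff g = 1" "poly g \<theta> = 0" "degree g = d"
    using g0 by (auto simp: g_def intro!: polys_closed(6) L_closed(7)) (simp add: polys_def)
  have "degree g \<noteq> 0"
  proof
    assume "degree g = 0"
    then have "g = 1" using g(2) by (metis degree_eq_zeroE lead_coeff_pCons(2) one_pCons)
    then show False using g(3) by simp
  qed
  moreover have "g dvd h" if h: "h \<in> polys" "poly h \<theta> = 0" for h
  proof -
    obtain k r where kr: "k \<in> polys" "r \<in> polys" "h = g * k + r" "r = 0 \<or> degree r < degree g"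
      using polys_division[OF g(1,2) h(1)] by blast
    have "poly r \<theta> = 0" using kr(3) h(2) g(3) by simp
    have "r = 0"
    proof (rule ccontr)
      assume "r \<noteq> 0"
      then have "good (degree r)" unfolding good_def using kr(2) \<open>poly r \<theta> = 0\<close> by blast
      then show False using le kr(4) g(4) \<open>r \<noteq> 0\<close> by fastforce
    qed
    then show ?thesis using kr(3) by simp
  qed
  ultimately show thesis using that g le[OF gf] by blast
qed

text \<open>\<open>combine\<close> stops at the end of the shorter list, and the independence
  criterion applied to the powers of \<open>\<theta>\<close> ranges over coefficient lists of any
  length.\<close>

lemma combine_eq_sum_min:
  "CC.combine Ks Us = (\<Sum>i<min (length Ks) (length Us). Ks ! i * Us ! i)"
proof (induction Ks Us rule: CC.combine.induct)
  case (1 k Ks u Us)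
  then show ?case by (simp add: sum.lessThan_Suc_shift del: sum.lessThan_Suc)
qed simp_all

definition adjoin :: "complex \<Rightarrow> complex set" where
  "adjoin \<theta> = {poly h \<theta> | h. h \<in> polys}"

text \<open>Polynomials as lists in the algebraic sense start with the leading coefficient,
  \<open>coeffs\<close> with the constant one; hence the reversal.\<close>

lemma eval_rev_coeffs: "CC.eval (rev (coeffs f)) \<theta> = poly f \<theta>"
proof (induction f)
  case (pCons a f)
  have "CC.eval (rev (coeffs f) @ [a]) \<theta> = CC.eval (rev (coeffs f)) \<theta> * \<theta> + a"
    using CC.eval_append_aux[of "rev (coeffs f)" a \<theta>] by simp
  then show ?case using pCons by (simp add: cCons_def mult.commute)
qed simp

lemma adjoin_eq_simple_extension: "adjoin \<theta> = CC.simple_extension L \<theta>"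
proof
  have "poly h \<theta> \<in> CC.simple_extension L \<theta>" if "h \<in> polys" for h
    using that
  proof (induction h)
    case 0
    then show ?case using CC.simple_extension.zero[of L \<theta>] by simp
  next
    case (pCons a h)
    have "h \<in> polys" "a \<in> L"
      using pCons.prems by (simp_all add: polys_pCons_iff)
    then show ?case using CC.simple_extension.lin[OF pCons.IH, of a] by (simp add: algebra_simps)
  qed
  then show "adjoin \<theta> \<subseteq> CC.simple_extension L \<theta>" by (auto simp: adjoin_def)
  show "CC.simple_extension L \<theta> \<subseteq> adjoin \<theta>"
  proof
    fix a assume "a \<in> CC.simple_extension L \<theta>"
    then show "a \<in> adjoin \<theta>"
    proof (induction rule: CC.simple_extension.induct)
      case zero
      then show ?case using polys_closed(4) by (auto simp: adjoin_def intro!: exI[of _ 0])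
    next
      case (lin k1 k2)
      then obtain h where h: "h \<in> polys" "k1 = poly h \<theta>" by (auto simp: adjoin_def)
      have "pCons k2 h \<in> polys" using h(1) lin(2) by (simp add: polys_pCons_iff)
      moreover have "k1 \<otimes>\<^bsub>CC\<^esub> \<theta> \<oplus>\<^bsub>CC\<^esub> k2 = poly (pCons k2 h) \<theta>" using h(2) by (simp add: mult.commute add.commute)
      ultimately show ?case unfolding adjoin_def by blast
    qed
  qed
qed

lemma poly_in_subfield:
  assumes "subfield E CC" "L \<subseteq> E" "h \<in> polys" "\<theta> \<in> E"
  shows "poly h \<theta> \<in> E"
proof -
  interpret E: complex_subfield E by (rule complex_subfield.intro) fact
  show ?thesis unfolding poly_altdef
    by (intro E.L_sum E.L_closed(4,9)) (use assms in \<open>auto simp: polys_def\<close>)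
qed

text \<open>As \<open>\<theta>\<close> is algebraic over \<open>L\<close>, the ring of values of
  polynomials at \<open>\<theta>\<close> is already a field.\<close>

lemma adjoin_field:
  assumes f: "f \<in> polys" "f \<noteq> 0" "poly f \<theta> = 0"
  shows "subfield (adjoin \<theta>) CC" "generate_field CC (insert \<theta> L) = adjoin \<theta>"
proof -
  have "set (coeffs f) \<subseteq> L" using f(1) by (auto simp: polys_def coeffs_def)
  moreover have "coeffs f \<noteq> []" "last (coeffs f) \<noteq> 0"
    using f(2) last_coeffs_eq_coeff_degree[OF f(2)] by auto
  ultimately have "rev (coeffs f) \<in> carrier (univ_poly CC L)"
    unfolding univ_poly_carrier[symmetric] polynomial_def by (simp add: hd_rev)
  moreover have "rev (coeffs f) \<noteq> []" using f(2) by simp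
  ultimately have "(CC.algebraic over L) \<theta>"
    using CC.algebraicI eval_rev_coeffs[of f \<theta>] f(3) by simp
  then show s: "subfield (adjoin \<theta>) CC"
    unfolding adjoin_eq_simple_extension using CC.simple_extension_is_subfield[OF subfield] by simp
  show "generate_field CC (insert \<theta> L) = adjoin \<theta>"
  proof (rule field.generate_fieldI[OF field_CC _ s, symmetric])
    have "a \<in> adjoin \<theta>" if "a \<in> L" for a
      unfolding adjoin_def using that polys_closed(7) by (intro CollectI exI[of _ "[:a:]"]) simp
    moreover have "\<theta> \<in> adjoin \<theta>" unfolding adjoin_def
      by (intro CollectI exI[of _ "[:0, 1:]"]) (simp add: polys_pCons_iff polys_closed)
    ultimately show "insert \<theta> L \<subseteq> adjoin \<theta>" by blast
    show "adjoin \<theta> \<subseteq> E" if "subfield E CC" "insert \<theta> L \<subseteq> E" for E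
      using poly_in_subfield[OF that(1)] that(2) by (auto simp: adjoin_def)
  qed simp
qed

text \<open>The powers of \<open>\<theta>\<close> below \<open>degree g\<close> are a basis:
  independent since \<open>g\<close> divides every relation, spanning by division with
  remainder.\<close>

lemma dimension_adjoin:
  assumes g: "g \<in> polys" "lead_coeff g = 1" "poly g \<theta> = 0"
    "\<And>h. h \<in> polys \<Longrightarrow> poly h \<theta> = 0 \<Longrightarrow> g dvd h"
  shows "CC.dimension (degree g) L (adjoin \<theta>)"
proof -
  define Us where "Us = map (\<lambda>i. \<theta> ^ i) [0..<degree g]"
  have len: "length Us = degree g" by (simp add: Us_def)
  have small: "h = 0" if "h \<in> polys" "poly h \<theta> = 0" "h = 0 \<or> degree h < degree g" for h
    using g(4)[OF that(1,2)] that(3) dvd_imp_degree_le[of g h] by fastforce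
  have "CC.independent L Us"
  proof (rule CC.trivial_combine_imp_independent[OF subfield])
    fix Ks assume Ks: "set Ks \<subseteq> L" "CC.combine Ks Us = \<zero>\<^bsub>CC\<^esub>"
    define m where "m = min (length Ks) (degree g)"
    define h where "h = (\<Sum>i<m. Polynomial.monom (Ks ! i) i)"
    have hL: "h \<in> polys" unfolding h_def
      by (intro polys_sum polys_closed) (use Ks(1) nth_mem in \<open>force simp: m_def\<close>)
    have ch: "poly.coeff h j = (if j < m then Ks ! j else 0)" for j
      by (simp add: h_def Polynomial.coeff_sum)
    have "poly h \<theta> = (\<Sum>i<m. Ks ! i * Us ! i)"
      by (simp add: h_def poly_sum poly_monom Us_def m_def)
    also have "\<dots> = 0" using Ks(2) by (simp add: combine_eq_sum_min m_def len)
    finally have "poly h \<theta> = 0" .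
    moreover have "h = 0 \<or> degree h < degree g"
    proof (cases "h = 0")
      case False
      then have "poly.coeff h (degree h) \<noteq> 0" by simp
      then show ?thesis using ch[of "degree h"] by (simp add: m_def split: if_splits)
    qed simp
    ultimately have "h = 0" using small hL by blast
    then have "Ks ! j = 0" if "j < m" for j using ch[of j] that by simp
    then show "set (take (length Us) Ks) \<subseteq> {\<zero>\<^bsub>CC\<^esub>}"
      by (auto simp: in_set_conv_nth len m_def)
  qed simp
  moreover have "CC.Span L Us = adjoin \<theta>"
  proof
    show "CC.Span L Us \<subseteq> adjoin \<theta>"
    proof
      fix a assume "a \<in> CC.Span L Us"
      then obtain Ks where Ks: "set Ks \<subseteq> L" "length Ks = length Us" "a = CC.combine Ks Us"
        using CC.Span_mem_iff_length_version[OF subfield, of Us a] by auto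
      define h where "h = (\<Sum>i<degree g. Polynomial.monom (Ks ! i) i)"
      have "h \<in> polys" unfolding h_def
        by (intro polys_sum polys_closed) (use Ks nth_mem len in force)
      moreover have "a = poly h \<theta>"
        by (simp add: h_def poly_sum poly_monom Ks(2,3) combine_eq_sum_min len) (simp add: Us_def)
      ultimately show "a \<in> adjoin \<theta>" unfolding adjoin_def by blast
    qed
    show "adjoin \<theta> \<subseteq> CC.Span L Us"
    proof
      fix a assume "a \<in> adjoin \<theta>"
      then obtain h where h: "h \<in> polys" "a = poly h \<theta>" unfolding adjoin_def by blast
      obtain k r where kr: "k \<in> polys" "r \<in> polys" "h = g * k + r" "r = 0 \<or> degree r < degree g"
        using polys_division[OF g(1,2) h(1)] by blast
      have a: "a = poly r \<theta>" using h kr g(3) by simp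
      define Ks where "Ks = map (poly.coeff r) [0..<degree g]"
      have "poly r \<theta> = (\<Sum>i<degree g. poly.coeff r i * \<theta> ^ i)"
      proof (cases "r = 0")
        case False
        then have "degree r < degree g" using kr(4) by blast
        then have "(\<Sum>i<degree g. poly.coeff r i * \<theta> ^ i) = (\<Sum>i\<le>degree r. poly.coeff r i * \<theta> ^ i)"
          by (intro sum.mono_neutral_right) (auto simp: coeff_eq_0)
        then show ?thesis by (simp add: poly_altdef)
      qed simp
      also have "\<dots> = CC.combine Ks Us" by (simp add: combine_eq_sum_min Ks_def Us_def)
      finally have "a = CC.combine Ks Us" using a by simp
      moreover have "set Ks \<subseteq> L" "length Ks = length Us" using kr(2) by (auto simp: Ks_def polys_def len)
      ultimately show "a \<in> CC.Span L Us" using CC.Span_mem_iff_length_version[OF subfield, of Us a] by auto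
    qed
  qed
  ultimately show ?thesis using CC.dimensionI[OF subfield, of Us "adjoin \<theta>"] len by simp
qed

lemma embeddingsD:
  assumes "\<sigma> \<in> embeddings L E"
  shows "a \<in> E \<Longrightarrow> b \<in> E \<Longrightarrow> \<sigma> (a + b) = \<sigma> a + \<sigma> b" "a \<in> E \<Longrightarrow> b \<in> E \<Longrightarrow> \<sigma> (a * b) = \<sigma> a * \<sigma> b"
    "\<sigma> 1 = 1" "a \<in> L \<Longrightarrow> \<sigma> a = a" "\<sigma> \<in> extensional E"
  using assms unfolding embeddings_def Ring.ring_hom_def by auto

lemma embedding_poly:
  assumes s: "\<sigma> \<in> embeddings L E" and E: "subfield E CC" "L \<subseteq> E" and h: "h \<in> polys" and a: "a \<in> E"
  shows "\<sigma> (poly h a) = poly h (\<sigma> a)"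
  using h
proof (induction h)
  case 0
  then show ?case using embeddingsD(4)[OF s, of 0] by simp
next
  case (pCons c h)
  interpret E: complex_subfield E by (rule complex_subfield.intro) fact
  have h: "h \<in> polys" and c: "c \<in> L"
    using pCons.prems by (simp_all add: polys_pCons_iff)
  have hE: "poly h a \<in> E" by (rule poly_in_subfield[OF E h a])
  have "\<sigma> (poly (pCons c h) a) = \<sigma> c + \<sigma> (a * poly h a)"
    using embeddingsD(1)[OF s, of c "a * poly h a"] c E(2) hE a by auto
  also have "\<dots> = c + \<sigma> a * \<sigma> (poly h a)"
    using embeddingsD(4)[OF s c] embeddingsD(2)[OF s a hE] by simp
  finally show ?case using pCons.IH h by simp
qed

lemma embedding_inj:
  assumes s: "\<sigma> \<in> embeddings L E" and E: "subfield E CC"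
  shows "inj_on \<sigma> E"
proof (rule inj_onI)
  interpret E: complex_subfield E by (rule complex_subfield.intro) fact
  fix a b assume ab: "a \<in> E" "b \<in> E" "\<sigma> a = \<sigma> b"
  have "\<sigma> a = \<sigma> (a - b) + \<sigma> b" using embeddingsD(1)[OF s, of "a - b" b] ab by simp
  then have z: "\<sigma> (a - b) = 0" using ab(3) by simp
  show "a = b"
  proof (rule ccontr)
    assume "a \<noteq> b"
    then have "\<sigma> ((a - b) * inverse (a - b)) = 1" using embeddingsD(3)[OF s] by simp
    moreover have "\<sigma> ((a - b) * inverse (a - b)) = \<sigma> (a - b) * \<sigma> (inverse (a - b))"
      by (rule embeddingsD(2)[OF s]) (use ab in auto)
    ultimately show False using z by simp
  qed
qed

text \<open>Embeddings correspond to the roots of the minimal polynomial of \<open>\<theta>\<close>, and an element fixed by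
  all of them is a polynomial in \<open>\<theta>\<close> of degree zero.\<close>

lemma simple_normal_extension:
  assumes S: "finite S" "\<theta> \<in> S" "(\<Prod>s\<in>S. [:- s, 1:]) \<in> polys" "S \<subseteq> E"
    and E: "E = generate_field CC (insert \<theta> L)"
  obtains d where "0 < d" "d \<le> card S" "CC.dimension d L E" "finite (embeddings L E)" "card (embeddings L E) = d"
    "\<And>\<sigma>. \<sigma> \<in> embeddings L E \<Longrightarrow> \<sigma> ` E = E"
    "\<And>a. a \<in> E \<Longrightarrow> (\<And>\<sigma>. \<sigma> \<in> embeddings L E \<Longrightarrow> \<sigma> a = a) \<Longrightarrow> a \<in> L"
proof -
  define f where "f = (\<Prod>s\<in>S. [:- s, 1:])"
  have f0: "f \<noteq> 0" unfolding f_def using S(1) by simp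
  have rootf: "poly f z = 0 \<longleftrightarrow> z \<in> S" for z
    unfolding f_def using S(1) by (auto simp: poly_prod)
  have degf: "degree f = card S"
    unfolding f_def by (subst degree_prod_eq_sum_degree) auto
  have fL: "f \<in> polys" "poly f \<theta> = 0" using S rootf by (auto simp: f_def)
  obtain g where g: "g \<in> polys" "lead_coeff g = 1" "poly g \<theta> = 0" "degree g > 0" "degree g \<le> degree f"
    "\<And>h. h \<in> polys \<Longrightarrow> poly h \<theta> = 0 \<Longrightarrow> g dvd h"
    using minimal_polynomial[OF fL(1) f0 fL(2)] by blast
  note adj = adjoin_field[OF fL(1) f0 fL(2)]
  have EA: "E = adjoin \<theta>" using E adj(2) by simp
  have sE: "subfield E CC" using EA adj(1) by simp
  interpret E: complex_subfield E by (rule complex_subfield.intro) (rule sE)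
  have "insert \<theta> L \<subseteq> E" unfolding E by (auto intro: generate_field.incl)
  then have LE: "L \<subseteq> E" and tE: "\<theta> \<in> E" by auto
  have dim: "CC.dimension (degree g) L E" unfolding EA by (rule dimension_adjoin[OF g(1-3,6)])
  define Z where "Z = {z. poly g z = 0}"
  have g0: "g \<noteq> 0" using g(2) by auto
  have finZ: "finite Z" unfolding Z_def by (rule poly_roots_finite[OF g0])
  obtain k where k: "f = g * k" using g(6)[OF fL] by blast
  have k0: "k \<noteq> 0" using f0 k by auto
  have ZS: "Z \<subseteq> S" unfolding Z_def using rootf k by auto
  \<comment> \<open>\<open>f = g * k\<close> has as many distinct roots as its degree, and neither
    factor has more roots than its own degree; so \<open>g\<close> has exactly
    \<open>degree g\<close> distinct roots.\<close>
  have "S = Z \<union> {z. poly k z = 0}" using rootf k unfolding Z_def by auto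
  then have "card S \<le> card Z + card {z. poly k z = 0}" by (metis card_Un_le)
  moreover have "card {z. poly k z = 0} \<le> degree k" by (rule card_poly_roots_bound[OF k0])
  moreover have "card Z \<le> degree g" unfolding Z_def by (rule card_poly_roots_bound[OF g0])
  moreover have "degree f = degree g + degree k" unfolding k by (rule degree_mult_eq[OF g0 k0])
  ultimately have cardZ: "card Z = degree g" using degf by linarith
  have rep: "\<exists>h\<in>polys. a = poly h \<theta>" if "a \<in> E" for a using that EA by (auto simp: adjoin_def)
  have intoZ: "\<sigma> z \<in> Z" if "\<sigma> \<in> embeddings L E" "z \<in> Z" for \<sigma> z
    using embedding_poly[OF that(1) sE LE g(1), of z] that(2) ZS S(4) embeddingsD(4)[OF that(1), of 0]
    by (auto simp: Z_def)
  have tZ: "\<theta> \<in> Z" using g(3) by (simp add: Z_def)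
  \<comment> \<open>The embedding sending \<open>\<theta>\<close> to \<open>z\<close> evaluates at
    \<open>z\<close> any polynomial that represents its argument at \<open>\<theta>\<close>. Two
    representatives differ by a multiple of \<open>g\<close>, which vanishes at
    \<open>z\<close>.\<close>
  have ext: "\<exists>\<sigma>\<in>embeddings L E. \<forall>h\<in>polys. \<sigma> (poly h \<theta>) = poly h z" if z: "z \<in> Z" for z
  proof -
    have "\<forall>a. \<exists>h. a \<in> E \<longrightarrow> h \<in> polys \<and> a = poly h \<theta>" using rep by blast
    then obtain p where p: "\<And>a. a \<in> E \<Longrightarrow> p a \<in> polys \<and> a = poly (p a) \<theta>" by metis
    define \<sigma> where "\<sigma> = restrict (\<lambda>a. poly (p a) z) E"
    have val: "\<sigma> (poly h \<theta>) = poly h z" if h: "h \<in> polys" for h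
    proof -
      have aE: "poly h \<theta> \<in> E" using h EA by (auto simp: adjoin_def)
      note q = p[OF aE]
      have "g dvd h - p (poly h \<theta>)"
        by (rule g(6)) (use h q polys_closed(2) in auto)
      then obtain k where "h - p (poly h \<theta>) = g * k" by (rule dvdE)
      then have "poly h z - poly (p (poly h \<theta>)) z = poly g z * poly k z" by (metis poly_diff poly_mult)
      then show ?thesis using aE z by (simp add: \<sigma>_def Z_def)
    qed
    have "\<sigma> \<in> embeddings L E"
      unfolding embeddings_def
    proof (intro CollectI conjI ballI)
      show "\<sigma> \<in> Ring.ring_hom (CC\<lparr>carrier := E\<rparr>) CC"
      proof (rule Ring.ring_hom_memI)
        fix a b assume "a \<in> carrier (CC\<lparr>carrier := E\<rparr>)" "b \<in> carrier (CC\<lparr>carrier := E\<rparr>)"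
        then obtain h k where hk: "h \<in> polys" "a = poly h \<theta>" "k \<in> polys" "b = poly k \<theta>"
          using rep[of a] rep[of b] by auto
        show "\<sigma> (a \<otimes>\<^bsub>CC\<lparr>carrier := E\<rparr>\<^esub> b) = \<sigma> a \<otimes>\<^bsub>CC\<^esub> \<sigma> b"
          using val[of "h * k"] val[of h] val[of k] hk polys_closed(3) by simp
        show "\<sigma> (a \<oplus>\<^bsub>CC\<lparr>carrier := E\<rparr>\<^esub> b) = \<sigma> a \<oplus>\<^bsub>CC\<^esub> \<sigma> b"
          using val[of "h + k"] val[of h] val[of k] hk polys_closed(1) by simp
      next
        show "\<sigma> \<one>\<^bsub>CC\<lparr>carrier := E\<rparr>\<^esub> = \<one>\<^bsub>CC\<^esub>" using val[of "[:1:]"] polys_closed(7)[of 1] by simp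
      qed simp
      show "\<sigma> \<in> extensional E" by (simp add: \<sigma>_def)
      show "\<sigma> a = a" if "a \<in> L" for a using val[of "[:a:]"] polys_closed(7)[OF that] by simp
    qed
    then show ?thesis using val by blast
  qed
  have idp: "[:0, 1:] \<in> polys" by (simp add: polys_pCons_iff polys_closed)
  have bij: "bij_betw (\<lambda>\<sigma>. \<sigma> \<theta>) (embeddings L E) Z"
    unfolding bij_betw_def
  proof
    show "inj_on (\<lambda>\<sigma>. \<sigma> \<theta>) (embeddings L E)"
    proof (rule inj_onI)
      fix \<sigma> \<rho> assume s: "\<sigma> \<in> embeddings L E" and r: "\<rho> \<in> embeddings L E" and e: "\<sigma> \<theta> = \<rho> \<theta>"
      show "\<sigma> = \<rho>"
      proof (rule extensionalityI[OF embeddingsD(5)[OF s] embeddingsD(5)[OF r]])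
        fix a assume "a \<in> E"
        then obtain h where "h \<in> polys" "a = poly h \<theta>" using rep by blast
        then show "\<sigma> a = \<rho> a"
          using embedding_poly[OF s sE LE _ tE] embedding_poly[OF r sE LE _ tE] e by simp
      qed
    qed
    show "(\<lambda>\<sigma>. \<sigma> \<theta>) ` embeddings L E = Z"
    proof
      show "(\<lambda>\<sigma>. \<sigma> \<theta>) ` embeddings L E \<subseteq> Z" using intoZ tZ by blast
      show "Z \<subseteq> (\<lambda>\<sigma>. \<sigma> \<theta>) ` embeddings L E"
      proof
        fix z assume "z \<in> Z"
        then obtain \<sigma> where "\<sigma> \<in> embeddings L E" "\<forall>h\<in>polys. \<sigma> (poly h \<theta>) = poly h z" using ext by blast
        then show "z \<in> (\<lambda>\<sigma>. \<sigma> \<theta>) ` embeddings L E" using idp by (force intro: image_eqI[of _ _ \<sigma>])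
      qed
    qed
  qed
  have fin: "finite (embeddings L E)" using bij_betw_finite[OF bij] finZ by simp
  have crd: "card (embeddings L E) = degree g" using bij_betw_same_card[OF bij] cardZ by simp
  have img: "\<sigma> ` E = E" if s: "\<sigma> \<in> embeddings L E" for \<sigma>
  proof
    show "\<sigma> ` E \<subseteq> E"
    proof
      fix b assume "b \<in> \<sigma> ` E"
      then obtain h where "h \<in> polys" "b = \<sigma> (poly h \<theta>)" using rep by blast
      then show "b \<in> E" using embedding_poly[OF s sE LE _ tE] poly_in_subfield[OF sE LE, of h "\<sigma> \<theta>"]
          intoZ[OF s tZ] ZS S(4) by auto
    qed
    \<comment> \<open>An injective self-map of a finite set is onto, so \<open>\<theta>\<close> is
      the image of some root \<open>z\<close>; polynomials in \<open>z\<close> then have all of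
      \<open>E\<close> as image.\<close>
    have "\<sigma> ` Z = Z"
      by (rule endo_inj_surj[OF finZ]) (use intoZ[OF s] inj_on_subset[OF embedding_inj[OF s sE]] ZS S(4) in auto)
    then obtain z where z: "z \<in> Z" "\<theta> = \<sigma> z" using tZ by blast
    have zE: "z \<in> E" using z ZS S(4) by blast
    show "E \<subseteq> \<sigma> ` E"
    proof
      fix b assume "b \<in> E"
      then obtain h where h: "h \<in> polys" "b = poly h \<theta>" using rep by blast
      then have "b = \<sigma> (poly h z)" using embedding_poly[OF s sE LE h(1) zE] z(2) by simp
      then show "b \<in> \<sigma> ` E" using poly_in_subfield[OF sE LE h(1) zE] by blast
    qed
  qed
  have fixed: "a \<in> L" if a: "a \<in> E" "\<And>\<sigma>. \<sigma> \<in> embeddings L E \<Longrightarrow> \<sigma> a = a" for a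
  proof -
    obtain h where h: "h \<in> polys" "a = poly h \<theta>" using rep[OF a(1)] by blast
    obtain q r where qr: "q \<in> polys" "r \<in> polys" "h = g * q + r" "r = 0 \<or> degree r < degree g"
      using polys_division[OF g(1,2) h(1)] by blast
    have ar: "a = poly r \<theta>" using h qr g(3) by simp
    have "poly (r - [:a:]) z = 0" if z: "z \<in> Z" for z
    proof -
      obtain \<sigma> where s: "\<sigma> \<in> embeddings L E" "\<forall>h\<in>polys. \<sigma> (poly h \<theta>) = poly h z" using ext[OF z] by blast
      then have "poly r z = a" using ar a(2)[OF s(1)] qr(2) by metis
      then show ?thesis by simp
    qed
    then have sub: "Z \<subseteq> {z. poly (r - [:a:]) z = 0}" by blast
    have "r - [:a:] = 0"
    proof (rule ccontr)
      assume n: "r - [:a:] \<noteq> 0"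
      have "degree g \<le> card {z. poly (r - [:a:]) z = 0}"
        using card_mono[OF poly_roots_finite[OF n] sub] cardZ by simp
      also have "\<dots> \<le> degree (r - [:a:])" by (rule card_poly_roots_bound[OF n])
      also have "\<dots> < degree g" using qr(4) g(4) degree_diff_le_max[of r "[:a:]"] by auto
      finally show False by simp
    qed
    then have "a = poly.coeff r 0" by simp
    then show ?thesis using qr(2) by (simp add: polys_def)
  qed
  have "degree g \<le> card S" using g(5) degf by simp
  then show thesis by (rule that[OF g(4) _ dim fin crd img fixed])
qed

end

text \<open>Unlike the members of \<open>galois_group\<close>, these maps are arbitrary outside
  \<open>L\<close>, so plain compositions and iterates \<open>\<sigma> ^^ k\<close> are again of
  this kind.\<close>

definition field_aut :: "complex set \<Rightarrow> (complex \<Rightarrow> complex) \<Rightarrow> bool" where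
  "field_aut L \<sigma> \<longleftrightarrow> \<sigma> ` L = L \<and> \<sigma> 1 = 1 \<and>
     (\<forall>a\<in>L. \<forall>b\<in>L. \<sigma> (a + b) = \<sigma> a + \<sigma> b \<and> \<sigma> (a * b) = \<sigma> a * \<sigma> b)"

context complex_subfield
begin

lemma field_autD:
  assumes s: "field_aut L \<sigma>"
  shows "\<sigma> ` L = L" "\<sigma> 1 = 1" "a \<in> L \<Longrightarrow> b \<in> L \<Longrightarrow> \<sigma> (a + b) = \<sigma> a + \<sigma> b"
    "a \<in> L \<Longrightarrow> b \<in> L \<Longrightarrow> \<sigma> (a * b) = \<sigma> a * \<sigma> b" "a \<in> L \<Longrightarrow> \<sigma> a \<in> L" "\<sigma> 0 = 0"
    "a \<in> L \<Longrightarrow> b \<in> L \<Longrightarrow> \<sigma> (a - b) = \<sigma> a - \<sigma> b" "a \<in> L \<Longrightarrow> \<sigma> (- a) = - \<sigma> a" "inj_on \<sigma> L"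
    "a \<in> L \<Longrightarrow> \<sigma> a = 0 \<longleftrightarrow> a = 0" "\<sigma> (of_nat m) = of_nat m" "\<sigma> (of_int k) = of_int k"
    "a \<in> L \<Longrightarrow> \<sigma> (a ^ m) = \<sigma> a ^ m"
proof -
  show im: "\<sigma> ` L = L" and one: "\<sigma> 1 = 1" using s by (auto simp: field_aut_def)
  show add: "\<sigma> (a + b) = \<sigma> a + \<sigma> b" and mult: "\<sigma> (a * b) = \<sigma> a * \<sigma> b"
    if "a \<in> L" "b \<in> L" for a b using s that by (auto simp: field_aut_def)
  show "\<sigma> a \<in> L" if "a \<in> L" for a using im that by blast
  show zero: "\<sigma> 0 = 0" using add[of 0 0] by simp
  show diff: "\<sigma> (a - b) = \<sigma> a - \<sigma> b" if "a \<in> L" "b \<in> L" for a b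
    using add[of "a - b" b] that by simp
  show um: "\<sigma> (- a) = - \<sigma> a" if "a \<in> L" for a using diff[of 0 a] zero that by simp
  show z: "\<sigma> a = 0 \<longleftrightarrow> a = 0" if "a \<in> L" for a
  proof (cases "a = 0")
    case False
    then have "\<sigma> a * \<sigma> (inverse a) = 1" using mult[of a "inverse a"] that one by simp
    then show ?thesis using False by auto
  qed (simp add: zero)
  show "inj_on \<sigma> L" by (rule inj_onI) (use z diff in \<open>metis L_closed(3) right_minus_eq\<close>)
  show nat: "\<sigma> (of_nat m) = of_nat m" for m by (induction m) (simp_all add: zero one add)
  show "\<sigma> (of_int k) = of_int k" by (cases k) (simp_all add: nat um one diff add del: of_nat_Suc)
  show "\<sigma> (a ^ m) = \<sigma> a ^ m" if "a \<in> L" by (induction m) (simp_all add: one mult that)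
qed

text \<open>\<open>\<sigma>\<close> commutes with integer polynomials and vanishes only at zero, so
  \<open>a\<close> and \<open>\<sigma> a\<close> are roots of the same ones.\<close>

lemma field_aut_algebraic_int:
  assumes s: "field_aut L \<sigma>" and a: "a \<in> L"
  shows "algebraic_int (\<sigma> a) \<longleftrightarrow> algebraic_int a"
proof -
  have p: "poly (map_poly of_int p) a \<in> L \<and> \<sigma> (poly (map_poly of_int p) a) = poly (map_poly of_int p) (\<sigma> a)"
    for p :: "int poly"
    by (induction p) (use a in \<open>simp_all add: map_poly_pCons field_autD[OF s]\<close>)
  then have "poly (map_poly of_int p) (\<sigma> a) = 0 \<longleftrightarrow> poly (map_poly of_int p) a = 0" for p :: "int poly"
    using field_autD(10)[OF s, of "poly (map_poly of_int p) a"] by metis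
  then show ?thesis unfolding algebraic_int_altdef_ipoly by simp
qed

lemma field_aut_compose:
  assumes "field_aut L \<sigma>" "field_aut L \<rho>"
  shows "field_aut L (\<lambda>a. \<sigma> (\<rho> a))"
  using assms field_autD(5)[OF assms(2)] unfolding field_aut_def by (auto simp: image_image[symmetric])

lemma field_aut_id: "field_aut L (\<lambda>a. a)"
  by (simp add: field_aut_def)

lemma field_aut_funpow: "field_aut L \<sigma> \<Longrightarrow> field_aut L (\<sigma> ^^ k)"
proof (induction k)
  case 0
  then show ?case using field_aut_id by (simp add: id_def)
next
  case (Suc k)
  then show ?case using field_aut_compose[of \<sigma> "\<sigma> ^^ k"] by (simp add: comp_def)
qed

lemma field_aut_prod:
  assumes s: "field_aut L \<sigma>" and f: "\<And>i. i \<in> A \<Longrightarrow> f i \<in> L"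
  shows "prod f A \<in> L \<and> \<sigma> (prod f A) = (\<Prod>i\<in>A. \<sigma> (f i))"
  using f by (induction A rule: infinite_finite_induct) (simp_all add: field_autD[OF s])

lemma field_aut_inv:
  assumes s: "field_aut L \<sigma>"
  shows "field_aut L (inv_into L \<sigma>)" "a \<in> L \<Longrightarrow> \<sigma> (inv_into L \<sigma> a) = a"
proof -
  note f = field_autD[OF s]
  let ?r = "inv_into L \<sigma>"
  have inv: "?r (\<sigma> a) = a" if "a \<in> L" for a using that f(9) by simp
  show "field_aut L ?r"
    unfolding field_aut_def
  proof (intro conjI ballI)
    show "?r ` L = L"
    proof
      show "?r ` L \<subseteq> L" using inv_into_into[of _ \<sigma> L] f(1) by auto
      show "L \<subseteq> ?r ` L" using inv f(5) by (metis image_eqI subsetI)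
    qed
    show "?r 1 = 1" using inv[of 1] f(2) by simp
    fix a b assume "a \<in> L" "b \<in> L"
    then have "a \<in> \<sigma> ` L" "b \<in> \<sigma> ` L" by (simp_all add: f(1))
    then obtain a' b' where "a' \<in> L" "b' \<in> L" "a = \<sigma> a'" "b = \<sigma> b'" by (elim imageE)
    then show "?r (a + b) = ?r a + ?r b" "?r (a * b) = ?r a * ?r b"
      using inv[of a'] inv[of b'] inv[of "a' + b'"] inv[of "a' * b'"] f(3,4)[of a' b'] by auto
  qed
  show "\<sigma> (inv_into L \<sigma> a) = a" if "a \<in> L" using f_inv_into_f[of a \<sigma> L] that f(1) by simp
qed

end

section \<open>Automorphisms acting on ideals and valuations\<close>

context number_field
begin

lemma field_aut_O:
  assumes s: "field_aut L \<sigma>"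
  shows "\<sigma> ` \<O> = \<O>"
proof -
  have "\<sigma> a \<in> \<O> \<longleftrightarrow> a \<in> \<O>" if "a \<in> L" for a
    using field_aut_algebraic_int[OF s that] field_autD(5)[OF s that] that by (simp add: integers_of_def)
  then show ?thesis using field_autD(1)[OF s] O_subset_L by (auto simp: image_iff) (metis imageE)
qed

lemma field_aut_times:
  assumes s: "field_aut L \<sigma>" and I: "I \<subseteq> L" and J: "J \<subseteq> L"
  shows "\<sigma> ` (I \<star> J) = (\<sigma> ` I) \<star> (\<sigma> ` J)"
proof
  have L: "I \<star> J \<subseteq> L" by (rule ideal_prod_subset) (use I J in auto)
  show "\<sigma> ` (I \<star> J) \<subseteq> (\<sigma> ` I) \<star> (\<sigma> ` J)"
  proof
    fix b assume "b \<in> \<sigma> ` (I \<star> J)"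
    then obtain a where a: "a \<in> I \<star> J" "b = \<sigma> a" by blast
    have "\<sigma> a \<in> (\<sigma> ` I) \<star> (\<sigma> ` J)" using a(1)
    proof (induction rule: ideal_prod.induct)
      case (prod i j)
      then have "i \<in> L" "j \<in> L" using I J by auto
      then show ?case using field_autD(4)[OF s, of i j] prod ideal_prod_mult[of "\<sigma> i" "\<sigma> ` I" "\<sigma> j"] by auto
    next
      case (sum s1 s2)
      then have "s1 \<in> L" "s2 \<in> L" using L by auto
      then show ?case using field_autD(3)[OF s, of s1 s2] ideal_prod_add[OF sum.IH] by auto
    qed
    then show "b \<in> (\<sigma> ` I) \<star> (\<sigma> ` J)" using a(2) by simp
  qed
  show "(\<sigma> ` I) \<star> (\<sigma> ` J) \<subseteq> \<sigma> ` (I \<star> J)"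
  proof (rule ideal_prod_subset)
    fix i j assume "i \<in> \<sigma> ` I" "j \<in> \<sigma> ` J"
    then obtain i' j' where ij: "i' \<in> I" "j' \<in> J" "i = \<sigma> i'" "j = \<sigma> j'" by blast
    moreover from this have "i' \<in> L" "j' \<in> L" using I J by auto
    ultimately have "i * j = \<sigma> (i' * j')" using field_autD(4)[OF s, of i' j'] by simp
    then show "i * j \<in> \<sigma> ` (I \<star> J)" using ideal_prod_mult[OF ij(1,2)] by blast
  next
    fix a b assume "a \<in> \<sigma> ` (I \<star> J)" "b \<in> \<sigma> ` (I \<star> J)"
    then obtain a' b' where ab: "a' \<in> I \<star> J" "b' \<in> I \<star> J" "a = \<sigma> a'" "b = \<sigma> b'" by blast
    moreover from this have "a' \<in> L" "b' \<in> L" using L by auto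
    ultimately have "a + b = \<sigma> (a' + b')" using field_autD(3)[OF s, of a' b'] by simp
    then show "a + b \<in> \<sigma> ` (I \<star> J)" using ideal_prod_add[OF ab(1,2)] by blast
  qed
qed

lemma field_aut_prime:
  assumes s: "field_aut L \<sigma>" and P: "P \<in> primes"
  shows "\<sigma> ` P \<in> primes"
proof -
  note p = primesD[OF P]
  have PL: "P \<subseteq> L" using p(2) O_subset_L by blast
  have mem: "\<sigma> a \<in> \<sigma> ` P \<longleftrightarrow> a \<in> P" if "a \<in> L" for a
    using inj_on_image_mem_iff[OF field_autD(9)[OF s] that PL] .
  have sub: "\<sigma> ` P \<subseteq> \<O>" using p(2) field_aut_O[OF s] by blast
  obtain c where c: "c \<in> P" "c \<noteq> 0" using fractionalD(7)[OF p(1)] by blast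
  have "integral (\<sigma> ` P)"
  proof (rule integral_if[OF sub, of "\<sigma> c"])
    show "\<sigma> c \<noteq> 0" using field_autD(10)[OF s, of c] c PL by auto
    show "a + b \<in> \<sigma> ` P" if ab: "a \<in> \<sigma> ` P" "b \<in> \<sigma> ` P" for a b
    proof -
      obtain a' b' where "a' \<in> P" "b' \<in> P" "a = \<sigma> a'" "b = \<sigma> b'" using ab by blast
      moreover from this have "a' \<in> L" "b' \<in> L" using PL by auto
      ultimately have "a + b = \<sigma> (a' + b')" "a' + b' \<in> P"
        using field_autD(3)[OF s, of a' b'] fractionalD(3)[OF p(1), of a' b'] by auto
      then show ?thesis by blast
    qed
    show "r * a \<in> \<sigma> ` P" if ra: "r \<in> \<O>" "a \<in> \<sigma> ` P" for r a
    proof -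
      have "r \<in> \<sigma> ` \<O>" using ra(1) by (simp add: field_aut_O[OF s])
      then obtain a' r' where "a' \<in> P" "r' \<in> \<O>" "a = \<sigma> a'" "r = \<sigma> r'" using ra(2) by (elim imageE)
      moreover from this have "a' \<in> L" "r' \<in> L" using PL O_subset_L by auto
      ultimately have "r * a = \<sigma> (r' * a')" "r' * a' \<in> P"
        using field_autD(4)[OF s, of r' a'] fractionalD(4)[OF p(1), of r' a'] by auto
      then show ?thesis by blast
    qed
  qed (use c in auto)
  moreover have "1 \<notin> \<sigma> ` P" using mem[of 1] field_autD(2)[OF s] p(3) by simp
  moreover have "a \<in> \<sigma> ` P \<or> b \<in> \<sigma> ` P" if ab: "a \<in> \<O>" "b \<in> \<O>" "a * b \<in> \<sigma> ` P" for a b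
  proof -
    have "a \<in> \<sigma> ` \<O>" "b \<in> \<sigma> ` \<O>" using ab(1,2) by (simp_all add: field_aut_O[OF s])
    then obtain a' b' where h: "a' \<in> \<O>" "b' \<in> \<O>" "a = \<sigma> a'" "b = \<sigma> b'" by (elim imageE)
    have L: "a' \<in> L" "b' \<in> L" using h(1,2) O_subset_L by auto
    then have "\<sigma> (a' * b') \<in> \<sigma> ` P" using ab(3) field_autD(4)[OF s, of a' b'] h(3,4) by simp
    then have "a' * b' \<in> P" using mem[OF L_closed(4)[OF L]] by simp
    then have "a' \<in> P \<or> b' \<in> P" by (rule p(4)[OF h(1,2)])
    then show ?thesis unfolding h(3,4) by (elim disjE) (blast, blast)
  qed
  ultimately show ?thesis unfolding in_primes_iff by blast
qed

lemma field_aut_lies_above: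
  assumes s: "field_aut L \<sigma>" and P: "P \<subseteq> L"
  shows "lies_above (\<sigma> ` P) q \<longleftrightarrow> lies_above P q"
proof -
  have "\<sigma> ` P \<inter> \<int> = P \<inter> \<int>"
  proof (rule Set.set_eqI)
    fix a
    show "a \<in> \<sigma> ` P \<inter> \<int> \<longleftrightarrow> a \<in> P \<inter> \<int>"
    proof (cases "a \<in> \<int>")
      case True
      then have "a \<in> L" "\<sigma> a = a" using field_autD(12)[OF s] by (auto elim!: Ints_cases)
      then have "a \<in> \<sigma> ` P \<longleftrightarrow> a \<in> P" using inj_on_image_mem_iff[OF field_autD(9)[OF s] _ P, of a] by simp
      then show ?thesis by blast
    qed simp
  qed
  then show ?thesis by (simp add: lies_above_def)
qed

lemma field_aut_list_prod:
  assumes s: "field_aut L \<sigma>"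
  shows "set Ps \<subseteq> primes \<Longrightarrow> \<sigma> ` list_prod Ps = list_prod (map ((`) \<sigma>) Ps)"
proof (induction Ps)
  case Nil
  then show ?case using field_aut_O[OF s] by simp
next
  case (Cons P Ps)
  have "P \<subseteq> L" "list_prod Ps \<subseteq> L"
    using Cons.prems primesD(2)[of P] integral_list_prod[of Ps] O_subset_L by auto
  then show ?case using field_aut_times[OF s, of P "list_prod Ps"] Cons by simp
qed

lemma field_aut_principal:
  assumes s: "field_aut L \<sigma>" and a: "a \<in> L"
  shows "\<sigma> ` principal_ideal L a = principal_ideal L (\<sigma> a)"
proof -
  have "\<sigma> ` principal_ideal L a = (\<lambda>r. \<sigma> (a * r)) ` \<O>"
    by (simp add: principal_eq_image image_image)
  also have "\<dots> = (\<lambda>r. \<sigma> r * \<sigma> a) ` \<O>"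
    by (rule image_cong) (use field_autD(4)[OF s a] O_subset_L in auto)
  also have "\<dots> = (\<lambda>r. r * \<sigma> a) ` (\<sigma> ` \<O>)" by (simp add: image_image)
  finally show ?thesis unfolding field_aut_O[OF s] by (auto simp: principal_ideal_def)
qed

text \<open>\<open>\<sigma>\<close> carries a factorization of the principal ideal of
  \<open>a\<close> to one of the principal ideal of \<open>\<sigma> a\<close>, and it is injective
  on primes, so multiplicities are kept.\<close>

lemma val_field_aut_O:
  assumes s: "field_aut L \<sigma>" and P: "P \<in> primes" and a: "a \<in> \<O>" "a \<noteq> 0"
  shows "val (\<sigma> ` P) (\<sigma> a) = val P a"
proof -
  have aL: "a \<in> L" using a O_subset_L by blast
  have f: "fractional (principal_ideal L a)" by (rule fractional_principal[OF aL a(2)])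
  have "principal_ideal L a \<subseteq> \<O>" using a by (auto simp: principal_ideal_def)
  then obtain Ps where Ps: "set Ps \<subseteq> primes" "list_prod Ps = principal_ideal L a"
    using integral_eq_list_prod[of "principal_ideal L a"] f by blast
  let ?Qs = "map ((`) \<sigma>) Ps"
  have Qs: "set ?Qs \<subseteq> primes" using Ps(1) field_aut_prime[OF s] by auto
  have "list_prod ?Qs = principal_ideal L (\<sigma> a)"
    using field_aut_list_prod[OF s Ps(1)] Ps(2) field_aut_principal[OF s aL] by simp
  moreover have "ideal_exponents L (list_prod Rs) R = int (count_list Rs R)" if "set Rs \<subseteq> primes" for Rs R
    using list_prod_eq_ideal_of[OF that] ideal_exponents_ideal_of by simp
  ultimately have v: "val P a = int (count_list Ps P)" "val (\<sigma> ` P) (\<sigma> a) = int (count_list ?Qs (\<sigma> ` P))"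
    using Ps Qs unfolding val_def by metis+
  have "count_list ?Qs (\<sigma> ` P) = count_list Ps P"
    using Ps(1)
  proof (induction Ps)
    case (Cons Q Ps)
    have "Q \<subseteq> L" "P \<subseteq> L" using Cons.prems P primesD(2) O_subset_L by auto
    then have "\<sigma> ` Q = \<sigma> ` P \<longleftrightarrow> Q = P" using inj_on_image_eq_iff[OF field_autD(9)[OF s]] by blast
    then show ?case using Cons by simp
  qed simp
  then show ?thesis using v by simp
qed

lemma val_field_aut:
  assumes s: "field_aut L \<sigma>" and P: "P \<in> primes" and a: "a \<in> L" "a \<noteq> 0"
  shows "val (\<sigma> ` P) (\<sigma> a) = val P a"
proof -
  obtain m where m: "m > 0" "of_nat m * a \<in> \<O>" using integral_multiple[OF a(1)] by blast
  have m0: "of_nat m \<in> \<O>" "of_nat m \<noteq> (0::complex)" "of_nat m \<in> L" using m by auto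
  have sa: "\<sigma> a \<in> L" "\<sigma> a \<noteq> 0" using a field_autD(5,10)[OF s] by auto
  have "val (\<sigma> ` P) (\<sigma> (of_nat m * a)) = val P (of_nat m * a)"
    by (rule val_field_aut_O[OF s P m(2)]) (use m a in simp)
  moreover have "\<sigma> (of_nat m * a) = of_nat m * \<sigma> a" using field_autD(4,11)[OF s] a m0 by simp
  moreover have "val (\<sigma> ` P) (of_nat m) = val P (of_nat m)"
    using val_field_aut_O[OF s P m0(1,2)] field_autD(11)[OF s] by simp
  ultimately show ?thesis
    using val_mult[OF m0(3,2) a] val_mult[OF m0(3,2) sa] by simp
qed

end

section \<open>Galois groups and stabilizers of primes\<close>

lemma (in complex_subfield) galois_group_eq:
  assumes k: "k \<subseteq> L"
  shows "carrier (galois_group k L) = {\<sigma> \<in> extensional L. field_aut L \<sigma> \<and> (\<forall>a\<in>k. \<sigma> a = a)}"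
proof (intro Set.set_eqI iffI)
  fix \<sigma> assume "\<sigma> \<in> carrier (galois_group k L)"
  then show "\<sigma> \<in> {\<sigma> \<in> extensional L. field_aut L \<sigma> \<and> (\<forall>a\<in>k. \<sigma> a = a)}"
    unfolding galois_group_def BijGroup_def Bij_def field_aut_def Ring.ring_hom_def
    by (auto simp: bij_betw_def)
next
  fix \<sigma> assume s: "\<sigma> \<in> {\<sigma> \<in> extensional L. field_aut L \<sigma> \<and> (\<forall>a\<in>k. \<sigma> a = a)}"
  then have "field_aut L \<sigma>" by blast
  note f = field_autD[OF this]
  show "\<sigma> \<in> carrier (galois_group k L)"
    unfolding galois_group_def BijGroup_def Bij_def Ring.ring_hom_def bij_betw_def using s f(1-5,9) by auto
qed

lemma (in complex_subfield) group_galois_group: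
  assumes k: "k \<subseteq> L"
  shows "group (galois_group k L)"
    "\<sigma> \<in> carrier (galois_group k L) \<Longrightarrow> \<rho> \<in> carrier (galois_group k L) \<Longrightarrow>
      \<sigma> \<otimes>\<^bsub>galois_group k L\<^esub> \<rho> = compose L \<sigma> \<rho>"
    "\<one>\<^bsub>galois_group k L\<^esub> = (\<lambda>a\<in>L. a)"
proof -
  let ?C = "carrier (galois_group k L)"
  have CB: "?C \<subseteq> Bij L" by (auto simp: galois_group_def)
  have m: "compose L \<sigma> \<rho> \<in> ?C" if "\<sigma> \<in> ?C" "\<rho> \<in> ?C" for \<sigma> \<rho>
  proof -
    have a: "field_aut L \<sigma>" "field_aut L \<rho>" using that galois_group_eq[OF k] by auto
    have "field_aut L (\<lambda>a. \<sigma> (\<rho> a))" by (rule field_aut_compose[OF a])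
    then have "field_aut L (compose L \<sigma> \<rho>)" unfolding field_aut_def by (auto simp: compose_def image_iff)
    then show ?thesis using that k unfolding galois_group_eq[OF k] by (auto simp: compose_def)
  qed
  have i: "(\<lambda>a\<in>L. inv_into L \<sigma> a) \<in> ?C" if s: "\<sigma> \<in> ?C" for \<sigma>
  proof -
    have a: "field_aut L \<sigma>" using s galois_group_eq[OF k] by auto
    let ?r = "\<lambda>a\<in>L. inv_into L \<sigma> a"
    have "field_aut L ?r"
      using field_aut_inv(1)[OF a] unfolding field_aut_def by simp
    moreover have "?r a = a" if "a \<in> k" for a
    proof -
      have "a \<in> L" "\<sigma> a = a" using that k s unfolding galois_group_eq[OF k] by auto
      then show ?thesis using inv_into_f_f[OF field_autD(9)[OF a], of a] by simp
    qed
    ultimately show ?thesis unfolding galois_group_eq[OF k] by auto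
  qed
  have sg: "subgroup ?C (BijGroup L)"
  proof
    show "?C \<subseteq> carrier (BijGroup L)" using CB by (simp add: BijGroup_def)
    show "\<sigma> \<otimes>\<^bsub>BijGroup L\<^esub> \<rho> \<in> ?C" if "\<sigma> \<in> ?C" "\<rho> \<in> ?C" for \<sigma> \<rho>
      using m[OF that] that CB by (auto simp: BijGroup_def)
    show "\<one>\<^bsub>BijGroup L\<^esub> \<in> ?C"
      using k unfolding galois_group_eq[OF k] by (auto simp: BijGroup_def field_aut_def)
    show "inv\<^bsub>BijGroup L\<^esub> \<sigma> \<in> ?C" if "\<sigma> \<in> ?C" for \<sigma>
      using i[OF that] inv_BijGroup[of \<sigma> L] that CB by auto
  qed
  have "galois_group k L = (BijGroup L)\<lparr>carrier := ?C\<rparr>" by (simp add: galois_group_def)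
  then show "group (galois_group k L)"
    using group.subgroup_imp_group[OF group_BijGroup sg] by simp
  show "\<sigma> \<otimes>\<^bsub>galois_group k L\<^esub> \<rho> = compose L \<sigma> \<rho>" if "\<sigma> \<in> ?C" "\<rho> \<in> ?C"
    using that CB by (auto simp: galois_group_def BijGroup_def)
  show "\<one>\<^bsub>galois_group k L\<^esub> = (\<lambda>a\<in>L. a)" by (simp add: galois_group_def BijGroup_def)
qed

text \<open>Lagrange for the decomposition group of \<open>P\<close>. In a group of order
  \<open>p\<close> only the trivial and the full stabilizer remain.\<close>

lemma (in complex_subfield) stabilizer_card_dvd:
  assumes k: "k \<subseteq> L" and fin: "finite (carrier (galois_group k L))" and P: "P \<subseteq> L"
  shows "card {\<sigma> \<in> carrier (galois_group k L). \<sigma> ` P = P} dvd card (carrier (galois_group k L))"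
proof -
  interpret H: group "galois_group k L" by (rule group_galois_group(1)[OF k])
  note c = group_galois_group(2)[OF k] and o = group_galois_group(3)[OF k]
  let ?S = "{\<sigma> \<in> carrier (galois_group k L). \<sigma> ` P = P}"
  have comp: "compose L \<sigma> \<rho> ` P = \<sigma> ` (\<rho> ` P)" for \<sigma> \<rho>
    using P by (auto simp: compose_def image_iff subset_iff) 
  have "subgroup ?S (galois_group k L)"
  proof
    show "\<sigma> \<otimes>\<^bsub>galois_group k L\<^esub> \<rho> \<in> ?S" if "\<sigma> \<in> ?S" "\<rho> \<in> ?S" for \<sigma> \<rho>
      using that c[of \<sigma> \<rho>] comp[of \<sigma> \<rho>] H.m_closed[of \<sigma> \<rho>] by simp
    have "(\<lambda>a\<in>L. a) ` P = P" using P by (auto simp: image_iff subset_iff)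
    then show "\<one>\<^bsub>galois_group k L\<^esub> \<in> ?S" using H.one_closed o by simp
    show "inv\<^bsub>galois_group k L\<^esub> \<sigma> \<in> ?S" if s: "\<sigma> \<in> ?S" for \<sigma>
    proof -
      let ?i = "inv\<^bsub>galois_group k L\<^esub> \<sigma>"
      have i: "?i \<in> carrier (galois_group k L)" using s by simp
      have "compose L ?i \<sigma> = (\<lambda>a\<in>L. a)" using c[OF i, of \<sigma>] H.l_inv[of \<sigma>] o s by simp
      then have "?i ` (\<sigma> ` P) = P" using comp[of ?i \<sigma>] \<open>(\<lambda>a\<in>L. a) ` P = P\<close> by simp
      then show ?thesis using s i by simp
    qed
  qed auto
  note e = H.lagrange[OF this, unfolded Coset.order_def, symmetric]
  show ?thesis by (subst e) (rule dvd_triv_right)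
qed

section \<open>Exponents modulo \<open>p\<close> in the tower\<close>

context number_field
begin

lemma O_prod: "(\<And>i. i \<in> A \<Longrightarrow> f i \<in> \<O>) \<Longrightarrow> prod f A \<in> \<O>"
  by (induction A rule: infinite_finite_induct) simp_all

lemma field_aut_prime_preimage:
  assumes s: "field_aut L \<sigma>" and P: "P \<in> primes"
  obtains Q where "Q \<in> primes" "\<sigma> ` Q = P"
proof -
  have PL: "P \<subseteq> L" using primesD(2)[OF P] O_subset_L by blast
  have "\<sigma> ` inv_into L \<sigma> ` P = (\<lambda>a. a) ` P"
    unfolding image_image by (rule image_cong) (use field_aut_inv(2)[OF s] PL in auto)
  then show thesis using that field_aut_prime[OF field_aut_inv(1)[OF s] P] by simp
qed

text \<open>Approximation yields a denominator \<open>d\<close> of \<open>b\<close>: its valuation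
  is at least \<open>max 0 (- val Q b)\<close> at every \<open>Q\<close> and exactly zero at
  \<open>P\<close>. Then \<open>d\<close> and \<open>d * b\<close> are algebraic integers outside
  \<open>P\<close>.\<close>

lemma val_zero_quotient:
  assumes P: "P \<in> primes" and b: "b \<in> L" "b \<noteq> 0" "val P b = 0"
  obtains c d where "c \<in> \<O>" "d \<in> \<O>" "c \<notin> P" "d \<notin> P" "d * b = c"
proof -
  define w where "w Q = max 0 (- val Q b)" for Q
  have "(\<lambda>Q. val Q b) \<in> exponent_functions"
    unfolding val_def using ideal_of_exponents(1)[OF fractional_principal[OF b(1,2)]] .
  moreover have "{Q. w Q \<noteq> 0} \<subseteq> {Q. val Q b \<noteq> 0}" by (auto simp: w_def)
  ultimately have w: "w \<in> exponent_functions"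
    unfolding exponent_functions_def using finite_subset[of "{Q. w Q \<noteq> 0}"] by blast
  note f = fractional_ideal_of[OF w] and x = ideal_exponents_ideal_of[OF w]
  obtain d where d: "d \<in> ideal_of w" "d \<noteq> 0" "val P d = w P"
    using approximation[OF f, of "{P}"] P x by auto
  have dL: "d \<in> L" using fractionalD(1)[OF f] d(1) by blast
  have wd: "w Q \<le> val Q d" for Q using mem_iff_val[OF f dL d(2)] d(1) x by simp
  have memO: "a \<in> \<O>" if "a \<in> L" "a \<noteq> 0" "\<And>Q. 0 \<le> val Q a" for a
    using mem_iff_val[of \<O> a] integral_O that by (simp add: ideal_exponents_O)
  have dO: "d \<in> \<O>"
  proof (rule memO[OF dL d(2)])
    show "0 \<le> val Q d" for Q using wd[of Q] by (simp add: w_def)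
  qed
  have v: "val Q (d * b) = val Q d + val Q b" for Q by (rule val_mult[OF dL d(2) b(1,2)])
  have bO: "d * b \<in> \<O>"
  proof (rule memO)
    show "0 \<le> val Q (d * b)" for Q using wd[of Q] v[of Q] by (simp add: w_def)
  qed (use dL d b in auto)
  have "d \<notin> P" using mem_prime_iff[OF P dO d(2)] d(3) b(3) by (simp add: w_def)
  moreover have "d * b \<notin> P" using mem_prime_iff[OF P bO] v[of P] d(2,3) b(2,3) by (simp add: w_def)
  ultimately show thesis using that bO dO by blast
qed

end

text \<open>What the argument takes from the tower: a group of order \<open>p\<close> with fixed
  field \<open>K\<close>, and a map \<open>\<tau>\<close> on \<open>L\<close> whose iterate
  \<open>p - 1\<close> is trivial and which commutes with this group and preserves \<open>K\<close>.
  \<open>degree_K\<close> is an upper bound, which suffices to let the count of an orbit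
  close.\<close>

locale cyclic_tower = L: number_field L nL + K: number_field K nK
  for L :: "complex set" and nL :: nat and K :: "complex set" and nK :: nat +
  fixes p e :: nat and \<tau> :: "complex \<Rightarrow> complex"
  assumes prime_p: "Factorial_Ring.prime p" and odd_p: "odd p" and primroot: "residue_primroot p e"
    and K_subset_L: "K \<subseteq> L" and degree_L: "nL = p * nK" and degree_K: "nK \<le> p - 1"
    and embeddings_eq: "embeddings K L = carrier (galois_group K L)"
    and card_embeddings: "card (embeddings K L) = p"
    and fixed_field: "\<And>a. a \<in> L \<Longrightarrow> (\<And>\<sigma>. \<sigma> \<in> embeddings K L \<Longrightarrow> \<sigma> a = a) \<Longrightarrow> a \<in> K"
    and tau_aut: "field_aut L \<tau>" and tau_K: "\<tau> ` K = K"
    and tau_order: "\<And>a. a \<in> L \<Longrightarrow> (\<tau> ^^ (p - 1)) a = a"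
    and tau_commute: "\<And>\<sigma> a. \<sigma> \<in> embeddings K L \<Longrightarrow> a \<in> L \<Longrightarrow> \<sigma> (\<tau> a) = \<tau> (\<sigma> a)"
begin

abbreviation H :: "(complex \<Rightarrow> complex) set" where "H \<equiv> embeddings K L"

abbreviation N :: "complex \<Rightarrow> complex" where "N \<equiv> field_norm K L"

abbreviation \<Phi> :: "complex \<Rightarrow> complex" where "\<Phi> \<equiv> Phi p e \<tau>"

lemma p_gt_2: "p > 2"
  using prime_p odd_p prime_ge_2_nat[of p] by (cases "p = 2") auto

lemma finite_H: "finite H"
  using card_embeddings p_gt_2 card.infinite by fastforce

lemma HD:
  assumes "\<sigma> \<in> H"
  shows "field_aut L \<sigma>" "a \<in> K \<Longrightarrow> \<sigma> a = a" "\<sigma> \<in> extensional L"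
  using assms unfolding embeddings_eq L.galois_group_eq[OF K_subset_L] by auto

lemma H_group:
  shows "group (galois_group K L)"
    "\<sigma> \<in> H \<Longrightarrow> \<rho> \<in> H \<Longrightarrow> compose L \<sigma> \<rho> \<in> H"
    "\<sigma> \<in> H \<Longrightarrow> \<exists>\<rho>\<in>H. compose L \<rho> \<sigma> = (\<lambda>a\<in>L. a)"
    "(\<lambda>a\<in>L. a) \<in> H"
proof -
  note g = L.group_galois_group[OF K_subset_L]
  show gr: "group (galois_group K L)" by (rule g(1))
  interpret G: group "galois_group K L" by (rule gr)
  show "compose L \<sigma> \<rho> \<in> H" if "\<sigma> \<in> H" "\<rho> \<in> H"
    using that g(2)[of \<sigma> \<rho>] G.m_closed[of \<sigma> \<rho>] unfolding embeddings_eq by simp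
  show "\<exists>\<rho>\<in>H. compose L \<rho> \<sigma> = (\<lambda>a\<in>L. a)" if "\<sigma> \<in> H"
  proof -
    have s: "\<sigma> \<in> carrier (galois_group K L)" using that embeddings_eq by simp
    note i = G.inv_closed[OF s]
    show ?thesis using g(2)[OF i s] G.l_inv[OF s] g(3) i unfolding embeddings_eq by auto
  qed
  show "(\<lambda>a\<in>L. a) \<in> H" using G.one_closed g(3) unfolding embeddings_eq by simp
qed

lemma N_closed:
  assumes a: "a \<in> L"
  shows "N a \<in> L" "N a \<in> K" "a \<noteq> 0 \<Longrightarrow> N a \<noteq> 0" "a \<in> integers_of L \<Longrightarrow> N a \<in> integers_of K"
    "a = 0 \<Longrightarrow> N a = 0"
proof -
  have sL: "\<sigma> a \<in> L" if "\<sigma> \<in> H" for \<sigma> using L.field_autD(5)[OF HD(1)[OF that] a] .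
  show NL: "N a \<in> L" unfolding field_norm_def
    using L.field_aut_prod[OF L.field_aut_id, of H "\<lambda>\<sigma>. \<sigma> a"] sL by simp
  have "\<rho> (N a) = N a" if r: "\<rho> \<in> H" for \<rho>
  proof -
    \<comment> \<open>Composition with \<open>\<rho>\<close> permutes \<open>H\<close>, hence the
      factors of the norm, which is therefore fixed by \<open>\<rho>\<close>.\<close>
    have inj: "inj_on (compose L \<rho>) H"
    proof (rule inj_onI)
      fix \<sigma> \<sigma>' assume h: "\<sigma> \<in> H" "\<sigma>' \<in> H" "compose L \<rho> \<sigma> = compose L \<rho> \<sigma>'"
      show "\<sigma> = \<sigma>'"
      proof (rule extensionalityI[OF HD(3)[OF h(1)] HD(3)[OF h(2)]])
        fix b assume b: "b \<in> L"
        then have "\<rho> (\<sigma> b) = \<rho> (\<sigma>' b)" using fun_cong[OF h(3), of b] by (simp add: compose_def)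
        then show "\<sigma> b = \<sigma>' b"
          using inj_onD[OF L.field_autD(9)[OF HD(1)[OF r]]] L.field_autD(5)[OF HD(1)] h(1,2) b by blast
      qed
    qed
    have im: "compose L \<rho> ` H = H"
      by (rule endo_inj_surj[OF finite_H _ inj]) (use H_group(2)[OF r] in blast)
    have "\<rho> (N a) = (\<Prod>\<sigma>\<in>H. \<rho> (\<sigma> a))" unfolding field_norm_def
      using L.field_aut_prod[OF HD(1)[OF r], of H "\<lambda>\<sigma>. \<sigma> a"] sL by simp
    also have "\<dots> = (\<Prod>\<sigma>\<in>H. compose L \<rho> \<sigma> a)" using a by (simp add: compose_def)
    also have "\<dots> = (\<Prod>\<sigma>\<in>compose L \<rho> ` H. \<sigma> a)" by (simp add: prod.reindex[OF inj])
    finally show ?thesis unfolding im field_norm_def .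
  qed
  then show NK: "N a \<in> K" by (rule fixed_field[OF NL])
  show "N a \<noteq> 0" if "a \<noteq> 0" unfolding field_norm_def
    using L.field_autD(10)[OF HD(1) a] that finite_H by simp
  show "N a = 0" if "a = 0"
    unfolding field_norm_def using L.field_autD(6)[OF HD(1)] that finite_H H_group(4) by auto
  show "N a \<in> integers_of K" if "a \<in> integers_of L"
  proof -
    have "N a \<in> integers_of L" unfolding field_norm_def
      by (rule L.O_prod) (use L.field_aut_O[OF HD(1)] that in blast)
    then show ?thesis using NK by (simp add: integers_of_def)
  qed
qed

lemma N_mult: "a \<in> L \<Longrightarrow> b \<in> L \<Longrightarrow> N (a * b) = N a * N b"
  unfolding field_norm_def prod.distrib[symmetric]
  by (rule prod.cong) (use L.field_autD(4)[OF HD(1)] in blast)+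

lemma N_power: "a \<in> L \<Longrightarrow> N (a ^ k) = N a ^ k"
  unfolding field_norm_def prod_power_distrib
  by (rule prod.cong) (use L.field_autD(13)[OF HD(1)] in blast)+

lemma tau_pow_aut: "field_aut L (\<tau> ^^ j)"
  by (rule L.field_aut_funpow[OF tau_aut])

lemma tau_pow_commute: "\<sigma> \<in> H \<Longrightarrow> a \<in> L \<Longrightarrow> \<sigma> ((\<tau> ^^ j) a) = (\<tau> ^^ j) (\<sigma> a)"
  by (induction j) (simp_all add: tau_commute L.field_autD(5)[OF tau_pow_aut])

lemma N_tau: "a \<in> L \<Longrightarrow> N ((\<tau> ^^ j) a) = (\<tau> ^^ j) (N a)"
  unfolding field_norm_def
  using L.field_aut_prod[OF tau_pow_aut, of H "\<lambda>\<sigma>. \<sigma> a" j] L.field_autD(5)[OF HD(1)]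
  by (simp add: tau_pow_commute)

lemma N_prod: "(\<And>i. i \<in> A \<Longrightarrow> f i \<in> L) \<Longrightarrow> finite A \<Longrightarrow> N (prod f A) = (\<Prod>i\<in>A. N (f i))"
proof (induction A rule: infinite_finite_induct)
  case empty
  have "N 1 = 1" unfolding field_norm_def by (rule prod.neutral) (use L.field_autD(2)[OF HD(1)] in blast)
  then show ?case by simp
next
  case (insert i A)
  have "prod f A \<in> L" using L.field_aut_prod[OF L.field_aut_id, of A f] insert.prems by simp
  then show ?case using insert N_mult by simp
qed simp

section \<open>The homomorphism \<open>\<Phi>\<close> and its exponents modulo
  \<open>p\<close>\<close>

lemma Phi_closed:
  assumes a: "a \<in> L"
  shows "\<Phi> a \<in> L" "a \<noteq> 0 \<Longrightarrow> \<Phi> a \<noteq> 0" "\<tau> (\<Phi> a) = \<Phi> (\<tau> a)" "N (\<Phi> a) = \<Phi> (N a)"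
proof -
  let ?f = "\<lambda>j. ((\<tau> ^^ j) a) ^ (e ^ (p - 2 - j))"
  have f: "?f j \<in> L" for j using L.field_autD(5)[OF tau_pow_aut a] by simp
  show "\<Phi> a \<in> L" unfolding Phi_def using L.field_aut_prod[OF L.field_aut_id, of _ ?f] f by blast
  show "\<Phi> a \<noteq> 0" if "a \<noteq> 0" unfolding Phi_def using L.field_autD(10)[OF tau_pow_aut a] that by simp
  have "\<tau> (\<Phi> a) = (\<Prod>j=0..p-2. \<tau> (?f j))" unfolding Phi_def
    using L.field_aut_prod[OF tau_aut, of _ ?f] f by blast
  also have "\<dots> = \<Phi> (\<tau> a)" unfolding Phi_def
    using L.field_autD(13)[OF tau_aut] L.field_autD(5)[OF tau_pow_aut a] by (simp add: funpow_swap1)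
  finally show "\<tau> (\<Phi> a) = \<Phi> (\<tau> a)" .
  have "N (\<Phi> a) = (\<Prod>j=0..p-2. N (?f j))" unfolding Phi_def by (rule N_prod) (use f in auto)
  also have "\<dots> = \<Phi> (N a)" unfolding Phi_def
    using N_power L.field_autD(5)[OF tau_pow_aut a] N_tau[OF a] by simp
  finally show "N (\<Phi> a) = \<Phi> (N a)" .
qed

lemma Phi_in_K: "a \<in> K \<Longrightarrow> \<Phi> a \<in> K"
proof -
  assume a: "a \<in> K"
  have "(\<tau> ^^ j) a \<in> K" for j by (induction j) (use a tau_K in auto)
  then show ?thesis unfolding Phi_def
    using K.field_aut_prod[OF K.field_aut_id, of _ "\<lambda>j. ((\<tau> ^^ j) a) ^ (e ^ (p - 2 - j))"] by simp
qed

lemma val_Phi: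
  assumes "a \<in> L" "a \<noteq> 0"
  shows "L.val P (\<Phi> a) = (\<Sum>j=0..p-2. int (e ^ (p - 2 - j)) * L.val P ((\<tau> ^^ j) a))"
proof -
  have t: "(\<tau> ^^ j) a \<in> L \<and> (\<tau> ^^ j) a \<noteq> 0" for j
    using L.field_autD(5,10)[OF tau_pow_aut assms(1)] assms(2) by simp
  show ?thesis unfolding Phi_def
    using L.val_prod[of "{0..p-2}" "\<lambda>j. ((\<tau> ^^ j) a) ^ (e ^ (p - 2 - j))" P] t
    by (simp add: L.val_power)
qed

lemma e_power_eq_1: "[int e ^ (p - 1) = 1] (mod int p)"
proof -
  have c: "Rings.coprime p e" using primroot by (simp add: residue_primroot_def)
  have "\<not> p dvd e"
    using c p_gt_2 by (metis coprime_common_divisor_nat dvd_refl nat_neq_iff one_less_numeral_iff less_trans semiring_norm(76))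
  then have "[e ^ (p - 1) = 1] (mod p)" by (rule fermat_theorem[OF prime_p])
  then show ?thesis by (metis cong_int_iff of_nat_1 of_nat_power)
qed

lemma coprime_e: "Rings.coprime (int e ^ k) (int p)"
proof -
  have "Rings.coprime p e" using primroot by (simp add: residue_primroot_def)
  then have "Rings.coprime (int e) (int p)" by (simp add: coprime_commute)
  then show ?thesis by simp
qed

lemma e_power_neq_1:
  assumes "0 < d" "d < p - 1"
  shows "\<not> [int e ^ d = 1] (mod int p)"
proof
  assume "[int e ^ d = 1] (mod int p)"
  then have "[e ^ d = 1] (mod p)" by (metis cong_int_iff of_nat_1 of_nat_power)
  then have "ord p e dvd d" using ord_divides by blast
  moreover have "ord p e = p - 1" using primroot prime_p by (simp add: residue_primroot_def totient_prime)
  ultimately show False using assms dvd_imp_le by fastforce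
qed

lemma val_Phi_tau:
  assumes P: "P \<in> L.primes" and a: "a \<in> L" "a \<noteq> 0"
  shows "[L.val P (\<Phi> a) = int e * L.val (\<tau> ` P) (\<Phi> a)] (mod int p)"
proof -
  let ?Q = "\<tau> ` P"
  have ta: "\<tau> a \<in> L" "\<tau> a \<noteq> 0" using L.field_autD(5,10)[OF tau_aut a(1)] a(2) by auto
  define u where "u j = L.val ?Q ((\<tau> ^^ j) a)" for j
  define m where "m = p - 2"
  have m: "p - 1 = Suc m" using p_gt_2 by (simp add: m_def)
  have shift: "(\<Sum>j\<le>Suc m. int (e ^ (Suc m - j)) * u j) =
    int (e ^ Suc m) * u 0 + (\<Sum>j\<le>m. int (e ^ (Suc m - Suc j)) * u (Suc j))"
    by (subst sum.atMost_Suc_shift) simp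
  have "L.val P (\<Phi> a) = L.val ?Q (\<tau> (\<Phi> a))"
    using L.val_field_aut[OF tau_aut P] Phi_closed(1,2)[OF a(1)] a(2) by simp
  also have "\<dots> = L.val ?Q (\<Phi> (\<tau> a))" using Phi_closed(3)[OF a(1)] by simp
  also have "\<dots> = (\<Sum>j=0..m. int (e ^ (m - j)) * u (Suc j))"
    using val_Phi[OF ta] by (simp add: u_def funpow_swap1 m_def)
  also have "\<dots> = (\<Sum>j\<le>m. int (e ^ (Suc m - Suc j)) * u (Suc j))" by (simp add: atLeast0AtMost)
  also have "\<dots> = (\<Sum>j\<le>Suc m. int (e ^ (Suc m - j)) * u j) - int (e ^ Suc m) * u 0"
    unfolding shift by simp
  also have "(\<Sum>j\<le>Suc m. int (e ^ (Suc m - j)) * u j) =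
    (\<Sum>j\<le>m. int (e ^ (Suc m - j)) * u j) + u (Suc m)" by simp
  also have "(\<Sum>j\<le>m. int (e ^ (Suc m - j)) * u j) = int e * (\<Sum>j\<le>m. int (e ^ (m - j)) * u j)"
    unfolding sum_distrib_left by (rule sum.cong) (simp_all add: Suc_diff_le)
  also have "(\<Sum>j\<le>m. int (e ^ (m - j)) * u j) = L.val ?Q (\<Phi> a)"
    using val_Phi[OF a, of ?Q] by (simp add: u_def m_def atLeast0AtMost)
  also have "u (Suc m) = u 0" using tau_order[OF a(1)] m by (simp add: u_def del: funpow.simps)
  finally have eq: "L.val P (\<Phi> a) - int e * L.val ?Q (\<Phi> a) = - (u 0 * (int e ^ Suc m - 1))"
    by (simp add: algebra_simps)
  have "int p dvd int e ^ Suc m - 1" using e_power_eq_1 unfolding m by (simp add: cong_iff_dvd_diff)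
  then show ?thesis unfolding cong_iff_dvd_diff eq by simp
qed

lemma tau_pow_prime: "P \<in> L.primes \<Longrightarrow> (\<tau> ^^ k) ` P \<in> L.primes"
  by (rule L.field_aut_prime[OF tau_pow_aut])

lemma val_Phi_tau_pow:
  assumes P: "P \<in> L.primes" and a: "a \<in> L" "a \<noteq> 0"
  shows "[L.val P (\<Phi> a) = int e ^ k * L.val ((\<tau> ^^ k) ` P) (\<Phi> a)] (mod int p)"
proof (induction k)
  case (Suc k)
  have "[int e ^ k * L.val ((\<tau> ^^ k) ` P) (\<Phi> a) = int e ^ k * (int e * L.val (\<tau> ` (\<tau> ^^ k) ` P) (\<Phi> a))] (mod int p)"
    by (rule cong_scalar_left[OF val_Phi_tau[OF tau_pow_prime[OF P] a]])
  then show ?case using cong_trans[OF Suc] by (simp add: image_comp mult_ac)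
qed simp

lemma val_Phi_tau_pow_dvd:
  assumes P: "P \<in> L.primes" and a: "a \<in> L" "a \<noteq> 0"
  shows "int p dvd L.val ((\<tau> ^^ k) ` P) (\<Phi> a) \<longleftrightarrow> int p dvd L.val P (\<Phi> a)"
  using cong_dvd_iff[OF val_Phi_tau_pow[OF P a, of k]] coprime_e[of k]
  by (simp add: coprime_commute coprime_dvd_mult_right_iff)

lemma val_H_invariant:
  assumes "\<sigma> \<in> H" "P \<in> L.primes" "b \<in> K" "b \<noteq> 0"
  shows "L.val (\<sigma> ` P) b = L.val P b"
  using L.val_field_aut[OF HD(1)[OF assms(1)] assms(2), of b] HD(2)[OF assms(1,3)] assms K_subset_L by auto

lemma val_N:
  assumes a: "a \<in> L" "a \<noteq> 0"
  shows "L.val P (N a) = (\<Sum>\<sigma>\<in>H. L.val P (\<sigma> a))"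
  unfolding field_norm_def
  using L.val_prod[of H "\<lambda>\<sigma>. \<sigma> a" P] L.field_autD(5,10)[OF HD(1) a(1)] a(2) by simp

lemma dvd_val_N_if_fixed:
  assumes P: "P \<in> L.primes" and s: "\<sigma> \<in> H" "\<sigma> ` P = P" "\<sigma> \<noteq> (\<lambda>a\<in>L. a)" and b: "b \<in> L" "b \<noteq> 0"
  shows "int p dvd L.val P (N b)"
proof -
  have PL: "P \<subseteq> L" using L.primesD(2)[OF P] L.O_subset_L by blast
  let ?S = "{\<sigma> \<in> H. \<sigma> ` P = P}"
  have "card ?S dvd p"
    using L.stabilizer_card_dvd[OF K_subset_L _ PL] finite_H card_embeddings unfolding embeddings_eq by simp
  moreover have "card ?S \<noteq> 1"
  proof -
    have "(\<lambda>a\<in>L. a) ` P = P" using PL by (auto simp: image_iff subset_iff)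
    then have "{\<sigma>, \<lambda>a\<in>L. a} \<subseteq> ?S" using s H_group(4) by auto
    then have "card {\<sigma>, \<lambda>a\<in>L. a} \<le> card ?S" using finite_H by (intro card_mono) auto
    then show ?thesis using s(3) by simp
  qed
  ultimately have "card ?S = p" using prime_p prime_nat_iff by blast
  then have S: "?S = H" using card_subset_eq[OF finite_H, of ?S] card_embeddings by auto
  have "L.val P (\<rho> b) = L.val P b" if "\<rho> \<in> H" for \<rho>
  proof -
    have "\<rho> ` P = P" using S that by blast
    then show ?thesis using L.val_field_aut[OF HD(1)[OF that] P b] by simp
  qed
  then show ?thesis unfolding val_N[OF b] using card_embeddings by simp
qed

lemma compose_image: "P \<subseteq> L \<Longrightarrow> compose L \<sigma> \<rho> ` P = \<sigma> ` \<rho> ` P"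
  by (auto simp: compose_def image_iff subset_iff)

context
  fixes x :: complex
  assumes x: "x \<in> L" "x \<noteq> 0"
begin

abbreviation V :: "complex set \<Rightarrow> int" where "V P \<equiv> L.val P (\<Phi> (N x))"

lemma Nx: "N x \<in> L" "N x \<in> K" "N x \<noteq> 0"
  using N_closed[OF x(1)] x(2) by auto

lemma V_H: "\<sigma> \<in> H \<Longrightarrow> P \<in> L.primes \<Longrightarrow> V (\<sigma> ` P) = V P"
  by (rule val_H_invariant) (use Phi_in_K[OF Nx(2)] Phi_closed(2)[OF Nx(1,3)] in auto)

text \<open>A power of \<open>\<tau>\<close> stands on one side only and \<open>Q\<close> is
  arbitrary: two members of the orbit of \<open>P\<close> are compared by taking \<open>Q\<close> to
  be the image of \<open>P\<close> under the smaller iterate and \<open>d\<close> the difference of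
  the iterates.\<close>

lemma orbit_inj_aux:
  assumes Q: "Q \<in> L.primes" "\<not> int p dvd V Q" and s: "\<sigma> \<in> H" "\<sigma>' \<in> H"
    and d: "d < p - 1" and eq: "\<sigma> ` Q = \<sigma>' ` (\<tau> ^^ d) ` Q"
  shows "d = 0 \<and> \<sigma> = \<sigma>'"
proof -
  have QL: "Q \<subseteq> L" using L.primesD(2)[OF Q(1)] L.O_subset_L by blast
  obtain \<rho> where r: "\<rho> \<in> H" "compose L \<rho> \<sigma>' = (\<lambda>a\<in>L. a)" using H_group(3)[OF s(2)] by blast
  have tQL: "(\<tau> ^^ d) ` Q \<subseteq> L" using L.primesD(2)[OF tau_pow_prime[OF Q(1)]] L.O_subset_L by blast
  have "compose L \<rho> \<sigma> ` Q = \<rho> ` \<sigma>' ` (\<tau> ^^ d) ` Q" by (simp only: compose_image[OF QL] eq)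
  also have "\<dots> = (\<lambda>a\<in>L. a) ` (\<tau> ^^ d) ` Q" using compose_image[OF tQL, of \<rho> \<sigma>'] r(2) by simp
  also have "\<dots> = (\<tau> ^^ d) ` Q" using tQL by (auto simp: image_iff subset_iff)
  finally have c: "compose L \<rho> \<sigma> ` Q = (\<tau> ^^ d) ` Q" .
  have cH: "compose L \<rho> \<sigma> \<in> H" by (rule H_group(2)[OF r(1) s(1)])
  have d0: "d = 0"
  proof (rule ccontr)
    assume "d \<noteq> 0"
    have "V ((\<tau> ^^ d) ` Q) = V Q" using V_H[OF cH Q(1)] c by simp
    then have "[V Q = int e ^ d * V Q] (mod int p)" using val_Phi_tau_pow[OF Q(1) Nx(1,3), of d] by simp
    then have "int p dvd int e ^ d * V Q - V Q" using cong_sym cong_iff_dvd_diff by blast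
    then have "int p dvd (int e ^ d - 1) * V Q" by (simp add: algebra_simps)
    then have "int p dvd int e ^ d - 1" using Q(2) prime_p by (simp add: prime_dvd_mult_iff)
    then show False using e_power_neq_1[of d] d \<open>d \<noteq> 0\<close> by (simp add: cong_iff_dvd_diff)
  qed
  have "compose L \<rho> \<sigma> = (\<lambda>a\<in>L. a)"
  proof (rule ccontr)
    assume n: "compose L \<rho> \<sigma> \<noteq> (\<lambda>a\<in>L. a)"
    \<comment> \<open>\<open>\<Phi>\<close> and the norm commute, so \<open>V Q\<close> is the
      exponent of a norm and is divisible by \<open>p\<close> once a nontrivial element of
      \<open>H\<close> fixes \<open>Q\<close>.\<close>
    have "int p dvd L.val Q (N (\<Phi> x))"
      by (rule dvd_val_N_if_fixed[OF Q(1) cH _ n]) (use c d0 Phi_closed[OF x(1)] x(2) in auto)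
    then show False using Q(2) Phi_closed(4)[OF x(1)] by simp
  qed
  then have "compose L \<rho> \<sigma> = compose L \<rho> \<sigma>'" using r(2) by simp
  have "\<sigma> = \<sigma>'"
  proof (rule extensionalityI[OF HD(3)[OF s(1)] HD(3)[OF s(2)]])
    fix b assume b: "b \<in> L"
    then have "\<rho> (\<sigma> b) = \<rho> (\<sigma>' b)" using fun_cong[OF \<open>compose L \<rho> \<sigma> = compose L \<rho> \<sigma>'\<close>, of b] by (simp add: compose_def)
    then show "\<sigma> b = \<sigma>' b"
      using inj_onD[OF L.field_autD(9)[OF HD(1)[OF r(1)]]] L.field_autD(5)[OF HD(1)] s b by blast
  qed
  then show ?thesis using d0 by blast
qed

text \<open>If \<open>p\<close> does not divide the exponent of \<open>P\<close>, the \<open>p (p - 1)\<close> conjugates of \<open>P\<close> are distinct.\<close>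

lemma splits_if_not_dvd:
  assumes P: "P \<in> L.primes" "\<not> int p dvd V P" and q: "Factorial_Ring.prime q" "lies_above P q"
  shows "card (L.primes_above q) = nL"
proof -
  have PL: "P \<subseteq> L" using L.primesD(2)[OF P(1)] L.O_subset_L by blast
  define f :: "(complex \<Rightarrow> complex) \<times> nat \<Rightarrow> complex set"
    where "f = (\<lambda>(\<sigma>, j). \<sigma> ` (\<tau> ^^ j) ` P)"
  have step: "j = j' \<and> \<sigma> = \<sigma>'"
    if h: "\<sigma> \<in> H" "\<sigma>' \<in> H" "j \<le> j'" "j' < p - 1" "\<sigma> ` (\<tau> ^^ j) ` P = \<sigma>' ` (\<tau> ^^ j') ` P" for \<sigma> \<sigma>' j j'
  proof -
    have "(\<tau> ^^ j') ` P = (\<tau> ^^ (j' - j)) ` (\<tau> ^^ j) ` P"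
      using h(3) by (simp add: image_comp flip: funpow_add)
    then have "j' - j = 0 \<and> \<sigma> = \<sigma>'"
      using orbit_inj_aux[OF tau_pow_prime[OF P(1)] _ h(1,2), of j "j' - j"]
        val_Phi_tau_pow_dvd[OF P(1) Nx(1,3), of j] P(2) h(4,5) by simp
    then show ?thesis using h(3) by simp
  qed
  have "inj_on f (H \<times> {..<p - 1})"
  proof (rule inj_onI, clarify)
    fix \<sigma> j \<sigma>' j' assume h: "\<sigma> \<in> H" "\<sigma>' \<in> H" "j < p - 1" "j' < p - 1" "f (\<sigma>, j) = f (\<sigma>', j')"
    show "\<sigma> = \<sigma>' \<and> j = j'"
    proof (cases "j \<le> j'")
      case True
      then show ?thesis using step[OF h(1,2) True h(4)] h(5) by (simp add: f_def)
    next
      case False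
      then show ?thesis using step[OF h(2,1) _ h(3), of j'] h(5) by (simp add: f_def)
    qed
  qed
  then have "card (f ` (H \<times> {..<p - 1})) = p * (p - 1)"
    by (simp add: card_image card_cartesian_product card_embeddings)
  moreover have "f ` (H \<times> {..<p - 1}) \<subseteq> L.primes_above q"
  proof
    fix Q assume "Q \<in> f ` (H \<times> {..<p - 1})"
    then obtain \<sigma> j where h: "\<sigma> \<in> H" "Q = \<sigma> ` (\<tau> ^^ j) ` P" by (auto simp: f_def)
    have t: "(\<tau> ^^ j) ` P \<in> L.primes" "(\<tau> ^^ j) ` P \<subseteq> L"
      using tau_pow_prime[OF P(1)] L.primesD(2) L.O_subset_L by blast+
    show "Q \<in> L.primes_above q"
      using L.field_aut_prime[OF HD(1)[OF h(1)] t(1)] L.field_aut_lies_above[OF HD(1)[OF h(1)] t(2)]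
        L.field_aut_lies_above[OF tau_pow_aut PL] q(2) h(2) by simp
  qed
  ultimately have "p * (p - 1) \<le> card (L.primes_above q)"
    using card_mono[OF L.card_primes_above(1)[OF q(1)]] by metis
  \<comment> \<open>The orbit gives at least \<open>p * (p - 1)\<close> primes, the degree allows at
    most \<open>nL\<close>; with this bound all three numbers are equal.\<close>
  moreover have "nL \<le> p * (p - 1)" using degree_L degree_K by simp
  ultimately show ?thesis using L.card_primes_above(2)[OF q(1)] by simp
qed

end

section \<open>Contraction of primes from \<open>L\<close> to \<open>K\<close>\<close>

lemma contraction:
  assumes P: "P \<in> L.primes_above q" and q: "q > 0"
  shows "P \<inter> K \<in> K.primes_above q"
proof -
  have p: "P \<in> L.primes" "lies_above P q" using P by auto
  note pd = L.primesD[OF p(1)]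
  have OKL: "integers_of K = integers_of L \<inter> K" using K_subset_L by (auto simp: integers_of_def)
  have "K.integral (P \<inter> K)"
  proof (rule K.integral_if[of _ "of_nat q"])
    show "P \<inter> K \<subseteq> integers_of K" using pd(2) OKL by blast
    show "of_nat q \<in> P \<inter> K" using L.of_nat_prime_mem[OF p(2)] by simp
    show "r * a \<in> P \<inter> K" if "r \<in> integers_of K" "a \<in> P \<inter> K" for r a
      using L.fractionalD(4)[OF pd(1), of r a] that OKL by auto
  qed (use q L.fractionalD(3)[OF pd(1)] in auto)
  moreover have "lies_above (P \<inter> K) q"
  proof -
    have "\<int> \<subseteq> K" by (auto elim!: Ints_cases)
    then have "P \<inter> K \<inter> \<int> = P \<inter> \<int>" by blast
    then show ?thesis using p(2) by (simp add: lies_above_def)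
  qed
  moreover have "a \<in> P \<inter> K \<or> b \<in> P \<inter> K"
    if "a \<in> integers_of K" "b \<in> integers_of K" "a * b \<in> P \<inter> K" for a b
    using pd(4)[of a b] that OKL by blast
  moreover have "1 \<notin> P \<inter> K" using pd(3) by blast
  ultimately show ?thesis unfolding K.in_primes_iff by blast
qed

text \<open>Otherwise some \<open>a\<close> lies in \<open>P'\<close> but in no conjugate of \<open>P\<close>, and the norm of \<open>a\<close> lies in
  \<open>P' \<inter> K\<close> but not in \<open>P\<close>.\<close>

lemma H_transitive:
  assumes P: "P \<in> L.primes" and P': "P' \<in> L.primes" and eq: "P \<inter> K = P' \<inter> K"
  obtains \<sigma> where "\<sigma> \<in> H" "P' = \<sigma> ` P"
proof (rule ccontr)
  assume n: "\<not> thesis"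
  let ?S = "(\<lambda>\<sigma>. \<sigma> ` P) ` H"
  have S: "finite ?S" "?S \<subseteq> L.primes" "?S \<noteq> {}"
    using finite_H L.field_aut_prime[OF HD(1) P] H_group(4) by auto
  have nS: "P' \<notin> ?S" using n that by blast
  obtain a where a: "a \<in> P'" "a \<noteq> 0" "\<And>Q. Q \<in> ?S \<Longrightarrow> L.val Q a = ideal_exponents L P' Q"
    using L.approximation[OF L.primesD(1)[OF P'] S] by blast
  have aO: "a \<in> integers_of L" using a(1) L.primesD(2)[OF P'] by blast
  then have aL: "a \<in> L" by (rule L.O_subset_L)
  \<comment> \<open>The prime \<open>P'\<close> is none of the conjugates of \<open>P\<close>, so
    its exponent at each of them is zero, and \<open>a\<close> was chosen to attain these
    exponents.\<close>
  have v0: "L.val (\<sigma> ` P) a = 0" if "\<sigma> \<in> H" for \<sigma>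
    using a(3)[of "\<sigma> ` P"] nS that by (auto simp: L.ideal_exponents_prime[OF P'])
  have vN: "L.val P (N a) = 0"
    unfolding val_N[OF aL a(2)]
  proof (rule sum.neutral, rule ballI)
    fix \<sigma> assume s: "\<sigma> \<in> H"
    obtain \<rho> where r: "\<rho> \<in> H" "compose L \<rho> \<sigma> = (\<lambda>a\<in>L. a)" using H_group(3)[OF s] by blast
    have "\<rho> (\<sigma> a) = a" using fun_cong[OF r(2), of a] aL by (simp add: compose_def)
    moreover have "L.val (\<rho> ` P) (\<rho> (\<sigma> a)) = L.val P (\<sigma> a)"
      using L.val_field_aut[OF HD(1)[OF r(1)] P] L.field_autD(5,10)[OF HD(1)[OF s] aL] a(2) by simp
    ultimately show "L.val P (\<sigma> a) = 0" using v0[OF r(1)] by simp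
  qed
  have "N a \<in> P'"
  proof -
    \<comment> \<open>Splitting off the identity shows that the norm is a multiple of
      \<open>a\<close> within \<open>\<O>\<close>.\<close>
    have "N a = (\<lambda>a\<in>L. a) a * (\<Prod>\<sigma>\<in>H - {\<lambda>a\<in>L. a}. \<sigma> a)"
      unfolding field_norm_def using prod.remove[OF finite_H H_group(4), of "\<lambda>\<sigma>. \<sigma> a"] .
    also have "\<dots> = (\<Prod>\<sigma>\<in>H - {\<lambda>a\<in>L. a}. \<sigma> a) * a" using aL by simp
    also have "\<dots> \<in> P'"
      by (rule L.fractionalD(4)[OF L.primesD(1)[OF P'] L.O_prod a(1)])
        (use L.field_aut_O[OF HD(1)] aO in blast)
    finally show ?thesis .
  qed
  then have "N a \<in> P" using N_closed(2)[OF aL] eq by blast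
  then show False
    using L.mem_prime_iff[OF P, of "N a"] vN L.primesD(2)[OF P] N_closed(3)[OF aL a(2)] by auto
qed

text \<open>A fibre of contraction lies in one orbit of \<open>H\<close> and has at most
  \<open>p\<close> members, so the \<open>p * nK\<close> primes of \<open>L\<close> have at least
  \<open>nK\<close> contractions. As \<open>K\<close> has at most \<open>nK\<close> primes above
  \<open>q\<close>, every one of them is hit.\<close>

lemma contraction_surj:
  assumes q: "Factorial_Ring.prime q" and n: "card (L.primes_above q) = nL"
  shows "card (K.primes_above q) = nK" "(\<lambda>P. P \<inter> K) ` L.primes_above q = K.primes_above q"
proof -
  have q0: "q > 0" using q prime_gt_0_nat by blast
  let ?A = "L.primes_above q" and ?B = "K.primes_above q" and ?c = "\<lambda>P. P \<inter> K"
  note fA = L.card_primes_above(1)[OF q] and fB = K.card_primes_above[OF q]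
  have sub: "?c ` ?A \<subseteq> ?B" using contraction[OF _ q0] by blast
  have fib: "card {P \<in> ?A. ?c P = R} \<le> p" if R: "R \<in> ?c ` ?A" for R
  proof -
    obtain P where P: "P \<in> ?A" "R = P \<inter> K" using R by blast
    have "{P' \<in> ?A. ?c P' = R} \<subseteq> (\<lambda>\<sigma>. \<sigma> ` P) ` H"
    proof
      fix P' assume "P' \<in> {P' \<in> ?A. ?c P' = R}"
      then obtain \<sigma> where "\<sigma> \<in> H" "P' = \<sigma> ` P" using H_transitive[of P P'] P by auto
      then show "P' \<in> (\<lambda>\<sigma>. \<sigma> ` P) ` H" by blast
    qed
    then have "card {P' \<in> ?A. ?c P' = R} \<le> card ((\<lambda>\<sigma>. \<sigma> ` P) ` H)"
      by (rule card_mono[rotated]) (use finite_H in simp)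
    also have "\<dots> \<le> p" using card_image_le[OF finite_H] card_embeddings by metis
    finally show ?thesis .
  qed
  have "nL = (\<Sum>R\<in>?c ` ?A. card {P \<in> ?A. ?c P = R})"
    using sum.image_gen[OF fA, of "\<lambda>_. 1::nat" ?c] n by simp
  also have "\<dots> \<le> (\<Sum>R\<in>?c ` ?A. p)" by (rule sum_mono[OF fib])
  also have "\<dots> = p * card (?c ` ?A)" by simp
  finally have "nK \<le> card (?c ` ?A)" using degree_L p_gt_2 by simp
  moreover have "card (?c ` ?A) \<le> card ?B" by (rule card_mono[OF fB(1) sub])
  ultimately show c: "card ?B = nK" using fB(2) by simp
  show "?c ` ?A = ?B"
    by (rule card_subset_eq[OF fB(1) sub]) (use c \<open>nK \<le> card (?c ` ?A)\<close> \<open>card (?c ` ?A) \<le> card ?B\<close> in simp)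
qed

text \<open>The prime number \<open>q\<close> is a uniformizer both at \<open>P\<close> and at \<open>P \<inter> K\<close>.\<close>

lemma val_contraction:
  assumes q: "Factorial_Ring.prime q" and n: "card (L.primes_above q) = nL"
    and P: "P \<in> L.primes_above q" and a: "a \<in> K" "a \<noteq> 0"
  shows "K.val (P \<inter> K) a = L.val P a"
proof -
  have q0: "q > 0" using q prime_gt_0_nat by blast
  have PK: "P \<inter> K \<in> K.primes_above q" by (rule contraction[OF P q0])
  have vL: "L.val P (of_nat q) = 1" by (rule L.val_unramified[OF q n P])
  have vK: "K.val (P \<inter> K) (of_nat q) = 1" by (rule K.val_unramified[OF q contraction_surj(1)[OF q n] PK])
  define k where "k = K.val (P \<inter> K) a"
  \<comment> \<open>The negative and positive parts of \<open>k\<close>, so that \<open>a\<close>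
    divided by the \<open>k\<close>-th power of \<open>q\<close> is written with natural exponents;
    the quotient \<open>b\<close> has valuation zero in \<open>K\<close>.\<close>
  define m l where "m = nat (- k)" and "l = nat k"
  define b where "b = a * of_nat q ^ m / of_nat q ^ l"
  have qn: "of_nat q ^ j \<noteq> (0::complex)" for j using q0 by simp
  have bK: "b \<in> K" "b \<noteq> 0" using a qn by (auto simp: b_def)
  have ab: "b * of_nat q ^ l = a * of_nat q ^ m" using qn by (simp add: b_def)
  have K: "K.val (P \<inter> K) b + int l = k + int m"
    using arg_cong[OF ab, of "K.val (P \<inter> K)"] bK a qn vK by (simp add: K.val_mult K.val_power k_def q0)
  moreover have "int l = k + int m" by (simp add: m_def l_def)
  ultimately have b0: "K.val (P \<inter> K) b = 0" by linarith
  \<comment> \<open>A quotient of two integers of \<open>K\<close> outside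
    \<open>P \<inter> K\<close> is also a quotient of two integers of \<open>L\<close> outside
    \<open>P\<close>, so valuation zero passes from \<open>K\<close> to \<open>L\<close>.\<close>
  obtain c d where cd: "c \<in> integers_of K" "d \<in> integers_of K" "c \<notin> P \<inter> K" "d \<notin> P \<inter> K" "d * b = c"
    using K.val_zero_quotient[OF _ bK b0] PK by blast
  have cdL: "c \<in> integers_of L" "d \<in> integers_of L" "c \<in> K" "d \<in> K"
    using cd K_subset_L by (auto simp: integers_of_def)
  have "0 \<in> P" using L.fractionalD(2) L.primesD(1) P by blast
  then have nz: "c \<noteq> 0" "d \<noteq> 0" using cd(3,4) by auto
  have "L.val P c = 0" "L.val P d = 0"
    using L.mem_prime_iff[of P] L.val_nonneg[of _ P] cdL nz cd(3,4) P by force+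
  moreover have "L.val P c = L.val P d + L.val P b"
    unfolding cd(5)[symmetric] by (rule L.val_mult) (use cdL nz bK K_subset_L in auto)
  ultimately have "L.val P b = 0" by simp
  moreover have "L.val P b + int l = L.val P a + int m"
    using arg_cong[OF ab, of "L.val P"] bK a qn vL K_subset_L by (simp add: L.val_mult L.val_power q0 subset_iff)
  ultimately show ?thesis using K b0 by (simp add: k_def)
qed

section \<open>The ideal norm and \<open>\<chi>\<close> at a completely split prime number\<close>

context
  fixes x :: complex and q :: nat
  assumes x: "x \<in> L" "x \<noteq> 0" and q: "Factorial_Ring.prime q" and split: "card (L.primes_above q) = nL"
begin

abbreviation J :: "complex set" where "J \<equiv> ideal_part L q (principal_ideal L x)"

abbreviation I :: "complex set" where "I \<equiv> ideal_norm K L J"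

lemma J_exponents:
  shows "L.fractional J" "ideal_exponents L J P = (if P \<in> L.primes_above q then L.val P x else 0)"
proof -
  define v where "v P = (if P \<in> L.primes_above q then L.val P x else 0)" for P
  have v: "v \<in> L.exponent_functions"
    using L.exponent_functions_finite[OF L.card_primes_above(1)[OF q], of "\<lambda>P. L.val P x"] by (auto simp: v_def[abs_def])
  have "J = finprod (ideal_group L) (\<lambda>P. P [^]\<^bsub>ideal_group L\<^esub> v P) (L.primes_above q)"
    unfolding ideal_part_def
  proof (rule L.G.finprod_cong')
    show "(\<lambda>P. P [^]\<^bsub>ideal_group L\<^esub> v P) \<in> L.primes_above q \<rightarrow> carrier (ideal_group L)"
      using L.prime_in_carrier by (blast intro: L.G.int_pow_closed)
  qed (simp_all add: v_def L.val_def)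
  also have "\<dots> = L.ideal_of v"
    by (rule L.ideal_of_eq[symmetric, OF L.card_primes_above(1)[OF q]]) (auto simp: v_def)
  finally have J: "J = L.ideal_of v" .
  show "L.fractional J" unfolding J by (rule L.fractional_ideal_of[OF v])
  show "ideal_exponents L J P = (if P \<in> L.primes_above q then L.val P x else 0)"
    unfolding J L.ideal_exponents_ideal_of[OF v] by (simp add: v_def)
qed

lemma preimage_above:
  assumes "\<sigma> \<in> H" "P \<in> L.primes_above q"
  obtains Q where "Q \<in> L.primes_above q" "\<sigma> ` Q = P"
proof -
  obtain Q where Q: "Q \<in> L.primes" "\<sigma> ` Q = P"
    using L.field_aut_prime_preimage[OF HD(1)[OF assms(1)]] assms(2) by blast
  then have "Q \<subseteq> L" using L.primesD(2) L.O_subset_L by blast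
  then show thesis using that Q L.field_aut_lies_above[OF HD(1)[OF assms(1)], of Q q] assms(2) by blast
qed

text \<open>The exponent of a norm at \<open>P\<close> is a sum of exponents at conjugates of
  \<open>P\<close>, all of which lie above \<open>q\<close>. At exactly these primes
  \<open>J\<close> prescribes the valuations of \<open>x\<close> as lower bounds, with equality in
  the sum when all bounds are attained.\<close>

lemma val_N_ge:
  assumes P: "P \<in> L.primes_above q" and a: "a \<in> J" "a \<noteq> 0"
  shows "L.val P (N x) \<le> L.val P (N a)"
    and "(\<And>Q. Q \<in> L.primes_above q \<Longrightarrow> L.val Q a = L.val Q x) \<Longrightarrow> L.val P (N a) = L.val P (N x)"
proof -
  have aL: "a \<in> L" using L.fractionalD(1)[OF J_exponents(1)] a(1) by blast
  have ge: "L.val Q x \<le> L.val Q a" if "Q \<in> L.primes_above q" for Q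
    using L.mem_iff_val[OF J_exponents(1) aL a(2)] a(1) J_exponents(2)[of Q] that by metis
  have pre: "\<exists>Q\<in>L.primes_above q. L.val P (\<sigma> x) = L.val Q x \<and> L.val P (\<sigma> a) = L.val Q a" if s: "\<sigma> \<in> H" for \<sigma>
  proof -
    obtain Q where Q: "Q \<in> L.primes_above q" "\<sigma> ` Q = P" using preimage_above[OF s P] .
    then show ?thesis
      using L.val_field_aut[OF HD(1)[OF s], of Q x] L.val_field_aut[OF HD(1)[OF s], of Q a] x aL a(2) by auto
  qed
  show "L.val P (N x) \<le> L.val P (N a)"
    unfolding val_N[OF x] val_N[OF aL a(2)] by (rule sum_mono) (use pre ge in fastforce)
  show "L.val P (N a) = L.val P (N x)" if "\<And>Q. Q \<in> L.primes_above q \<Longrightarrow> L.val Q a = L.val Q x"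
    unfolding val_N[OF x] val_N[OF aL a(2)] by (rule sum.cong) (use pre that in fastforce)+
qed

text \<open>A denominator \<open>d\<close> of \<open>J\<close> gives the denominator
  \<open>N d\<close> of the ideal norm, because \<open>N d * N b = N (d * b)\<close> is the norm of
  an algebraic integer.\<close>

lemma fractional_I: "K.fractional I"
proof -
  note J = L.fractionalD[OF J_exponents(1)]
  have NJ: "N a \<in> I" if "a \<in> J" for a
    unfolding ideal_norm_def using ideal_prod_mult[of 1 "integers_of K" "N a" "N ` J"] that by simp
  have sub: "I \<subseteq> K" unfolding ideal_norm_def
    by (rule ideal_prod_subset) (use J(1) N_closed(2) K.O_subset_L in auto)
  obtain a where a: "a \<in> J" "a \<noteq> 0" using J(7) by blast
  then have "N a \<noteq> 0" "N a \<in> I" using N_closed(3) J(1) NJ by auto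
  moreover have "0 \<in> I" using NJ[OF J(2)] N_closed(5)[of 0] by simp
  moreover have "r * s \<in> I" if r: "r \<in> integers_of K" and s: "s \<in> I" for r s
    using s unfolding ideal_norm_def
  proof (induction rule: ideal_prod.induct)
    case (prod i j)
    then show ?case using ideal_prod_mult[of "r * i" "integers_of K" j "N ` J"] r by (simp add: mult.assoc)
  qed (simp add: distrib_left ideal_prod_add)
  moreover obtain d where d: "d \<in> integers_of L" "d \<noteq> 0" "\<And>a. a \<in> J \<Longrightarrow> d * a \<in> integers_of L"
    using J(8) by blast
  have dL: "d \<in> L" using d(1) L.O_subset_L by blast
  have "N d * s \<in> integers_of K" if "s \<in> I" for s
    using that unfolding ideal_norm_def
  proof (induction rule: ideal_prod.induct)
    case (prod i j)
    then obtain b where b: "b \<in> J" "j = N b" by blast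
    then have bL: "b \<in> L" using J(1) by blast
    have "N d * N b = N (d * b)" using N_mult[OF dL bL] by simp
    also have "\<dots> \<in> integers_of K" by (rule N_closed(4)) (use dL bL d(3)[OF b(1)] in auto)
    finally have "i * (N d * N b) \<in> integers_of K" using prod(1) by simp
    then show ?case using b(2) by (simp add: mult_ac)
  qed (simp add: distrib_left)
  moreover have "N d \<in> integers_of K" "N d \<noteq> 0" using N_closed(3,4)[OF dL] d by auto
  ultimately show ?thesis
    using sub ideal_prod_add[of _ "integers_of K" "N ` J"] unfolding fractional_ideal_def
    by (intro conjI ballI bexI[of _ "N d"]) (auto simp: ideal_norm_def)
qed

text \<open>An element of \<open>J\<close> that attains the exponents of \<open>J\<close> at all
  primes above \<open>q\<close> has a norm with the claimed valuation, which bounds the exponent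
  from above. Conversely all generators have at least this valuation, hence so do their
  combinations, in particular one that attains the exponent of \<open>I\<close>.\<close>

lemma norm_exponent:
  assumes P: "P \<in> L.primes_above q"
  shows "ideal_exponents K I (P \<inter> K) = L.val P (N x)"
proof (rule antisym)
  have q0: "q > 0" using q prime_gt_0_nat by blast
  have PK: "P \<inter> K \<in> K.primes" using contraction[OF P q0] by blast
  note v = val_contraction[OF q split P]
  have fin: "finite (L.primes_above q)" by (rule L.card_primes_above(1)[OF q])
  obtain a where a: "a \<in> J" "a \<noteq> 0" "\<And>Q. Q \<in> L.primes_above q \<Longrightarrow> L.val Q a = ideal_exponents L J Q"
    using L.approximation[OF J_exponents(1) fin] P by blast
  have aL: "a \<in> L" using L.fractionalD(1)[OF J_exponents(1)] a(1) by blast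
  have vN: "L.val P (N a) = L.val P (N x)"
    by (rule val_N_ge(2)[OF P a(1,2)]) (use a(3) J_exponents(2) in simp)
  have NaI: "N a \<in> I"
    unfolding ideal_norm_def using ideal_prod_mult[of 1 "integers_of K" "N a" "N ` J"] a(1) by simp
  have Na: "N a \<in> K" "N a \<noteq> 0" using N_closed[OF aL] a(2) by auto
  show "ideal_exponents K I (P \<inter> K) \<le> L.val P (N x)"
    using K.mem_iff_val[OF fractional_I Na] NaI unfolding vN[symmetric] v[OF Na, symmetric] by blast
  obtain b where b: "b \<in> I" "b \<noteq> 0" "K.val (P \<inter> K) b = ideal_exponents K I (P \<inter> K)"
    using K.approximation[OF fractional_I, of "{P \<inter> K}"] PK by auto
  have "K.val_ge (P \<inter> K) (L.val P (N x)) b"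
    using b(1) unfolding ideal_norm_def
  proof (induction rule: ideal_prod.induct)
    case (prod i j)
    then obtain c where c: "c \<in> J" "j = N c" by blast
    have cL: "c \<in> L" using L.fractionalD(1)[OF J_exponents(1)] c(1) by blast
    have "K.val_ge (P \<inter> K) (L.val P (N x)) j"
    proof (cases "c = 0")
      case True
      then show ?thesis using N_closed(5)[OF cL] c(2) by (simp add: K.val_ge_def)
    next
      case False
      have n: "N c \<in> K" "N c \<noteq> 0" using N_closed[OF cL] False by auto
      show ?thesis using val_N_ge(1)[OF P c(1) False] v[OF n] n c(2) by (simp add: K.val_ge_def)
    qed
    then show ?case using K.val_ge_mult[of i] prod(1) by simp
  next
    case (sum s t)
    then show ?case using K.val_ge_add by simp
  qed
  then show "L.val P (N x) \<le> ideal_exponents K I (P \<inter> K)" using b(2,3) by (simp add: K.val_ge_def)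
qed

lemma chi_eq:
  assumes num: "cyclic_numbering p K (restrict \<tau> K) q R" and Q: "Q \<in> L.primes_above q" "Q \<inter> K = R 1"
  shows "chi p e K R I = L.val Q (\<Phi> (N x))" "j < p - 1 \<Longrightarrow> R (Suc j) = (\<tau> ^^ j) ` Q \<inter> K"
proof -
  have QL: "Q \<subseteq> L" using Q L.primesD(2) L.O_subset_L by blast
  have above: "(\<tau> ^^ j) ` Q \<in> L.primes_above q" for j
    using tau_pow_prime Q L.field_aut_lies_above[OF tau_pow_aut QL] by simp
  have Rj: "R (Suc j) = (\<tau> ^^ j) ` Q \<inter> K" if "j < p - 1" for j
    using that
  proof (induction j)
    case 0
    then show ?case using Q(2) by simp
  next
    case (Suc j)
    have jL: "(\<tau> ^^ j) ` Q \<subseteq> L" using above[of j] L.primesD(2) L.O_subset_L by blast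
    have "R (Suc (Suc j)) = restrict \<tau> K ` R (Suc j)"
      using num Suc.prems by (simp add: cyclic_numbering_def)
    also have "\<dots> = \<tau> ` ((\<tau> ^^ j) ` Q \<inter> K)" using Suc by auto
    also have "\<dots> = \<tau> ` (\<tau> ^^ j) ` Q \<inter> \<tau> ` K"
      using inj_on_image_Int[OF L.field_autD(9)[OF tau_aut] jL K_subset_L] .
    finally show ?case by (simp add: tau_K image_comp)
  qed
  then show "j < p - 1 \<Longrightarrow> R (Suc j) = (\<tau> ^^ j) ` Q \<inter> K" .
  define y where "y = N x"
  have y: "y \<in> L" "y \<noteq> 0" unfolding y_def using N_closed[OF x(1)] x(2) by auto
  have ex: "ideal_exponents K I (R (Suc j)) = L.val ((\<tau> ^^ j) ` Q) y" if "j < p - 1" for j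
    unfolding Rj[OF that] y_def by (rule norm_exponent[OF above])
  have vt: "L.val Q ((\<tau> ^^ j) y) = L.val ((\<tau> ^^ (p - 1 - j)) ` Q) y" if "j < p - 1" for j
  proof -
    let ?k = "p - 1 - j"
    have "(\<tau> ^^ j) ` (\<tau> ^^ ?k) ` Q = (\<tau> ^^ (p - 1)) ` Q"
      using that by (simp add: image_comp flip: funpow_add)
    also have "\<dots> = (\<lambda>a. a) ` Q" by (rule image_cong) (use tau_order QL in auto)
    finally have "(\<tau> ^^ j) ` (\<tau> ^^ ?k) ` Q = Q" by simp
    then show ?thesis using L.val_field_aut[OF tau_pow_aut, of "(\<tau> ^^ ?k) ` Q" y j] above[of ?k] y by simp
  qed
  \<comment> \<open>\<open>p\<close> is at least 3, so the term with \<open>j = 0\<close> can be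
    split off and the remaining \<open>m + 1\<close> terms reversed.\<close>
  define m where "m = p - 3"
  have m: "p - 2 = Suc m" "p - 1 = Suc (Suc m)" using p_gt_2 by (simp_all add: m_def)
  have "L.val Q (\<Phi> y) = (\<Sum>j\<le>Suc m. int e ^ (Suc m - j) * L.val Q ((\<tau> ^^ j) y))"
    using val_Phi[OF y, of Q] unfolding m by (simp add: atLeast0AtMost)
  also have "\<dots> = int e ^ Suc m * L.val Q y + (\<Sum>j\<le>m. int e ^ (m - j) * L.val Q ((\<tau> ^^ Suc j) y))"
    by (subst sum.atMost_Suc_shift) simp
  also have "(\<Sum>j\<le>m. int e ^ (m - j) * L.val Q ((\<tau> ^^ Suc j) y)) =
    (\<Sum>j\<le>m. int e ^ (m - j) * L.val ((\<tau> ^^ Suc (m - j)) ` Q) y)"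
  proof (rule sum.cong)
    fix j assume "j \<in> {..m}"
    then have "Suc j < p - 1" "p - 1 - Suc j = Suc (m - j)" using m by auto
    then show "int e ^ (m - j) * L.val Q ((\<tau> ^^ Suc j) y) = int e ^ (m - j) * L.val ((\<tau> ^^ Suc (m - j)) ` Q) y"
      using vt[of "Suc j"] by (simp del: funpow.simps)
  qed simp
  also have "\<dots> = (\<Sum>j\<le>m. int e ^ j * L.val ((\<tau> ^^ Suc j) ` Q) y)"
    using sum.nat_diff_reindex[of "\<lambda>j. int e ^ j * L.val ((\<tau> ^^ Suc j) ` Q) y" "Suc m"]
    by (simp add: lessThan_Suc_atMost del: funpow.simps)
  also have "\<dots> = (\<Sum>j\<le>m. int e ^ j * ideal_exponents K I (R (j + 2)))"
    by (rule sum.cong) (use ex m in \<open>simp_all del: funpow.simps\<close>)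
  also have "\<dots> = (\<Sum>j=2..p - 1. int e ^ (j - 2) * ideal_exponents K I (R j))"
    by (rule sum.reindex_bij_witness[of _ "\<lambda>j. j - 2" "\<lambda>j. j + 2"]) (use m in auto)
  finally show "chi p e K R I = L.val Q (\<Phi> (N x))"
    using ex[of 0] m by (simp add: chi_def y_def)
qed

end

text \<open>The primes above a completely split \<open>q i\<close> form one orbit under
  \<open>H\<close> and the powers of \<open>\<tau>\<close>, along which divisibility of the exponent
  by \<open>p\<close> does not change. \<open>chi\<close> is the exponent at one of them and so
  decides for all.\<close>

theorem not_power_iff:
  fixes q :: "nat \<Rightarrow> nat" and R :: "nat \<Rightarrow> nat \<Rightarrow> complex set"
  assumes x: "x \<in> L" "x \<noteq> 0" and q: "\<And>i. i \<in> A \<Longrightarrow> Factorial_Ring.prime (q i)"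
    and supp: "\<And>Q. Q \<in> prime_ideals L \<Longrightarrow> ideal_exponents L (principal_ideal L x) Q \<noteq> 0 \<Longrightarrow>
           \<exists>i\<in>A. lies_above Q (q i)"
    and num: "\<And>i. i \<in> A \<Longrightarrow> splits_completely K (q i) \<Longrightarrow> cyclic_numbering p K (restrict \<tau> K) (q i) (R i)"
  shows "\<not> (\<exists>I\<in>carrier (ideal_group L). principal_ideal L (\<Phi> (N x)) = I [^]\<^bsub>ideal_group L\<^esub> p) \<longleftrightarrow>
    (\<exists>i\<in>A. splits_completely L (q i) \<and>
       \<not> int p dvd chi p e K (R i) (ideal_norm K L (ideal_part L (q i) (principal_ideal L x))))"
proof -
  have y: "N x \<in> L" "N x \<noteq> 0" using N_closed[OF x(1)] x(2) by auto
  have f: "L.fractional (principal_ideal L (\<Phi> (N x)))"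
    by (rule L.fractional_principal) (use Phi_closed[OF y(1)] y(2) in auto)
  have p0: "p > 0" using p_gt_2 by simp
  have lhs: "\<not> (\<exists>I\<in>carrier (ideal_group L). principal_ideal L (\<Phi> (N x)) = I [^]\<^bsub>ideal_group L\<^esub> p) \<longleftrightarrow>
    (\<exists>P\<in>L.primes. \<not> int p dvd L.val P (\<Phi> (N x)))"
    unfolding L.is_power_iff[OF f p0] L.val_def by blast
  have splitL: "splits_completely L (q i) \<longleftrightarrow> card (L.primes_above (q i)) = nL" for i
    unfolding splits_completely_def
    using CC.dimension_is_inj[OF subfield_Rats L.dimension] L.dimension by blast
  have splitK: "splits_completely K (q i)" if "card (K.primes_above (q i)) = nK" for i
    unfolding splits_completely_def using K.dimension that by simp
  have key: "\<exists>Q\<in>L.primes_above (q i). chi p e K (R i) (ideal_norm K L (ideal_part L (q i) (principal_ideal L x)))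
      = L.val Q (\<Phi> (N x)) \<and> (\<forall>P\<in>L.primes_above (q i). \<exists>\<sigma>\<in>H. \<exists>j. P = \<sigma> ` (\<tau> ^^ j) ` Q)"
    if i: "i \<in> A" and s: "card (L.primes_above (q i)) = nL" for i
  proof -
    note c = contraction_surj[OF q[OF i] s]
    \<comment> \<open>A numbering is supplied only where \<open>q i\<close> splits completely in
      \<open>K\<close>; contraction derives this from the count in \<open>L\<close>.\<close>
    have nm: "cyclic_numbering p K (restrict \<tau> K) (q i) (R i)" by (rule num[OF i splitK[OF c(1)]])
    then have bij: "bij_betw (R i) {1..p - 1} (K.primes_above (q i))" by (simp add: cyclic_numbering_def)
    then have "R i 1 \<in> K.primes_above (q i)" using p_gt_2 bij_betwE[OF bij] by auto
    then have "R i 1 \<in> (\<lambda>P. P \<inter> K) ` L.primes_above (q i)" unfolding c(2) .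
    then obtain Q where Q: "Q \<in> L.primes_above (q i)" "R i 1 = Q \<inter> K" by (rule imageE)
    note chi = chi_eq[OF x q[OF i] s nm Q(1) Q(2)[symmetric]]
    \<comment> \<open>Two moves reach \<open>P\<close> from \<open>Q\<close>: by the numbering a
      power of \<open>\<tau>\<close> leads to a prime with the same contraction as \<open>P\<close>,
      and \<open>H\<close> acts transitively on the primes with a given contraction.\<close>
    have "\<exists>\<sigma>\<in>H. \<exists>j. P = \<sigma> ` (\<tau> ^^ j) ` Q" if P: "P \<in> L.primes_above (q i)" for P
    proof -
      have "P \<inter> K \<in> (\<lambda>P. P \<inter> K) ` L.primes_above (q i)" using P by (rule imageI)
      then have "P \<inter> K \<in> R i ` {1..p - 1}" unfolding c(2) using bij by (simp add: bij_betw_def)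
      then obtain k where k: "k \<in> {1..p - 1}" "P \<inter> K = R i k" by (elim imageE)
      then have "k - 1 < p - 1" "Suc (k - 1) = k" by auto
      then have e: "(\<tau> ^^ (k - 1)) ` Q \<inter> K = P \<inter> K" using chi(2)[of "k - 1"] k(2) by simp
      have Qp: "Q \<in> L.primes" and Pp: "P \<in> L.primes" using Q(1) P by auto
      obtain \<sigma> where "\<sigma> \<in> H" "P = \<sigma> ` (\<tau> ^^ (k - 1)) ` Q"
        by (rule H_transitive[OF tau_pow_prime[OF Qp] Pp e])
      then show ?thesis by blast
    qed
    then show ?thesis using Q(1) chi(1) by blast
  qed
  show ?thesis
    unfolding lhs
  proof
    assume "\<exists>P\<in>L.primes. \<not> int p dvd L.val P (\<Phi> (N x))"
    then obtain P where P: "P \<in> L.primes" "\<not> int p dvd L.val P (\<Phi> (N x))" by blast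
    \<comment> \<open>A nonzero exponent in \<open>\<Phi> (N x)\<close> is traced back through some
      \<open>\<tau> ^^ j\<close> and some \<open>\<sigma>\<close> to a prime \<open>T\<close> at
      which \<open>x\<close> itself has nonzero exponent. The support hypothesis names the prime
      number below \<open>T\<close>, and automorphisms do not change it.\<close>
    have "\<exists>j. L.val P ((\<tau> ^^ j) (N x)) \<noteq> 0"
    proof (rule ccontr)
      assume "\<not> ?thesis"
      then have "L.val P (\<Phi> (N x)) = 0" unfolding val_Phi[OF y] by simp
      then show False using P(2) by simp
    qed
    then obtain j where j: "L.val P ((\<tau> ^^ j) (N x)) \<noteq> 0" by blast
    obtain Q where Q: "Q \<in> L.primes" "(\<tau> ^^ j) ` Q = P"
      using L.field_aut_prime_preimage[OF tau_pow_aut P(1)] by blast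
    have "L.val Q (N x) \<noteq> 0" using L.val_field_aut[OF tau_pow_aut Q(1) y, of j] Q(2) j by simp
    then obtain \<sigma> where s: "\<sigma> \<in> H" "L.val Q (\<sigma> x) \<noteq> 0"
      unfolding val_N[OF x] by (metis sum.neutral)
    obtain T where T: "T \<in> L.primes" "\<sigma> ` T = Q"
      using L.field_aut_prime_preimage[OF HD(1)[OF s(1)] Q(1)] by blast
    have "L.val T x \<noteq> 0" using L.val_field_aut[OF HD(1)[OF s(1)] T(1) x] T(2) s(2) by simp
    then obtain i where i: "i \<in> A" "lies_above T (q i)" using supp[OF T(1)] unfolding L.val_def by blast
    have TL: "T \<subseteq> L" "Q \<subseteq> L" using L.primesD(2)[OF T(1)] L.primesD(2)[OF Q(1)] L.O_subset_L by auto
    have "lies_above Q (q i)" using L.field_aut_lies_above[OF HD(1)[OF s(1)] TL(1)] T(2) i(2) by simp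
    then have Pq: "lies_above P (q i)" using L.field_aut_lies_above[OF tau_pow_aut TL(2), of j] Q(2) by simp
    have sp: "card (L.primes_above (q i)) = nL" by (rule splits_if_not_dvd[OF x P q[OF i(1)] Pq])
    obtain S where S: "S \<in> L.primes_above (q i)"
      "chi p e K (R i) (ideal_norm K L (ideal_part L (q i) (principal_ideal L x))) = L.val S (\<Phi> (N x))"
      "\<forall>P\<in>L.primes_above (q i). \<exists>\<sigma>\<in>H. \<exists>j. P = \<sigma> ` (\<tau> ^^ j) ` S"
      using key[OF i(1) sp] by blast
    have "P \<in> L.primes_above (q i)" using P(1) Pq by simp
    from bspec[OF S(3) this] obtain \<rho> k where r: "\<rho> \<in> H" "P = \<rho> ` (\<tau> ^^ k) ` S"
      by (elim bexE exE)
    have "L.val P (\<Phi> (N x)) = L.val ((\<tau> ^^ k) ` S) (\<Phi> (N x))"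
      unfolding r(2) by (rule V_H[OF x r(1) tau_pow_prime]) (use S(1) in blast)
    then have "\<not> int p dvd L.val S (\<Phi> (N x))"
      using val_Phi_tau_pow_dvd[of S "N x" k] S(1) y P(2) by simp
    then show "\<exists>i\<in>A. splits_completely L (q i) \<and>
       \<not> int p dvd chi p e K (R i) (ideal_norm K L (ideal_part L (q i) (principal_ideal L x)))"
      using i(1) sp splitL S(2) by auto
  next
    assume "\<exists>i\<in>A. splits_completely L (q i) \<and>
       \<not> int p dvd chi p e K (R i) (ideal_norm K L (ideal_part L (q i) (principal_ideal L x)))"
    then obtain i where i: "i \<in> A" "card (L.primes_above (q i)) = nL"
       "\<not> int p dvd chi p e K (R i) (ideal_norm K L (ideal_part L (q i) (principal_ideal L x)))"
      using splitL by blast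
    then show "\<exists>P\<in>L.primes. \<not> int p dvd L.val P (\<Phi> (N x))" using key[OF i(1,2)] by auto
  qed
qed

end

section \<open>The compositum with the cyclotomic field\<close>

lemma generate_field_CC:
  shows "subfield (generate_field CC A) CC" "A \<subseteq> generate_field CC A"
    "subfield E CC \<Longrightarrow> A \<subseteq> E \<Longrightarrow> generate_field CC A \<subseteq> E"
  using field.generate_fieldE[OF field_CC, of A "generate_field CC A"] by auto

lemma Rats_subset_subfield: "subfield E CC \<Longrightarrow> \<rat> \<subseteq> E"
  using complex_subfield.Rats_subset_L complex_subfield.intro by blast

text \<open>A basis over \<open>k\<close> still spans over \<open>E\<close>, which gives some finite
  dimension; its value is found afterwards from multiplicativity of degrees.\<close>

lemma dimension_over_intermediate:
  assumes k: "subfield k CC" and E: "subfield E CC" and F: "subfield F CC" and sub: "k \<subseteq> E" "E \<subseteq> F"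
    and dim: "CC.dimension n k F"
  obtains m where "CC.dimension m E F"
proof -
  obtain Us where Us: "CC.independent k Us" "length Us = n" "CC.Span k Us = F"
    using CC.exists_base[OF k dim] by blast
  interpret F: complex_subfield F by (rule complex_subfield.intro[OF F])
  have UF: "set Us \<subseteq> F" using CC.Span_base_incl[OF k, of Us] Us(3) by simp
  have "CC.Span E Us = F"
  proof
    show "CC.Span E Us \<subseteq> F"
    proof
      fix a assume "a \<in> CC.Span E Us"
      then obtain Ks where Ks: "set Ks \<subseteq> E" "length Ks = length Us" "a = CC.combine Ks Us"
        using CC.Span_mem_iff_length_version[OF E, of Us a] by auto
      have "Ks ! i \<in> F" "Us ! i \<in> F" if "i < length Us" for i
      proof -
        have "Ks ! i \<in> set Ks" "Us ! i \<in> set Us" using Ks(2) that by simp_all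
        then show "Ks ! i \<in> F" "Us ! i \<in> F" using Ks(1) UF sub(2) by blast+
      qed
      then show "a \<in> F" unfolding Ks(3) combine_CC_eq_sum[OF Ks(2)] by (intro F.L_sum F.L_closed(4)) auto
    qed
    show "F \<subseteq> CC.Span E Us"
    proof
      fix a assume "a \<in> F"
      then obtain Ks where "set Ks \<subseteq> k" "length Ks = length Us" "a = CC.combine Ks Us"
        using CC.Span_mem_iff_length_version[OF k, of Us a] Us(3) by auto
      then show "a \<in> CC.Span E Us"
        using CC.Span_mem_iff_length_version[OF E, of Us a] sub(1) by auto
    qed
  qed
  moreover have "CC.finite_dimension E (CC.Span E Us)" by (rule CC.Span_finite_dimension[OF E]) simp
  ultimately show thesis using that unfolding CC.finite_dimension_def by auto
qed

lemma algebraic_over_Rats: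
  assumes L: "number_field L n" and a: "\<theta> \<in> L"
  obtains f where "f \<in> complex_subfield.polys \<rat>" "f \<noteq> 0" "poly f \<theta> = 0"
proof -
  interpret L: number_field L n by (rule L)
  interpret Q: complex_subfield \<rat> by (rule complex_subfield.intro[OF subfield_Rats])
  obtain m where m: "m > 0" "of_nat m * \<theta> \<in> integers_of L" using L.integral_multiple[OF a] .
  then have "algebraic_int (of_nat m * \<theta>)" by (simp add: integers_of_def)
  then obtain k c where k: "k > 0" "(of_nat m * \<theta>) ^ k = (\<Sum>i<k. of_int (c i) * (of_nat m * \<theta>) ^ i)"
    by (rule algebraic_int_power_relation)
  define f where "f = Polynomial.monom (of_nat m ^ k) k - (\<Sum>i<k. Polynomial.monom (of_int (c i) * of_nat m ^ i) i :: complex poly)"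
  have "f \<in> Q.polys" unfolding f_def
    by (intro Q.polys_closed(2,5) Q.polys_sum) auto
  moreover have "poly.coeff f k = of_nat m ^ k" by (simp add: f_def Polynomial.coeff_sum)
  then have "f \<noteq> 0" using m(1) by auto
  moreover have "poly f \<theta> = 0"
    using k(2) by (simp add: f_def poly_sum poly_monom power_mult_distrib mult_ac)
  ultimately show thesis using that by blast
qed

text \<open>When \<open>\<sigma>\<close> permutes \<open>S\<close>, the coefficients of the product
  are fixed by \<open>\<sigma>\<close>; this is how the orbit polynomial of a generator of
  \<open>F\<close> gets rational coefficients.\<close>

lemma (in complex_subfield) linear_factors_field_aut:
  assumes s: "field_aut L \<sigma>" and S: "finite S" "S \<subseteq> L"
  shows "poly.coeff (\<Prod>s\<in>S. [:- s, 1:]) i \<in> L \<and>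
    \<sigma> (poly.coeff (\<Prod>s\<in>S. [:- s, 1:]) i) = poly.coeff (\<Prod>s\<in>S. [:- \<sigma> s, 1:]) i"
  using S
proof (induction S arbitrary: i rule: finite_induct)
  case empty
  then show ?case using field_autD(2,6)[OF s] by (simp add: Polynomial.coeff_1)
next
  case (insert t S)
  define f g where "f = (\<Prod>s\<in>S. [:- s, 1:])" and "g = (\<Prod>s\<in>S. [:- \<sigma> s, 1:])"
  have t: "t \<in> L" using insert.prems by simp
  have f: "poly.coeff f j \<in> L" "\<sigma> (poly.coeff f j) = poly.coeff g j" for j
    using insert by (auto simp: f_def g_def)
  have c: "poly.coeff ([:- a, 1:] * h) i = (case i of 0 \<Rightarrow> 0 | Suc j \<Rightarrow> poly.coeff h j) - a * poly.coeff h i"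
    for a :: complex and h by (simp add: coeff_pCons split: nat.splits)
  have "poly.coeff ([:- t, 1:] * f) i \<in> L \<and> \<sigma> (poly.coeff ([:- t, 1:] * f) i) = poly.coeff ([:- \<sigma> t, 1:] * g) i"
    unfolding c using f t by (cases i) (simp_all add: field_autD[OF s])
  then show ?case unfolding f_def g_def by (simp only: prod.insert[OF insert.hyps(1,2)])
qed

lemma galois_group_subset_embeddings:
  assumes L: "subfield L CC" and k: "k \<subseteq> L"
  shows "carrier (galois_group k L) \<subseteq> embeddings k L"
proof
  fix \<sigma> assume "\<sigma> \<in> carrier (galois_group k L)"
  then have s: "\<sigma> \<in> extensional L" "field_aut L \<sigma>" "\<forall>a\<in>k. \<sigma> a = a"
    using complex_subfield.galois_group_eq[OF complex_subfield.intro[OF L] k] by auto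
  then have "\<sigma> \<in> Ring.ring_hom (CC\<lparr>carrier := L\<rparr>) CC"
    by (intro Ring.ring_hom_memI) (auto simp: field_aut_def)
  then show "\<sigma> \<in> embeddings k L" using s unfolding embeddings_def by blast
qed

lemma embeddings_eq_galois_group:
  assumes L: "subfield L CC" and k: "subfield k CC" "k \<subseteq> L"
    and im: "\<And>\<sigma>. \<sigma> \<in> embeddings k L \<Longrightarrow> \<sigma> ` L = L"
  shows "embeddings k L = carrier (galois_group k L)"
proof
  show "carrier (galois_group k L) \<subseteq> embeddings k L" by (rule galois_group_subset_embeddings[OF L k(2)])
  show "embeddings k L \<subseteq> carrier (galois_group k L)"
  proof
    fix \<sigma> assume s: "\<sigma> \<in> embeddings k L"
    interpret k: complex_subfield k by (rule complex_subfield.intro[OF k(1)])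
    note d = k.embeddingsD[OF s]
    have "field_aut L \<sigma>" unfolding field_aut_def using im[OF s] d(1-3) by blast
    then show "\<sigma> \<in> carrier (galois_group k L)"
      unfolding complex_subfield.galois_group_eq[OF complex_subfield.intro[OF L] k(2)] using d(4,5) by blast
  qed
qed

text \<open>The extension is generated by any irrational \<open>\<theta>\<close>, as its degree is prime.\<close>

lemma cyclic_prime_generator:
  assumes cyc: "cyclic_extension p \<rat> F" and p: "Factorial_Ring.prime (p::nat)"
  obtains \<theta> S where "F = generate_field CC (insert \<theta> \<rat>)" "finite S" "\<theta> \<in> S" "S \<subseteq> F" "card S \<le> p"
    "(\<Prod>s\<in>S. [:- s, 1:]) \<in> complex_subfield.polys \<rat>"
proof -
  have F: "subfield F CC" and dim: "CC.dimension p \<rat> F"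
    and fixed: "{a \<in> F. \<forall>\<sigma>\<in>carrier (galois_group \<rat> F). \<sigma> a = a} = \<rat>"
    using cyc by (auto simp: cyclic_extension_def)
  have QF: "\<rat> \<subseteq> F" by (rule Rats_subset_subfield[OF F])
  interpret F: number_field F p
    by (rule number_field.intro[OF complex_subfield.intro[OF F]]) (unfold_locales, rule dim)
  interpret Q: complex_subfield \<rat> by (rule complex_subfield.intro[OF subfield_Rats])
  have "F \<noteq> \<rat>"
  proof
    assume "F = \<rat>"
    then have "p = 1" using CC.dimension_is_inj[OF subfield_Rats dim] CC.dimension_one[OF subfield_Rats] by simp
    then show False using p by simp
  qed
  then obtain \<theta> where t: "\<theta> \<in> F" "\<theta> \<notin> \<rat>" using QF by blast
  obtain f where f: "f \<in> Q.polys" "f \<noteq> 0" "poly f \<theta> = 0"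
    using algebraic_over_Rats[OF F.number_field_axioms t(1)] .
  obtain g where g: "g \<in> Q.polys" "lead_coeff g = 1" "poly g \<theta> = 0" "degree g > 0" "degree g \<le> degree f"
    "\<And>h. h \<in> Q.polys \<Longrightarrow> poly h \<theta> = 0 \<Longrightarrow> g dvd h"
    using Q.minimal_polynomial[OF f] by blast
  let ?E = "generate_field CC (insert \<theta> \<rat>)"
  have EA: "?E = Q.adjoin \<theta>" by (rule Q.adjoin_field(2)[OF f])
  have dE: "CC.dimension (degree g) \<rat> ?E" unfolding EA by (rule Q.dimension_adjoin[OF g(1-3,6)])
  have sE: "subfield ?E CC" by (rule generate_field_CC(1))
  have EF: "?E \<subseteq> F" by (rule generate_field_CC(3)[OF F]) (use t QF in auto)
  have QE: "\<rat> \<subseteq> ?E" by (rule Rats_subset_subfield[OF sE])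
  \<comment> \<open>Degrees multiply, so \<open>degree g\<close> divides the prime \<open>p\<close>.
    It is not 1 since \<open>\<theta>\<close> is irrational; hence it is \<open>p\<close>, and
    \<open>F\<close> has dimension 1 over the field generated by \<open>\<theta>\<close>.\<close>
  obtain m where m: "CC.dimension m ?E F"
    using dimension_over_intermediate[OF subfield_Rats sE F QE EF dim] .
  have pm: "p = degree g * m"
    using CC.dimension_is_inj[OF subfield_Rats dim CC.telescopic_base[OF subfield_Rats sE dE m]] .
  have "degree g \<noteq> 1"
  proof
    assume d1: "degree g = 1"
    have "poly g \<theta> = poly.coeff g 0 + poly.coeff g 1 * \<theta>"
      unfolding poly_altdef d1 by simp
    then have "\<theta> = - poly.coeff g 0" using g(2,3) d1 by (simp add: eq_neg_iff_add_eq_0 add.commute)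
    moreover have "poly.coeff g 0 \<in> \<rat>" using g(1) by (simp add: Q.polys_def)
    ultimately show False using t(2) by simp
  qed
  then have dg: "degree g = p" using p pm by (metis dvd_triv_left prime_nat_iff)
  then have "m = 1" using pm p prime_gt_0_nat by fastforce
  then have FE: "F = ?E"
    using CC.dimension_one[OF sE] m
  proof -
    have m1: "CC.dimension 1 ?E F" using m \<open>m = 1\<close> by simp
    have i1: "CC.independent ?E [1]"
      by (rule CC.li_Cons) auto
    have "CC.Span ?E [1] = F"
      using CC.independent_length_eq_dimension[OF sE m1 i1] F.L_closed(1) by simp
    moreover have "CC.Span ?E [1] \<subseteq> ?E"
    proof
      fix a assume "a \<in> CC.Span ?E [1]"
      then obtain Ks where "set Ks \<subseteq> ?E" "length Ks = length [1::complex]" "a = CC.combine Ks [1]"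
        using CC.Span_mem_iff_length_version[OF sE, of "[1]" a] by auto
      then show "a \<in> ?E" by (cases Ks) auto
    qed
    ultimately show ?thesis using EF by blast
  qed
  let ?C = "carrier (galois_group \<rat> F)"
  \<comment> \<open>The Galois orbit of \<open>\<theta>\<close>. Its members are roots of
    \<open>g\<close>, so there are at most \<open>p\<close>; the coefficients of the product of its
    linear factors are invariant and thus lie in the fixed field \<open>\<rat>\<close>.\<close>
  define S where "S = (\<lambda>\<sigma>. \<sigma> \<theta>) ` ?C"
  have CD: "field_aut F \<sigma>" "\<sigma> \<in> embeddings \<rat> F" if "\<sigma> \<in> ?C" for \<sigma>
    using that F.galois_group_eq[OF QF] galois_group_subset_embeddings[OF F QF] by auto
  have root: "S \<subseteq> {z. poly g z = 0}"
    unfolding S_def using Q.embedding_poly[OF CD(2) F QF g(1) t(1)] g(3) F.field_autD(6)[OF CD(1)] by force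
  have g0: "g \<noteq> 0" using g(2) by auto
  have finS: "finite S" by (rule finite_subset[OF root poly_roots_finite[OF g0]])
  have "card S \<le> card {z. poly g z = 0}" by (rule card_mono[OF poly_roots_finite[OF g0] root])
  also have "\<dots> \<le> p" using card_poly_roots_bound[OF g0] dg by simp
  finally have cS: "card S \<le> p" .
  have SF: "S \<subseteq> F" unfolding S_def using F.field_autD(5)[OF CD(1) t(1)] by blast
  note gr = F.group_galois_group[OF QF]
  interpret Gal: group "galois_group \<rat> F" by (rule gr(1))
  have "(\<lambda>a\<in>F. a) \<in> ?C" using Gal.one_closed gr(3) by simp
  then have tS: "\<theta> \<in> S" unfolding S_def using t(1) by (force intro: image_eqI[of _ _ "\<lambda>a\<in>F. a"])
  have perm: "\<sigma> ` S = S" if s: "\<sigma> \<in> ?C" for \<sigma>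
  proof (rule endo_inj_surj[OF finS])
    show "\<sigma> ` S \<subseteq> S"
    proof
      fix z assume "z \<in> \<sigma> ` S"
      then obtain \<rho> where r: "\<rho> \<in> ?C" "z = \<sigma> (\<rho> \<theta>)" unfolding S_def by blast
      then have "z = compose F \<sigma> \<rho> \<theta>" using t(1) by (simp add: compose_def)
      moreover have "compose F \<sigma> \<rho> \<in> ?C" using Gal.m_closed[OF s r(1)] gr(2)[OF s r(1)] by simp
      ultimately show "z \<in> S" unfolding S_def by blast
    qed
    show "inj_on \<sigma> S" by (rule inj_on_subset[OF F.field_autD(9)[OF CD(1)[OF s]] SF])
  qed
  have "poly.coeff (\<Prod>s\<in>S. [:- s, 1:]) i \<in> {a \<in> F. \<forall>\<sigma>\<in>?C. \<sigma> a = a}" for i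
  proof (intro CollectI conjI ballI)
    show "poly.coeff (\<Prod>s\<in>S. [:- s, 1:]) i \<in> F"
      using F.linear_factors_field_aut[OF F.field_aut_id finS SF] by blast
    fix \<sigma> assume s: "\<sigma> \<in> ?C"
    have inj: "inj_on \<sigma> S" by (rule inj_on_subset[OF F.field_autD(9)[OF CD(1)[OF s]] SF])
    have "(\<Prod>s\<in>S. [:- \<sigma> s, 1:]) = (\<Prod>s\<in>\<sigma> ` S. [:- s, 1:])" by (simp add: prod.reindex[OF inj])
    then show "\<sigma> (poly.coeff (\<Prod>s\<in>S. [:- s, 1:]) i) = poly.coeff (\<Prod>s\<in>S. [:- s, 1:]) i"
      using F.linear_factors_field_aut[OF CD(1)[OF s] finS SF, of i] perm[OF s] by simp
  qed
  then have "(\<Prod>s\<in>S. [:- s, 1:]) \<in> Q.polys" unfolding fixed Q.polys_def by simp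
  then show thesis using that FE finS tS SF cS by blast
qed

section \<open>Automorphisms on generators and the degrees in the tower\<close>

lemma (in complex_subfield) subfield_field_aut_eq:
  assumes "field_aut L \<sigma>" "field_aut L \<rho>"
  shows "subfield {a \<in> L. \<sigma> a = \<rho> a} CC"
proof -
  note s = field_autD[OF assms(1)] and r = field_autD[OF assms(2)]
  have "\<sigma> (inverse a) = \<rho> (inverse a)" if a: "a \<in> L" "\<sigma> a = \<rho> a" for a
  proof (cases "a = 0")
    case False
    have "\<sigma> a * \<sigma> (inverse a) = 1" using s(4)[of a "inverse a"] a s(2) False by simp
    moreover have "\<rho> a * \<rho> (inverse a) = 1" using r(4)[of a "inverse a"] a r(2) False by simp
    ultimately show ?thesis using a(2) s(10)[OF a(1)] False by (metis mult_left_cancel)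
  qed (simp add: s(6) r(6))
  then show ?thesis unfolding subfield_CC_iff using s r by auto
qed

text \<open>An automorphism maps a generated field into \<open>E\<close> as soon as it maps the
  generators there. This gives the stability of \<open>K\<close> under \<open>\<tau>\<close> and of
  \<open>F\<close> under the automorphisms of \<open>L\<close> over \<open>K\<close>.\<close>

lemma (in complex_subfield) subfield_field_aut_vimage:
  assumes s: "field_aut L \<sigma>" and E: "subfield E CC"
  shows "subfield {a \<in> L. \<sigma> a \<in> E} CC"
proof -
  interpret E: complex_subfield E by (rule complex_subfield.intro[OF E])
  note f = field_autD[OF s]
  have "\<sigma> (inverse a) \<in> E" if a: "a \<in> L" "\<sigma> a \<in> E" for a
  proof (cases "a = 0")
    case False
    have "\<sigma> a * \<sigma> (inverse a) = 1" using f(4)[of a "inverse a"] a f(2) False by simp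
    then have "\<sigma> (inverse a) = inverse (\<sigma> a)" by (metis inverse_unique)
    then show ?thesis using a by simp
  qed (simp add: f(6))
  then show ?thesis unfolding subfield_CC_iff using f by auto
qed

text \<open>The powers of \<open>z\<close> below \<open>m\<close> are distinct, so they exhaust the
  \<open>m\<close> complex roots of unity.\<close>

lemma root_of_unity_power:
  assumes z: "primitive_root_of_unity m z" and m: "m > 0" and w: "w ^ m = 1"
  obtains k where "w = z ^ k"
proof -
  have zm: "z ^ m = 1" and pz: "\<And>k. 0 < k \<Longrightarrow> k < m \<Longrightarrow> z ^ k \<noteq> 1"
    using z by (auto simp: primitive_root_of_unity_def)
  have z0: "z \<noteq> 0" using zm m by (cases "z = 0") (auto simp: power_0_left)
  have ne: "z ^ i \<noteq> z ^ j" if "i < j" "j < m" for i j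
  proof
    assume "z ^ i = z ^ j"
    moreover have "z ^ j = z ^ i * z ^ (j - i)" using that by (simp flip: power_add)
    ultimately have "z ^ (j - i) = 1" using z0 by simp
    then show False using pz[of "j - i"] that by simp
  qed
  have inj: "inj_on (\<lambda>k. z ^ k) {..<m}"
    by (rule inj_onI) (metis ne lessThan_iff linorder_neqE_nat)
  have "(\<lambda>k. z ^ k) ` {..<m} = {w. w ^ m = 1}"
  proof (rule card_subset_eq)
    show "finite {w::complex. w ^ m = 1}" by (rule finite_roots_unity) (use m in simp)
    show "(\<lambda>k. z ^ k) ` {..<m} \<subseteq> {w. w ^ m = 1}"
      using zm by (auto simp: power_commuting_commutes power_mult[symmetric] mult.commute[of _ m])
        (simp add: power_mult)
    show "card ((\<lambda>k. z ^ k) ` {..<m}) = card {w::complex. w ^ m = 1}"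
      using card_image[OF inj] card_roots_unity_eq[OF m] by simp
  qed
  then have "w \<in> (\<lambda>k. z ^ k) ` {..<m}" using w by simp
  then show thesis using that by blast
qed

text \<open>\<open>f\<close> is \<open>1 + X + ... + X ^ (p - 1)\<close>; it vanishes at
  \<open>\<zeta>\<close> because its product with \<open>X - 1\<close> does and
  \<open>\<zeta> \<noteq> 1\<close>. Its degree bounds that of the minimal polynomial.\<close>

lemma cyclotomic_dimension:
  assumes p: "Factorial_Ring.prime (p::nat)" and z: "primitive_root_of_unity p \<zeta>"
  obtains d where "0 < d" "d \<le> p - 1" "CC.dimension d \<rat> (generate_field CC {\<zeta>})"
proof -
  interpret Q: complex_subfield \<rat> by (rule complex_subfield.intro[OF subfield_Rats])
  have p1: "p > 1" using p prime_gt_1_nat by blast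
  have zp: "\<zeta> ^ p = 1" "\<zeta> \<noteq> 1" using z p1 unfolding primitive_root_of_unity_def by force+
  define f where "f = (\<Sum>k<p. Polynomial.monom (1::complex) k)"
  have c: "poly.coeff f j = (if j < p then 1 else 0)" for j by (simp add: f_def Polynomial.coeff_sum)
  have fQ: "f \<in> Q.polys" by (simp add: Q.polys_def c)
  have f0: "f \<noteq> 0" using c[of 0] p1 by auto
  have df: "degree f \<le> p - 1" by (rule degree_le) (use c in auto)
  have "poly f \<zeta> * (\<zeta> - 1) = 0"
    using zp(1) power_diff_1_eq[of \<zeta> p] by (simp add: f_def poly_sum poly_monom mult.commute)
  then have fz: "poly f \<zeta> = 0" using zp(2) by simp
  obtain g where g: "g \<in> Q.polys" "lead_coeff g = 1" "poly g \<zeta> = 0" "degree g > 0" "degree g \<le> degree f"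
    "\<And>h. h \<in> Q.polys \<Longrightarrow> poly h \<zeta> = 0 \<Longrightarrow> g dvd h"
    using Q.minimal_polynomial[OF fQ f0 fz] by blast
  have "generate_field CC {\<zeta>} = generate_field CC (insert \<zeta> \<rat>)"
  proof
    show "generate_field CC {\<zeta>} \<subseteq> generate_field CC (insert \<zeta> \<rat>)"
      by (rule generate_field_CC(3)[OF generate_field_CC(1)]) (use generate_field_CC(2) in blast)
    show "generate_field CC (insert \<zeta> \<rat>) \<subseteq> generate_field CC {\<zeta>}"
      by (rule generate_field_CC(3)[OF generate_field_CC(1)])
        (use generate_field_CC(2)[of "{\<zeta>}"] Rats_subset_subfield[OF generate_field_CC(1)[of "{\<zeta>}"]] in blast)
  qed
  also have "\<dots> = Q.adjoin \<zeta>" by (rule Q.adjoin_field(2)[OF fQ f0 fz])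
  finally have "CC.dimension (degree g) \<rat> (generate_field CC {\<zeta>})"
    using Q.dimension_adjoin[OF g(1-3,6)] by simp
  then show thesis using that[of "degree g"] g(4,5) df by simp
qed

text \<open>The point is that \<open>L\<close> has degree exactly \<open>p\<close> over
  \<open>K\<close>. A generator of \<open>F\<close> also generates \<open>L\<close> over
  \<open>K\<close>, and its at most \<open>p\<close> conjugates bound the degree \<open>d\<close> by
  \<open>p\<close>. Passing through \<open>F\<close> instead, \<open>p\<close> divides
  \<open>nK * d\<close>; as \<open>0 < nK < p\<close>, it divides \<open>d\<close>.\<close>

lemma cyclic_tower_compositum:
  assumes p: "Factorial_Ring.prime p" "odd p" and cyc: "cyclic_extension p \<rat> F"
    and z: "primitive_root_of_unity p \<zeta>" and K: "K = generate_field CC {\<zeta>}"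
    and L: "L = generate_field CC (F \<union> K)" and tau: "\<tau> \<in> carrier (galois_group F L)"
    and e: "residue_primroot p e"
  obtains nL nK where "cyclic_tower L nL K nK p e \<tau>"
proof -
  have sF: "subfield F CC" and dF: "CC.dimension p \<rat> F" using cyc by (auto simp: cyclic_extension_def)
  have sK: "subfield K CC" and zK: "\<zeta> \<in> K" using generate_field_CC(1,2)[of "{\<zeta>}"] K by auto
  have sL: "subfield L CC" and FL: "F \<subseteq> L" and KL: "K \<subseteq> L" using generate_field_CC(1,2)[of "F \<union> K"] L by auto
  interpret K: complex_subfield K by (rule complex_subfield.intro[OF sK])
  interpret L: complex_subfield L by (rule complex_subfield.intro[OF sL])
  interpret Q: complex_subfield \<rat> by (rule complex_subfield.intro[OF subfield_Rats])
  have min: "L \<subseteq> E" if "subfield E CC" "F \<subseteq> E" "\<zeta> \<in> E" for E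
  proof -
    have "K \<subseteq> E" unfolding K by (rule generate_field_CC(3)[OF that(1)]) (use that(3) in simp)
    then show ?thesis unfolding L by (intro generate_field_CC(3)[OF that(1)]) (use that(2) in simp)
  qed
  obtain \<theta> S where S: "F = generate_field CC (insert \<theta> \<rat>)" "finite S" "\<theta> \<in> S" "S \<subseteq> F" "card S \<le> p"
    "(\<Prod>s\<in>S. [:- s, 1:]) \<in> Q.polys"
    using cyclic_prime_generator[OF cyc p(1)] by blast
  have QK: "\<rat> \<subseteq> K" by (rule Rats_subset_subfield[OF sK])
  have LK: "L = generate_field CC (insert \<theta> K)"
  proof
    let ?E = "generate_field CC (insert \<theta> K)"
    have E: "subfield ?E CC" "insert \<theta> K \<subseteq> ?E" using generate_field_CC(1,2) by blast+
    have "F \<subseteq> ?E" unfolding S(1) by (rule generate_field_CC(3)[OF E(1)]) (use E(2) QK in blast)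
    then show "L \<subseteq> ?E" using min[OF E(1)] E(2) zK by blast
    show "?E \<subseteq> L" by (rule generate_field_CC(3)[OF sL]) (use S(3,4) FL KL in blast)
  qed
  have SK: "(\<Prod>s\<in>S. [:- s, 1:]) \<in> K.polys" using S(6) QK unfolding Q.polys_def K.polys_def by blast
  have SL: "S \<subseteq> L" using S(4) FL by blast
  obtain d where d: "0 < d" "d \<le> card S" "CC.dimension d K L" "finite (embeddings K L)" "card (embeddings K L) = d"
    "\<And>\<sigma>. \<sigma> \<in> embeddings K L \<Longrightarrow> \<sigma> ` L = L"
    "\<And>a. a \<in> L \<Longrightarrow> (\<And>\<sigma>. \<sigma> \<in> embeddings K L \<Longrightarrow> \<sigma> a = a) \<Longrightarrow> a \<in> K"
    using K.simple_normal_extension[OF S(2,3) SK SL LK] by blast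
  obtain nK where nK: "0 < nK" "nK \<le> p - 1" "CC.dimension nK \<rat> K"
    using cyclotomic_dimension[OF p(1) z] K by blast
  have dL: "CC.dimension (nK * d) \<rat> L" by (rule CC.telescopic_base[OF subfield_Rats sK nK(3) d(3)])
  obtain m where m: "CC.dimension m F L"
    using dimension_over_intermediate[OF subfield_Rats sF sL Rats_subset_subfield[OF sF] FL dL] .
  have "nK * d = p * m"
    using CC.dimension_is_inj[OF subfield_Rats dL CC.telescopic_base[OF subfield_Rats sF dF m]] .
  then have "p dvd nK * d" by simp
  moreover have "\<not> p dvd nK" using nK(1,2) by (auto dest: dvd_imp_le)
  ultimately have "p dvd d" using p(1) by (simp add: prime_dvd_mult_iff)
  then have dp: "d = p" using d(1,2) S(5) dvd_imp_le[of p d] by linarith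
  have emb: "embeddings K L = carrier (galois_group K L)"
    by (rule embeddings_eq_galois_group[OF sL sK KL d(6)])
  have ta: "field_aut L \<tau>" and tF: "\<And>a. a \<in> F \<Longrightarrow> \<tau> a = a"
    using tau unfolding L.galois_group_eq[OF FL] by auto
  note t = L.field_autD[OF ta]
  have p0: "p > 0" using p(1) prime_gt_0_nat by blast
  have zL: "\<zeta> \<in> L" using zK KL by blast
  have zp: "\<zeta> ^ p = 1" "\<zeta> \<noteq> 1" using z prime_gt_1_nat[OF p(1)] unfolding primitive_root_of_unity_def by force+
  have "(\<tau> \<zeta>) ^ p = 1" using t(13)[OF zL, of p] zp(1) t(2) by simp
  then obtain k where k: "\<tau> \<zeta> = \<zeta> ^ k" using root_of_unity_power[OF z p0] by blast
  have "\<not> p dvd k"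
  proof
    assume "p dvd k"
    then have "\<tau> \<zeta> = 1" using k zp(1) by (auto simp: power_mult)
    then have "\<tau> \<zeta> = \<tau> 1" using t(2) by simp
    then show False using inj_onD[OF t(9) _ zL] zp(2) by auto
  qed
  then have "[k ^ (p - 1) = 1] (mod p)" by (rule fermat_theorem[OF p(1)])
  \<comment> \<open>\<open>\<tau>\<close> raises \<open>\<zeta>\<close> to the power
    \<open>k\<close>, so its iterate \<open>p - 1\<close> raises it to the power
    \<open>k ^ (p - 1)\<close>, which exceeds 1 by a multiple of \<open>p\<close> and hence leaves
    \<open>\<zeta>\<close> unchanged.\<close>
  then obtain c where c: "k ^ (p - 1) = 1 + c * p"
    using prime_gt_1_nat[OF p(1)] by (metis (no_types, lifting) cong_def mod_less mult.commute div_mult_mod_eq add.commute)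
  have pow: "(\<tau> ^^ j) \<zeta> = \<zeta> ^ (k ^ j)" for j
  proof (induction j)
    case (Suc j)
    have "(\<tau> ^^ Suc j) \<zeta> = \<tau> (\<zeta> ^ (k ^ j))" using Suc by simp
    also have "\<dots> = (\<zeta> ^ k) ^ (k ^ j)" using t(13)[OF zL] k by simp
    finally show ?case by (simp add: power_mult)
  qed simp
  have "(\<tau> ^^ (p - 1)) \<zeta> = \<zeta>"
    unfolding pow c using zp(1) by (simp add: power_add power_mult mult.commute[of c])
  moreover have "(\<tau> ^^ j) a = a" if "a \<in> F" for a j by (induction j) (use tF that in auto)
  ultimately have "L \<subseteq> {a \<in> L. (\<tau> ^^ (p - 1)) a = (\<lambda>a. a) a}"
    using FL zL by (intro min L.subfield_field_aut_eq L.field_aut_funpow ta L.field_aut_id) auto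
  then have order: "(\<tau> ^^ (p - 1)) a = a" if "a \<in> L" for a using that by blast
  have "\<zeta> ^ k \<in> K" using zK by simp
  then have "{\<zeta>} \<subseteq> {a \<in> L. \<tau> a \<in> K}" using zL k by simp
  then have "K \<subseteq> {a \<in> L. \<tau> a \<in> K}"
    using generate_field_CC(3)[OF L.subfield_field_aut_vimage[OF ta sK]] K by metis
  then have tK: "\<tau> a \<in> K" if "a \<in> K" for a using that by blast
  have "\<tau> ` K = K"
  proof
    show "\<tau> ` K \<subseteq> K" using tK by blast
    show "K \<subseteq> \<tau> ` K"
    proof
      fix a assume a: "a \<in> K"
      have "(\<tau> ^^ j) a \<in> K" for j by (induction j) (use a tK in auto)
      moreover have "a = \<tau> ((\<tau> ^^ (p - 2)) a)"
      proof -
        have "p - 1 = Suc (p - 2)" using prime_gt_1_nat[OF p(1)] by simp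
        then show ?thesis using order[of a] a KL by auto
      qed
      ultimately show "a \<in> \<tau> ` K" by blast
    qed
  qed
  \<comment> \<open>On \<open>F\<close> both sides equal \<open>\<sigma> a\<close>, since
    \<open>\<sigma>\<close> maps \<open>F\<close> into itself and \<open>\<tau>\<close> is trivial
    there; at \<open>\<zeta>\<close> both equal \<open>\<tau> \<zeta>\<close>, since
    \<open>\<sigma>\<close> is trivial on \<open>K\<close>. The set of agreement is a subfield
    containing these generators of \<open>L\<close>.\<close>
  moreover have "\<sigma> (\<tau> a) = \<tau> (\<sigma> a)" if s: "\<sigma> \<in> embeddings K L" and a: "a \<in> L" for \<sigma> a
  proof -
    have sa: "field_aut L \<sigma>" using s unfolding emb L.galois_group_eq[OF KL] by blast
    note sd = K.embeddingsD[OF s]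
    have "poly (\<Prod>s\<in>S. [:- s, 1:]) (\<sigma> \<theta>) = \<sigma> (poly (\<Prod>s\<in>S. [:- s, 1:]) \<theta>)"
      by (rule K.embedding_poly[OF s sL KL SK, symmetric]) (use S(3) SL in blast)
    also have "poly (\<Prod>s\<in>S. [:- s, 1:]) \<theta> = 0" using S(2,3) by (auto simp: poly_prod)
    also have "\<sigma> 0 = 0" by (rule L.field_autD(6)[OF sa])
    finally have "\<sigma> \<theta> \<in> S" using S(2) by (auto simp: poly_prod)
    moreover have "\<sigma> a = a" if "a \<in> \<rat>" for a by (rule sd(4)) (use QK that in blast)
    ultimately have "insert \<theta> \<rat> \<subseteq> {a \<in> L. \<sigma> a \<in> F}"
      using S(3,4) FL Rats_subset_subfield[OF sF] by auto
    then have "F \<subseteq> {a \<in> L. \<sigma> a \<in> F}"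
      using generate_field_CC(3)[OF L.subfield_field_aut_vimage[OF sa sF]] S(1) by blast
    then have "\<sigma> (\<tau> b) = \<tau> (\<sigma> b)" if "b \<in> F" for b using that tF by auto
    moreover have "\<sigma> (\<tau> \<zeta>) = \<tau> (\<sigma> \<zeta>)" using sd(4) tK zK by simp
    ultimately have "L \<subseteq> {a \<in> L. \<sigma> (\<tau> a) = \<tau> (\<sigma> a)}"
      using FL zL by (intro min L.subfield_field_aut_eq[OF L.field_aut_compose[OF sa ta] L.field_aut_compose[OF ta sa]]) auto
    then show ?thesis using a by blast
  qed
  ultimately have "cyclic_tower L (nK * d) K nK p e \<tau>"
    using p e KL nK dL dp d(5,7) emb ta order sL sK
    by unfold_locales (simp_all add: mult.commute)
  then show thesis by (rule that)
qed

theorem theorem3p1: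
  fixes p e n :: nat and \<zeta> x :: complex and F K L :: "complex set"
    and \<tau> :: "complex \<Rightarrow> complex" and q :: "nat \<Rightarrow> nat" and l :: "nat \<Rightarrow> int"
    and P :: "nat \<Rightarrow> nat \<Rightarrow> complex set"
  assumes "Factorial_Ring.prime p" and "odd p"
    and "cyclic_extension p \<rat> F"
    and "primitive_root_of_unity p \<zeta>"
    and "K = generate_field CC {\<zeta>}"
    and "L = generate_field CC (F \<union> K)"
    and "\<tau> \<in> carrier (galois_group F L)"
    and "subgroup_generated (galois_group F L) {\<tau>} = galois_group F L"
    and "residue_primroot p e"
    and "x \<in> L" and "x \<noteq> 0"
    and "\<And>i. i \<in> {1..n} \<Longrightarrow> Factorial_Ring.prime (q i)" and "inj_on q {1..n}"
    and "\<And>i. i \<in> {1..n} \<Longrightarrow> l i \<noteq> 0"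
    and "field_norm \<rat> L x = (\<Prod>i=1..n. of_nat (q i) powi l i) \<or>
         field_norm \<rat> L x = - (\<Prod>i=1..n. of_nat (q i) powi l i)"
    and "\<And>Q. Q \<in> prime_ideals L \<Longrightarrow> ideal_exponents L (principal_ideal L x) Q \<noteq> 0 \<Longrightarrow>
           \<exists>i\<in>{1..n}. lies_above Q (q i)"
    and "\<And>i. i \<in> {1..n} \<Longrightarrow> splits_completely K (q i) \<Longrightarrow>
           cyclic_numbering p K (restrict \<tau> K) (q i) (P i)"
  shows "\<not> (\<exists>I\<in>carrier (ideal_group L).
             principal_ideal L (Phi p e \<tau> (field_norm K L x)) = I [^]\<^bsub>ideal_group L\<^esub> p)
    \<longleftrightarrow> n > 0 \<and>
        (\<exists>i\<in>{1..n}. splits_completely L (q i) \<and>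
           \<not> int p dvd chi p e K (P i)
               (ideal_norm K L (ideal_part L (q i) (principal_ideal L x))))"
proof -
  obtain nL nK where "cyclic_tower L nL K nK p e \<tau>"
    using cyclic_tower_compositum[OF assms(1-7,9)] .
  then interpret cyclic_tower L nL K nK p e \<tau> .
  have "n > 0 \<and> (\<exists>i\<in>{1..n}. A i) \<longleftrightarrow> (\<exists>i\<in>{1..n}. A i)" for A :: "nat \<Rightarrow> bool" by auto
  then show ?thesis using not_power_iff[OF assms(10-12,16,17)] by simp
qed

end
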